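(* Let $n\ge2$, $2\le k\le n$ and let $\Omega\subset\mathbb{R}^n$ be open, bounded, smooth and contractible. Then for any $\omega_0\in W^{1,2}(\Omega;\Lambda^{k-1})$ with $\nu\wedge\omega_0=0$ on $\partial\Omega$ but $\omega_0\ne0$ on $\partial\Omega$ (i.e. the trace of $\omega_0$ on $\partial\Omega$ is not identically zero), the problem $$\inf\left\{I(\omega)=\frac12\int_\Omega|d\omega|^2+\frac12\int_\Omega|\omega|^2:\ \omega\in\omega_0+W^{1,2}_0(\Omega;\Lambda^{k-1})\right\}$$ does not admit a minimizer.
   Context: $\Lambda^{k-1}=\Lambda^{k-1}(\mathbb{R}^n)$ is the space of alternating $(k-1)$-linear forms on $\mathbb{R}^n$ with its Euclidean norm, $d$ is the exterior derivative, and $\nu$ is the outer unit normal on $\partial\Omega$ viewed as a 1-form. $W_0^{1,2}$ is the space of $W^{1,2}$ forms all of whose components have zero trace. *)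

theory Defs
  imports "HOL-Analysis.Analysis"
begin

section \<open>Smooth functions and smooth domains\<close>

text \<open>\<open>\<real>\<^sup>n\<close> is a Euclidean space type \<open>'a\<close> with \<open>n = DIM('a)\<close>; its standard basis is \<open>Basis\<close>.\<close>

definition partial_deriv :: "'a::euclidean_space \<Rightarrow> ('a \<Rightarrow> real) \<Rightarrow> 'a \<Rightarrow> real" where
  "partial_deriv b f x = frechet_derivative f (at x) b"

definition gradient :: "('a::euclidean_space \<Rightarrow> real) \<Rightarrow> 'a \<Rightarrow> 'a" where
  "gradient f x = (\<Sum>b\<in>Basis. partial_deriv b f x *\<^sub>R b)"

primrec Ck_fun :: "nat \<Rightarrow> ('a::euclidean_space \<Rightarrow> real) \<Rightarrow> bool" where
  "Ck_fun 0 f = continuous_on UNIV f"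
| "Ck_fun (Suc k) f =
     ((\<forall>x. f differentiable (at x)) \<and> (\<forall>b\<in>Basis. Ck_fun k (partial_deriv b f)))"

definition smooth_fun :: "('a::euclidean_space \<Rightarrow> real) \<Rightarrow> bool" where
  "smooth_fun f \<longleftrightarrow> (\<forall>k. Ck_fun k f)"

definition test_fun :: "'a::euclidean_space set \<Rightarrow> ('a \<Rightarrow> real) \<Rightarrow> bool" where
  "test_fun \<Omega> \<phi> \<longleftrightarrow> smooth_fun \<phi> \<and>
     compact (closure {x. \<phi> x \<noteq> 0}) \<and> closure {x. \<phi> x \<noteq> 0} \<subseteq> \<Omega>"

text \<open>Near \<open>p\<close> the set \<open>\<Omega>\<close> is the region above the graph of a smooth function of the remaining
  \<open>n - 1\<close> coordinates, after relabelling and reorienting the axes so that \<open>e\<close> is the last one.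
  A function of the remaining coordinates is encoded as a function on the whole space that does
  not depend on the coordinate along \<open>e\<close>.\<close>

definition boundary_graph ::
  "'a::euclidean_space set \<Rightarrow> 'a \<Rightarrow> real \<Rightarrow> 'a \<Rightarrow> ('a \<Rightarrow> real) \<Rightarrow> bool" where
  "boundary_graph \<Omega> p r e \<gamma> \<longleftrightarrow>
     0 < r \<and> (e \<in> Basis \<or> - e \<in> Basis) \<and> smooth_fun \<gamma> \<and>
     (\<forall>x t. \<gamma> (x + t *\<^sub>R e) = \<gamma> x) \<and>
     \<Omega> \<inter> ball p r = {x \<in> ball p r. \<gamma> x < x \<bullet> e}"

definition smooth_boundary :: "'a::euclidean_space set \<Rightarrow> bool" where
  "smooth_boundary \<Omega> \<longleftrightarrow> (\<forall>p\<in>frontier \<Omega>. \<exists>r e \<gamma>. boundary_graph \<Omega> p r e \<gamma>)"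

text \<open>In a chart, \<open>\<Omega>\<close> is the sublevel set \<open>\<gamma> x - x \<bullet> e < 0\<close>, so the normalised gradient
  of \<open>\<gamma> x - x \<bullet> e\<close> points outwards. Here \<open>gradient \<gamma> p \<bottom> e\<close>, so it does not vanish, and the
  normalised vector does not depend on the chart.\<close>

definition outer_normal :: "'a::euclidean_space set \<Rightarrow> 'a \<Rightarrow> 'a" where
  "outer_normal \<Omega> p =
     (THE \<nu>. \<exists>r e \<gamma>. boundary_graph \<Omega> p r e \<gamma> \<and> \<nu> = sgn (gradient \<gamma> p - e))"


section \<open>Surface measure\<close>

text \<open>The surface measure on the boundary is the \<open>(n - 1)\<close>-dimensional Hausdorff measure,
  normalised so that it agrees with Lebesgue measure on hyperplanes. The empty set is given cost
  zero separately because \<open>0 ^ 0 = 1\<close>.\<close>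

definition hausdorff_cost :: "nat \<Rightarrow> 'a::metric_space set \<Rightarrow> ennreal" where
  "hausdorff_cost s C =
     (if C = {} then 0 else ennreal (unit_ball_vol (real s) * (diameter C / 2) ^ s))"

definition hausdorff_outer :: "nat \<Rightarrow> 'a::metric_space set \<Rightarrow> ennreal" where
  "hausdorff_outer s A =
     (SUP \<delta>\<in>{0<..}. INF C\<in>{C :: nat \<Rightarrow> 'a set.
          (\<forall>j. bounded (C j) \<and> diameter (C j) \<le> \<delta>) \<and> A \<subseteq> (\<Union>j. C j)}.
        (\<Sum>j. hausdorff_cost s (C j)))"

definition hausdorff_measure :: "nat \<Rightarrow> 'a::metric_space measure" where
  "hausdorff_measure s = measure_of UNIV (sets borel) (hausdorff_outer s)"

definition surface_measure :: "'a::euclidean_space set \<Rightarrow> 'a measure" where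
  "surface_measure \<Omega> = restrict_space (hausdorff_measure (DIM('a) - 1)) (frontier \<Omega>)"


section \<open>Sobolev functions and traces\<close>

definition L2_fun :: "'a measure \<Rightarrow> ('a \<Rightarrow> real) \<Rightarrow> bool" where
  "L2_fun M f \<longleftrightarrow> f \<in> borel_measurable M \<and> integrable M (\<lambda>x. (f x)\<^sup>2)"

definition L2_tendsto :: "'a measure \<Rightarrow> (nat \<Rightarrow> 'a \<Rightarrow> real) \<Rightarrow> ('a \<Rightarrow> real) \<Rightarrow> bool" where
  "L2_tendsto M F f \<longleftrightarrow> (\<lambda>j. \<integral>\<^sup>+x. ennreal ((F j x - f x)\<^sup>2) \<partial>M) \<longlonglongrightarrow> 0"

definition is_weak_partial ::
  "'a::euclidean_space set \<Rightarrow> 'a \<Rightarrow> ('a \<Rightarrow> real) \<Rightarrow> ('a \<Rightarrow> real) \<Rightarrow> bool" where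
  "is_weak_partial \<Omega> b u w \<longleftrightarrow> L2_fun (lebesgue_on \<Omega>) w \<and>
     (\<forall>\<phi>. test_fun \<Omega> \<phi> \<longrightarrow>
        (\<integral>x. u x * partial_deriv b \<phi> x \<partial>lebesgue_on \<Omega>) = - (\<integral>x. w x * \<phi> x \<partial>lebesgue_on \<Omega>))"

definition W12 :: "'a::euclidean_space set \<Rightarrow> ('a \<Rightarrow> real) \<Rightarrow> bool" where
  "W12 \<Omega> u \<longleftrightarrow> L2_fun (lebesgue_on \<Omega>) u \<and> (\<forall>b\<in>Basis. \<exists>w. is_weak_partial \<Omega> b u w)"

text \<open>The weak derivative is unique up to null sets; this picks a representative.\<close>

definition weak_partial :: "'a::euclidean_space set \<Rightarrow> 'a \<Rightarrow> ('a \<Rightarrow> real) \<Rightarrow> 'a \<Rightarrow> real" where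
  "weak_partial \<Omega> b u = (SOME w. is_weak_partial \<Omega> b u w)"

text \<open>The trace operator is the continuous extension to \<open>W\<^sup>1\<^sup>,\<^sup>2\<close> of the restriction of smooth
  functions to the boundary, with values in \<open>L\<^sup>2\<close> of the boundary. It is given here by its graph:
  \<open>g\<close> is a representative of the trace of \<open>u\<close>.\<close>

definition has_trace ::
  "'a::euclidean_space set \<Rightarrow> ('a \<Rightarrow> real) \<Rightarrow> ('a \<Rightarrow> real) \<Rightarrow> bool" where
  "has_trace \<Omega> u g \<longleftrightarrow> W12 \<Omega> u \<and> L2_fun (surface_measure \<Omega>) g \<and>
     (\<exists>U :: nat \<Rightarrow> 'a \<Rightarrow> real. (\<forall>j. smooth_fun (U j)) \<and>
        L2_tendsto (lebesgue_on \<Omega>) U u \<and>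
        (\<forall>b\<in>Basis. L2_tendsto (lebesgue_on \<Omega>) (\<lambda>j. partial_deriv b (U j)) (weak_partial \<Omega> b u)) \<and>
        L2_tendsto (surface_measure \<Omega>) U g)"


section \<open>Alternating forms\<close>

text \<open>An \<open>m\<close>-linear form takes its \<open>m\<close> arguments as a list. It is extended by zero to lists of any
  other length, so that equality of forms is equality of functions.\<close>

type_synonym 'a form = "'a list \<Rightarrow> real"

definition alt_form :: "nat \<Rightarrow> 'a::euclidean_space form \<Rightarrow> bool" where
  "alt_form m \<alpha> \<longleftrightarrow>
     (\<forall>vs. length vs \<noteq> m \<longrightarrow> \<alpha> vs = 0) \<and>
     (\<forall>vs i. length vs = m \<and> i < m \<longrightarrow> linear (\<lambda>v. \<alpha> (vs[i := v]))) \<and>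
     (\<forall>vs. length vs = m \<and> \<not> distinct vs \<longrightarrow> \<alpha> vs = 0)"

definition basis_tuples :: "nat \<Rightarrow> 'a::euclidean_space list set" where
  "basis_tuples m = {bs. length bs = m \<and> set bs \<subseteq> Basis}"

text \<open>The Euclidean norm for which the forms \<open>dx\<^sup>I\<close>, \<open>I\<close> increasing, are orthonormal: the sum below
  runs over all multi-indices, so that each increasing one is counted \<open>m!\<close> times.\<close>

definition form_norm :: "nat \<Rightarrow> 'a::euclidean_space form \<Rightarrow> real" where
  "form_norm m \<alpha> = sqrt ((\<Sum>bs\<in>basis_tuples m. (\<alpha> bs)\<^sup>2) / fact m)"

definition omit :: "nat \<Rightarrow> 'a list \<Rightarrow> 'a list" where
  "omit j vs = take j vs @ drop (Suc j) vs"

text \<open>\<open>\<nu> \<and> \<alpha>\<close>, where the vector \<open>\<nu>\<close> stands for the 1-form \<open>v \<mapsto> \<nu> \<bullet> v\<close>.\<close>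

definition wedge_covector :: "'a::euclidean_space \<Rightarrow> 'a form \<Rightarrow> 'a form" where
  "wedge_covector \<nu> \<alpha> vs = (\<Sum>j<length vs. (-1) ^ j * (\<nu> \<bullet> (vs ! j)) * \<alpha> (omit j vs))"


section \<open>Sobolev forms and the functional\<close>

definition W12_form :: "nat \<Rightarrow> 'a::euclidean_space set \<Rightarrow> ('a \<Rightarrow> 'a form) \<Rightarrow> bool" where
  "W12_form m \<Omega> \<omega> \<longleftrightarrow> (\<forall>x\<in>\<Omega>. alt_form m (\<omega> x)) \<and>
     (\<forall>bs\<in>basis_tuples m. W12 \<Omega> (\<lambda>x. \<omega> x bs))"

definition has_form_trace ::
  "nat \<Rightarrow> 'a::euclidean_space set \<Rightarrow> ('a \<Rightarrow> 'a form) \<Rightarrow> ('a \<Rightarrow> 'a form) \<Rightarrow> bool" where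
  "has_form_trace m \<Omega> \<omega> g \<longleftrightarrow> (\<forall>x\<in>frontier \<Omega>. alt_form m (g x)) \<and>
     (\<forall>bs\<in>basis_tuples m. has_trace \<Omega> (\<lambda>x. \<omega> x bs) (\<lambda>x. g x bs))"

definition W12_0_form :: "nat \<Rightarrow> 'a::euclidean_space set \<Rightarrow> ('a \<Rightarrow> 'a form) \<Rightarrow> bool" where
  "W12_0_form m \<Omega> \<phi> \<longleftrightarrow> W12_form m \<Omega> \<phi> \<and> has_form_trace m \<Omega> \<phi> (\<lambda>x vs. 0)"

text \<open>\<open>d\<omega>(v\<^sub>0, \<dots>, v\<^sub>m) = \<Sum>\<^sub>j (-1)\<^sup>j D\<omega>[v\<^sub>j](v\<^sub>0, \<dots>, v\<^sub>m\<close> without \<open>v\<^sub>j)\<close>, with weak derivatives.\<close>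

definition ext_deriv :: "'a::euclidean_space set \<Rightarrow> ('a \<Rightarrow> 'a form) \<Rightarrow> 'a \<Rightarrow> 'a form" where
  "ext_deriv \<Omega> \<omega> x vs =
     (\<Sum>j<length vs. (-1) ^ j *
        (\<Sum>b\<in>Basis. (vs ! j \<bullet> b) * weak_partial \<Omega> b (\<lambda>y. \<omega> y (omit j vs)) x))"

text \<open>The functional on forms of degree \<open>m\<close>.\<close>

definition energy :: "nat \<Rightarrow> 'a::euclidean_space set \<Rightarrow> ('a \<Rightarrow> 'a form) \<Rightarrow> real" where
  "energy m \<Omega> \<omega> =
     1 / 2 * (\<integral>x. (form_norm (Suc m) (ext_deriv \<Omega> \<omega> x))\<^sup>2 \<partial>lebesgue_on \<Omega>) +
     1 / 2 * (\<integral>x. (form_norm m (\<omega> x))\<^sup>2 \<partial>lebesgue_on \<Omega>)"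

definition admissible ::
  "nat \<Rightarrow> 'a::euclidean_space set \<Rightarrow> ('a \<Rightarrow> 'a form) \<Rightarrow> ('a \<Rightarrow> 'a form) set" where
  "admissible m \<Omega> \<omega>\<^sub>0 = {\<lambda>x vs. \<omega>\<^sub>0 x vs + \<phi> x vs | \<phi>. W12_0_form m \<Omega> \<phi>}"

end

theory Submission
  imports Defs
begin

text \<open>
  The infimum is \<open>0\<close>, so a minimizer \<open>\<omega>\<close> would vanish and could not have trace \<open>g \<noteq> 0\<close>. To see this,
  multiply \<open>\<omega>\<close> by functions \<open>\<Psi>\<^sub>n\<close> which equal \<open>1\<close> on \<open>\<partial>\<Omega>\<close> and are supported in strips of width \<open>1/n\<close>;
  then \<open>\<Psi>\<^sub>n \<omega>\<close> is admissible, and the only term of \<open>\<Psi>\<^sub>n \<omega>\<close> and \<open>d(\<Psi>\<^sub>n \<omega>)\<close> which does not obviously tend to \<open>0\<close>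
  in \<open>L\<^sup>2\<close> is \<open>d\<Psi>\<^sub>n \<and> \<omega>\<close>. In a graph chart with height function \<open>s\<close> above the boundary it has size
  \<open>n |ds \<and> \<omega>|\<close>. Since \<open>ds\<close> is parallel to \<open>\<nu>\<close> on \<open>\<partial>\<Omega>\<close>, the form \<open>ds \<and> \<omega>\<close> has zero trace, and Hardy's
  inequality bounds its \<open>L\<^sup>2\<close> norm over the strip by \<open>C/n\<close> times the \<open>L\<^sup>2\<close> norm of its gradient over the strip.
\<close>

section \<open>Smooth functions and cut-offs\<close>

text \<open>The form ds replaces \<nu> because it is smooth on the whole space, whereas \<nu> lives
  on the boundary only: ds \<and> \<omega> is again a Sobolev form, and its trace is ds \<and> g.
  The factor n from the derivative of the cut-off cancels the width 1/n gained in Hardy's inequality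
  exactly, so mere boundedness would result, were it not that the remaining gradient norm is taken
  over strips that shrink to nothing. A second obstacle is that \<open>has_trace\<close> is a
  relation given by approximating sequences. A minimizer that vanishes almost everywhere yields a
  contradiction only once it is known that the zero function has no nonzero trace. Both this and
  Hardy's inequality compare surface measure with the volume of a tube of height 1 over a boundary
  set. Hardy's inequality needs the volume to be at most a multiple of the surface measure;
  uniqueness of the trace needs in addition that zero volume forces zero surface measure.\<close>

lemma partial_deriv_eq: "(f has_derivative f') (at x) \<Longrightarrow> partial_deriv b f x = f' b"
  unfolding partial_deriv_def using frechet_derivative_at by metis

lemma partial_deriv_add:
  assumes "f differentiable at x" "g differentiable at x"
  shows "partial_deriv b (\<lambda>x. f x + g x) x = partial_deriv b f x + partial_deriv b g x"
  unfolding partial_deriv_def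
  using partial_deriv_eq[OF has_derivative_add[OF assms[unfolded frechet_derivative_works]], of b]
  by (simp add: partial_deriv_def)

lemma partial_deriv_mult:
  assumes "f differentiable at x" "g differentiable at x"
  shows "partial_deriv b (\<lambda>x. f x * g x) x = f x * partial_deriv b g x + partial_deriv b f x * g x"
  using partial_deriv_eq[OF has_derivative_mult[OF assms[unfolded frechet_derivative_works]], of b]
  by (simp add: partial_deriv_def)

lemma partial_deriv_const [simp]: "partial_deriv b (\<lambda>x. c) = (\<lambda>x. 0)"
  by (auto simp: partial_deriv_def)

lemma partial_deriv_compose:
  assumes "f differentiable at x" and "(h has_real_derivative h') (at (f x))"
  shows "(\<lambda>x. h (f x)) differentiable at x"
    and "partial_deriv b (\<lambda>x. h (f x)) x = h' * partial_deriv b f x"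
proof -
  have "((\<lambda>x. h (f x)) has_derivative (\<lambda>v. h' * frechet_derivative f (at x) v)) (at x)"
    using has_derivative_compose[OF assms(1)[unfolded frechet_derivative_works]
        assms(2)[unfolded has_field_derivative_def]] by simp
  then show "(\<lambda>x. h (f x)) differentiable at x"
    and "partial_deriv b (\<lambda>x. h (f x)) x = h' * partial_deriv b f x"
    using partial_deriv_eq[of "\<lambda>x. h (f x)"] by (auto simp: differentiable_def partial_deriv_def[of b f])
qed

lemma Ck_fun_SucD: "Ck_fun (Suc k) f \<Longrightarrow> Ck_fun k f"
proof (induction k arbitrary: f)
  case 0
  then show ?case
    by (auto intro!: differentiable_imp_continuous_on simp: differentiable_on_def
        differentiable_at_withinI)
qed auto

lemma smooth_fun_iff:
  "smooth_fun f \<longleftrightarrow>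
    (\<forall>x. f differentiable (at x)) \<and> (\<forall>b\<in>Basis. smooth_fun (partial_deriv b f))"
proof
  assume L: "smooth_fun f"
  show "(\<forall>x. f differentiable (at x)) \<and> (\<forall>b\<in>Basis. smooth_fun (partial_deriv b f))"
    using L[unfolded smooth_fun_def, rule_format, of "Suc _"] by (auto simp: smooth_fun_def)
next
  assume R: "(\<forall>x. f differentiable (at x)) \<and> (\<forall>b\<in>Basis. smooth_fun (partial_deriv b f))"
  then have "Ck_fun (Suc k) f" for k by (auto simp: smooth_fun_def)
  then show "smooth_fun f" unfolding smooth_fun_def using Ck_fun_SucD by blast
qed

lemma smooth_differentiable: "smooth_fun f \<Longrightarrow> f differentiable (at x)"
  by (subst (asm) smooth_fun_iff) auto

lemma smooth_fun_partial: "smooth_fun f \<Longrightarrow> b \<in> Basis \<Longrightarrow> smooth_fun (partial_deriv b f)"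
  by (subst (asm) smooth_fun_iff) auto

lemma smooth_fun_continuous: "smooth_fun f \<Longrightarrow> continuous_on S f"
  by (metis Ck_fun.simps(1) continuous_on_subset smooth_fun_def subset_UNIV)

lemma smooth_fun_measurable: "smooth_fun f \<Longrightarrow> f \<in> borel_measurable borel"
  by (simp add: borel_measurable_continuous_onI smooth_fun_continuous)

lemma smooth_fun_has_derivative:
  "smooth_fun f \<Longrightarrow> (f has_derivative (\<lambda>v. partial_deriv v f x)) (at x)"
  using smooth_differentiable frechet_derivative_works unfolding partial_deriv_def by blast

lemma Ck_fun_const: "Ck_fun k (\<lambda>x. c)"
  by (induction k arbitrary: c) auto

lemma smooth_fun_const [simp]: "smooth_fun (\<lambda>x. c)"
  by (simp add: smooth_fun_def Ck_fun_const)

lemma Ck_fun_add: "Ck_fun k f \<Longrightarrow> Ck_fun k g \<Longrightarrow> Ck_fun k (\<lambda>x. f x + g x)"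
proof (induction k arbitrary: f g)
  case 0 then show ?case by (simp add: continuous_on_add)
next
  case (Suc k)
  then have "partial_deriv b (\<lambda>x. f x + g x) = (\<lambda>x. partial_deriv b f x + partial_deriv b g x)" for b
    by (auto simp: partial_deriv_add)
  with Suc show ?case by (auto intro: differentiable_add)
qed

lemma Ck_fun_mult: "Ck_fun k f \<Longrightarrow> Ck_fun k g \<Longrightarrow> Ck_fun k (\<lambda>x. f x * g x)"
proof (induction k arbitrary: f g)
  case 0 then show ?case by (simp add: continuous_on_mult)
next
  case (Suc k)
  then have "partial_deriv b (\<lambda>x. f x * g x) =
      (\<lambda>x. f x * partial_deriv b g x + partial_deriv b f x * g x)" for b
    by (auto simp: partial_deriv_mult)
  \<comment> \<open>The product rule keeps one factor undifferentiated, so that factor has to be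
    lowered from order \<open>Suc k\<close> to order \<open>k\<close>.\<close>
  with Suc Suc.prems[THEN Ck_fun_SucD] show ?case
    by (auto intro!: Ck_fun_add differentiable_mult)
qed

lemma smooth_fun_add: "smooth_fun f \<Longrightarrow> smooth_fun g \<Longrightarrow> smooth_fun (\<lambda>x. f x + g x)"
  by (simp add: smooth_fun_def Ck_fun_add)

lemma smooth_fun_mult: "smooth_fun f \<Longrightarrow> smooth_fun g \<Longrightarrow> smooth_fun (\<lambda>x. f x * g x)"
  by (simp add: smooth_fun_def Ck_fun_mult)

lemma smooth_fun_diff: "smooth_fun f \<Longrightarrow> smooth_fun g \<Longrightarrow> smooth_fun (\<lambda>x. f x - g x)"
  using smooth_fun_add[of f "\<lambda>x. (-1) * g x"] smooth_fun_mult[of "\<lambda>x. -1" g] by simp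

lemma smooth_fun_sum: "(\<And>i. i \<in> I \<Longrightarrow> smooth_fun (f i)) \<Longrightarrow> smooth_fun (\<lambda>x. \<Sum>i\<in>I. f i x)"
  by (induction I rule: infinite_finite_induct) (auto intro: smooth_fun_add)

lemma smooth_fun_prod: "(\<And>i. i \<in> I \<Longrightarrow> smooth_fun (f i)) \<Longrightarrow> smooth_fun (\<lambda>x. \<Prod>i\<in>I. f i x)"
  by (induction I rule: infinite_finite_induct) (auto intro: smooth_fun_mult)

lemma partial_deriv_inner: "partial_deriv b (\<lambda>x. x \<bullet> v) = (\<lambda>x. b \<bullet> v)"
  by (rule ext, rule partial_deriv_eq) (auto intro!: derivative_eq_intros)

lemma smooth_fun_inner: "smooth_fun (\<lambda>x. x \<bullet> v)"
  by (subst smooth_fun_iff) (auto simp: partial_deriv_inner)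

lemma partial_deriv_diff:
  assumes "f differentiable at x" "g differentiable at x"
  shows "partial_deriv b (\<lambda>x. f x - g x) x = partial_deriv b f x - partial_deriv b g x"
  using partial_deriv_eq[OF has_derivative_diff[OF assms[unfolded frechet_derivative_works]], of b]
  by (simp add: partial_deriv_def)

lemma partial_deriv_sum:
  assumes "\<And>i. i \<in> I \<Longrightarrow> f i differentiable at x"
  shows "partial_deriv b (\<lambda>x. \<Sum>i\<in>I. f i x) x = (\<Sum>i\<in>I. partial_deriv b (f i) x)"
  using partial_deriv_eq[OF has_derivative_sum[OF assms[unfolded frechet_derivative_works]], where b = b]
  by (simp add: partial_deriv_def)

lemma partial_deriv_linear: "f differentiable (at x) \<Longrightarrow> linear (\<lambda>v. partial_deriv v f x)"
  unfolding partial_deriv_def by (simp add: linear_frechet_derivative)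

text \<open>A whole sequence of derivatives is the witness, rather than iterates of
  \<open>deriv\<close>: for the flat exponential this sequence is available in closed form.\<close>

definition smooth_real :: "(real \<Rightarrow> real) \<Rightarrow> bool" where
  "smooth_real h \<longleftrightarrow> (\<exists>H :: nat \<Rightarrow> real \<Rightarrow> real.
     H 0 = h \<and> (\<forall>i t. (H i has_real_derivative H (Suc i) t) (at t)))"

lemma smooth_real_DERIV: "smooth_real h \<Longrightarrow> (h has_real_derivative deriv h t) (at t)"
  unfolding smooth_real_def by (metis DERIV_imp_deriv)

lemma smooth_real_deriv: "smooth_real h \<Longrightarrow> smooth_real (deriv h)"
proof -
  assume "smooth_real h"
  then obtain H where H: "H 0 = h" "\<And>i t. (H i has_real_derivative H (Suc i) t) (at t)"
    unfolding smooth_real_def by blast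
  then have "deriv h = H 1" using DERIV_imp_deriv by fastforce
  with H show ?thesis unfolding smooth_real_def
    by (intro exI[of _ "\<lambda>i. H (Suc i)"]) auto
qed

lemma smooth_real_continuous: "smooth_real h \<Longrightarrow> continuous_on S h"
  by (meson DERIV_continuous continuous_at_imp_continuous_on smooth_real_DERIV)

lemma smooth_fun_compose:
  assumes "smooth_real h" "smooth_fun f"
  shows "smooth_fun (\<lambda>x. h (f x))"
proof -
  obtain H where H: "H 0 = h" "\<And>i t. (H i has_real_derivative H (Suc i) t) (at t)"
    using assms(1) unfolding smooth_real_def by blast
  \<comment> \<open>Quantified over \<open>i\<close>: the chain rule for \<open>H i\<close> produces
    \<open>H (Suc i)\<close>, so the induction on \<open>k\<close> has to cover all members of the
    sequence.\<close>
  have "Ck_fun k f \<Longrightarrow> Ck_fun k (\<lambda>x. H i (f x))" for k i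
  proof (induction k arbitrary: i)
    case 0
    have "continuous_on UNIV (H i)"
      by (meson DERIV_continuous H(2) continuous_at_imp_continuous_on)
    with 0 show ?case
      using continuous_on_compose2[of UNIV "H i" UNIV f] by simp
  next
    case (Suc k)
    have "partial_deriv b (\<lambda>x. H i (f x)) = (\<lambda>x. H (Suc i) (f x) * partial_deriv b f x)" for b
      using Suc.prems by (auto intro!: partial_deriv_compose(2)[OF _ H(2)])
    with Suc.IH Suc.prems Ck_fun_SucD[OF Suc.prems] show ?case
      by (auto intro!: Ck_fun_mult partial_deriv_compose(1)[OF _ H(2)])
  qed
  from this[of _ 0] assms(2) H(1) show ?thesis by (simp add: smooth_fun_def)
qed

text \<open>A family that contains the flat exponential (\<open>P = 1\<close>) and is closed under
  differentiation, so that a single rule yields all derivatives.\<close>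

definition flat_poly :: "real poly \<Rightarrow> real \<Rightarrow> real" where
  "flat_poly P t = (if t \<le> 0 then 0 else poly P (1 / t) * exp (- (1 / t)))"

lemma poly_exp_tendsto_0: "((\<lambda>y. poly P y * exp (- y)) \<longlongrightarrow> 0) at_top" for P :: "real poly"
proof -
  have "((\<lambda>y. \<Sum>i\<le>degree P. coeff P i * (y ^ i / exp y)) \<longlongrightarrow> (\<Sum>i\<le>degree P. coeff P i * 0)) at_top"
    by (intro tendsto_intros tendsto_power_div_exp_0)
  moreover have "(\<Sum>i\<le>degree P. coeff P i * (y ^ i / exp y)) = poly P y * exp (- y)" for y :: real
    by (simp add: poly_altdef sum_distrib_right exp_minus field_simps sum_divide_distrib)
  ultimately show ?thesis by simp
qed

text \<open>With y = 1/t one has d/dt = - y^2 d/dy, and applying this to P(y) exp(-y) gives y^2 (P -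
  P')(y) exp(-y); the factor \<open>[:0, 0, 1:]\<close> is y^2.\<close>

lemma flat_poly_DERIV:
  "(flat_poly P has_real_derivative flat_poly ([:0, 0, 1:] * (P - pderiv P)) t) (at t)"
proof -
  consider "t < 0" | "t = 0" | "t > 0" by linarith
  then show ?thesis
  proof cases
    case 1
    have "((\<lambda>t. 0) has_real_derivative 0) (at t)" by simp
    then have "(flat_poly P has_real_derivative 0) (at t)"
      by (rule has_field_derivative_transform_within_open[of _ _ _ "{..<0}"])
        (use 1 in \<open>auto simp: flat_poly_def\<close>)
    with 1 show ?thesis by (simp add: flat_poly_def)
  next
    case 3
    have "((\<lambda>t. poly P (1 / t) * exp (- (1 / t))) has_real_derivative
        poly ([:0, 0, 1:] * (P - pderiv P)) (1 / t) * exp (- (1 / t))) (at t)"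
      using 3 by (auto intro!: derivative_eq_intros simp: power2_eq_square field_simps)
    then have "(flat_poly P has_real_derivative
        poly ([:0, 0, 1:] * (P - pderiv P)) (1 / t) * exp (- (1 / t))) (at t)"
      by (rule has_field_derivative_transform_within_open[of _ _ _ "{0<..}"])
        (use 3 in \<open>auto simp: flat_poly_def\<close>)
    with 3 show ?thesis by (simp add: flat_poly_def)
  next
    case 2
    \<comment> \<open>The right-hand difference quotient at 0 is y P(y) exp(-y) with y =
      1/t.\<close>
    have "((\<lambda>t. poly ([:0, 1:] * P) (inverse t) * exp (- inverse t)) \<longlongrightarrow> 0) (at_right 0)"
      using filterlim_compose[OF poly_exp_tendsto_0 filterlim_inverse_at_top_right] .
    then have R: "((\<lambda>t. flat_poly P t / t) \<longlongrightarrow> 0) (at_right 0)"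
      by (rule Lim_transform_eventually)
        (auto simp: eventually_at_right_less flat_poly_def field_simps
          intro!: eventually_mono[OF eventually_at_right_less])
    have L: "((\<lambda>t. flat_poly P t / t) \<longlongrightarrow> 0) (at_left 0)"
      by (rule Lim_transform_eventually[OF tendsto_const])
        (auto simp: flat_poly_def eventually_at_left_field intro!: exI[of _ "-1"])
    have "((\<lambda>t. flat_poly P t / t) \<longlongrightarrow> 0) (at 0)"
      using L R by (simp add: filterlim_at_split)
    with 2 show ?thesis
      by (simp add: has_field_derivative_iff flat_poly_def)
  qed
qed

definition flat_exp :: "real \<Rightarrow> real" where
  "flat_exp t = (if t \<le> 0 then 0 else exp (- (1 / t)))"

lemma smooth_real_flat_exp: "smooth_real flat_exp"
proof -
  define Q where "Q i = ((\<lambda>P. [:0, 0, 1:] * (P - pderiv P)) ^^ i) (1 :: real poly)" for i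
  have "flat_poly (Q 0) = flat_exp" by (auto simp: Q_def flat_poly_def flat_exp_def)
  moreover have "(flat_poly (Q i) has_real_derivative flat_poly (Q (Suc i)) t) (at t)" for i t
    using flat_poly_DERIV[of "Q i" t] by (simp add: Q_def)
  ultimately show ?thesis unfolding smooth_real_def
    by (intro exI[of _ "\<lambda>i. flat_poly (Q i)"]) auto
qed

lemma smooth_real_affine:
  assumes "smooth_real h"
  shows "smooth_real (\<lambda>t. c * h (a + b * t))"
proof -
  obtain H where H: "H 0 = h" "\<And>i t. (H i has_real_derivative H (Suc i) t) (at t)"
    using assms(1) unfolding smooth_real_def by blast
  have "((\<lambda>t. c * b ^ i * H i (a + b * t)) has_real_derivative
      c * b ^ Suc i * H (Suc i) (a + b * t)) (at t)" for i t
  proof -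
    have "((\<lambda>t. H i (a + b * t)) has_real_derivative H (Suc i) (a + b * t) * b) (at t)"
      by (rule DERIV_chain2[OF H(2)]) (auto intro!: derivative_eq_intros)
    from DERIV_cmult[OF this, of "c * b ^ i"] show ?thesis by (simp add: mult_ac)
  qed
  with H(1) show ?thesis unfolding smooth_real_def
    by (intro exI[of _ "\<lambda>i t. c * b ^ i * H i (a + b * t)"]) auto
qed

text \<open>The factor \<open>exp 1\<close> normalises the value at 0 to 1. For negative arguments
  the function exceeds 1, so bounds are stated for t \<ge> 0 only.\<close>

definition cut_off :: "real \<Rightarrow> real" where
  "cut_off t = exp 1 * flat_exp (1 - t)"

lemma smooth_real_cut_off: "smooth_real cut_off"
  unfolding cut_off_def using smooth_real_affine[OF smooth_real_flat_exp, of "exp 1" 1 "-1"] by simp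

lemma cut_off_0 [simp]: "cut_off 0 = 1"
  by (simp add: cut_off_def flat_exp_def exp_minus)

lemma cut_off_ge_1: "1 \<le> t \<Longrightarrow> cut_off t = 0"
  by (simp add: cut_off_def flat_exp_def)

lemma cut_off_nonneg: "0 \<le> cut_off t"
  by (simp add: cut_off_def flat_exp_def)

lemma cut_off_le_1:
  assumes "0 \<le> t" shows "cut_off t \<le> 1"
proof (cases "t < 1")
  case True
  then have "1 \<le> 1 / (1 - t)" using assms by (simp add: field_simps)
  then have "exp 1 * exp (- (1 / (1 - t))) \<le> exp 1 * exp (- 1 :: real)"
    by (intro mult_left_mono) auto
  then show ?thesis using True by (simp add: cut_off_def flat_exp_def exp_minus)
qed (simp add: cut_off_ge_1)

lemma deriv_cut_off_ge_1:
  assumes "1 \<le> t" shows "deriv cut_off t = 0"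
proof -
  have "(cut_off has_real_derivative 0) (at s)" if "1 < s" for s
    by (rule has_field_derivative_transform_within_open[of "\<lambda>_. 0" _ _ "{1<..}"])
      (use that in \<open>auto simp: cut_off_ge_1\<close>)
  then have *: "deriv cut_off s = 0" if "1 < s" for s using that DERIV_imp_deriv by blast
  \<comment> \<open>Locality of the derivative settles t > 1 only; the value at the endpoint 1
    follows from continuity of the derivative.\<close>
  have "continuous (at_right 1) (deriv cut_off)"
    by (meson continuous_at_imp_continuous_at_within continuous_on_eq_continuous_at open_UNIV
        smooth_real_continuous smooth_real_deriv smooth_real_cut_off UNIV_I)
  then have "(deriv cut_off \<longlongrightarrow> deriv cut_off 1) (at_right 1)" by (simp add: continuous_within)
  moreover have "(deriv cut_off \<longlongrightarrow> 0) (at_right 1)"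
    by (rule Lim_transform_eventually[OF tendsto_const])
      (auto intro!: eventually_mono[OF eventually_at_right_less] simp: *)
  ultimately have "deriv cut_off 1 = 0"
    using tendsto_unique trivial_limit_at_right_real by blast
  with * assms show ?thesis by (cases "t = 1") auto
qed

text \<open>Applying \<open>1 - cut_off\<close> to a nonnegative smooth function produces a plateau:
  0 where the function is 0, and exactly 1 where it is at least 1. The factor \<open>exp 2\<close>
  is the reciprocal of \<open>flat_exp (1 / 2)\<close>, so the inner function is at least 1 wherever
  |x - p|^2 \<le> r^2 / 2.\<close>

definition bump :: "'a::euclidean_space \<Rightarrow> real \<Rightarrow> 'a \<Rightarrow> real" where
  "bump p r x = 1 - cut_off (exp 2 * flat_exp (1 - (norm (x - p))\<^sup>2 / r\<^sup>2))"

lemma smooth_fun_bump: "smooth_fun (bump p r)"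
proof -
  have "smooth_fun (\<lambda>x. \<Sum>b\<in>Basis. (x \<bullet> b - p \<bullet> b) * (x \<bullet> b - p \<bullet> b))"
    by (intro smooth_fun_sum smooth_fun_mult smooth_fun_diff smooth_fun_inner smooth_fun_const)
  moreover have "(\<lambda>x. \<Sum>b\<in>Basis. (x \<bullet> b - p \<bullet> b) * (x \<bullet> b - p \<bullet> b)) = (\<lambda>x. (norm (x - p))\<^sup>2)"
    unfolding power2_norm_eq_inner by (subst euclidean_inner) (simp add: inner_diff_left)
  ultimately have "smooth_fun (\<lambda>x. (norm (x - p))\<^sup>2)" by simp
  then have "smooth_fun (\<lambda>x. 1 - (1 / r\<^sup>2) * (norm (x - p))\<^sup>2)"
    by (intro smooth_fun_diff smooth_fun_mult smooth_fun_const)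
  then have "smooth_fun (\<lambda>x. 1 - (norm (x - p))\<^sup>2 / r\<^sup>2)" by simp
  from smooth_fun_mult[OF smooth_fun_const smooth_fun_compose[OF smooth_real_flat_exp this], of "exp 2"]
  show ?thesis unfolding bump_def
    by (intro smooth_fun_diff[OF smooth_fun_const] smooth_fun_compose[OF smooth_real_cut_off])
qed

lemma flat_exp_nonneg: "0 \<le> flat_exp t" by (simp add: flat_exp_def)

lemma bump_outside:
  assumes "0 < r" "r \<le> norm (x - p)" shows "bump p r x = 0"
proof -
  have "1 \<le> (norm (x - p))\<^sup>2 / r\<^sup>2" using assms by (simp add: power_mono)
  then show ?thesis by (simp add: bump_def flat_exp_def)
qed

lemma bump_inside:
  assumes "0 < r" "norm (x - p) \<le> r / 2" shows "bump p r x = 1"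
proof -
  have "(norm (x - p))\<^sup>2 \<le> (r / 2)\<^sup>2" using assms by (intro power_mono) auto
  then have "(norm (x - p))\<^sup>2 / r\<^sup>2 \<le> (r / 2)\<^sup>2 / r\<^sup>2" by (intro divide_right_mono) auto
  also have "(r / 2)\<^sup>2 / r\<^sup>2 \<le> 1 / 2" using assms by (simp add: power2_eq_square field_simps)
  finally have "(norm (x - p))\<^sup>2 / r\<^sup>2 \<le> 1 / 2" .
  then have *: "1 / 2 \<le> 1 - (norm (x - p))\<^sup>2 / r\<^sup>2" (is "_ \<le> ?t") by simp
  then have "1 / ?t \<le> 2" by (simp add: field_simps)
  then have "exp (-2) \<le> exp (- (1 / ?t))" by simp
  also have "\<dots> = flat_exp ?t"
  proof -
    have "\<not> ?t \<le> 0" using * by linarith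
    then show ?thesis by (simp only: flat_exp_def if_False)
  qed
  finally have "exp (-2) \<le> flat_exp ?t" .
  then have "1 \<le> exp 2 * flat_exp ?t" by (simp add: exp_minus field_simps)
  then show ?thesis by (simp add: bump_def cut_off_ge_1)
qed

section \<open>Square-integrable functions and the fundamental lemma\<close>

lemma sum_sq_le: "(a + b)\<^sup>2 \<le> 2 * a\<^sup>2 + 2 * b\<^sup>2" for a b :: real
  using sum_squares_bound[of a b] by (simp add: power2_sum)

lemma L2_fun_add:
  assumes "L2_fun M f" "L2_fun M g" shows "L2_fun M (\<lambda>x. f x + g x)"
proof -
  have [measurable]: "f \<in> borel_measurable M" "g \<in> borel_measurable M"
    using assms by (auto simp: L2_fun_def)
  have "integrable M (\<lambda>x. 2 * (f x)\<^sup>2 + 2 * (g x)\<^sup>2)"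
    using assms by (auto simp: L2_fun_def)
  then have "integrable M (\<lambda>x. (f x + g x)\<^sup>2)"
    by (rule Bochner_Integration.integrable_bound) (auto simp: sum_sq_le)
  then show ?thesis by (auto simp: L2_fun_def)
qed

lemma L2_fun_bounded_mult:
  assumes "L2_fun M f" "h \<in> borel_measurable M" "\<And>x. x \<in> space M \<Longrightarrow> \<bar>h x\<bar> \<le> C"
  shows "L2_fun M (\<lambda>x. h x * f x)"
proof -
  have [measurable]: "f \<in> borel_measurable M" "h \<in> borel_measurable M"
    using assms by (auto simp: L2_fun_def)
  have "integrable M (\<lambda>x. C\<^sup>2 * (f x)\<^sup>2)"
    using assms by (auto simp: L2_fun_def)
  then have "integrable M (\<lambda>x. (h x * f x)\<^sup>2)"
  proof (rule Bochner_Integration.integrable_bound, measurable, intro AE_I2)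
    fix x assume "x \<in> space M"
    from power_mono[OF assms(3)[OF this], of 2] show "norm ((h x * f x)\<^sup>2) \<le> norm (C\<^sup>2 * (f x)\<^sup>2)"
      by (auto simp: power_mult_distrib intro!: mult_right_mono)
  qed
  then show ?thesis by (auto simp: L2_fun_def)
qed

lemma L2_fun_cmult: "L2_fun M f \<Longrightarrow> L2_fun M (\<lambda>x. c * f x)"
  by (rule L2_fun_bounded_mult[of _ _ _ "\<bar>c\<bar>"]) auto

lemma L2_fun_diff: "L2_fun M f \<Longrightarrow> L2_fun M g \<Longrightarrow> L2_fun M (\<lambda>x. f x - g x)"
  using L2_fun_add[of M f "\<lambda>x. -1 * g x"] L2_fun_cmult[of M g "-1"] by simp

lemma L2_fun_zero [simp]: "L2_fun M (\<lambda>x. 0)"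
  by (simp add: L2_fun_def)

lemma L2_fun_sum: "(\<And>i. i \<in> I \<Longrightarrow> L2_fun M (f i)) \<Longrightarrow> L2_fun M (\<lambda>x. \<Sum>i\<in>I. f i x)"
  by (induction I rule: infinite_finite_induct) (auto intro: L2_fun_add)

lemma L2_fun_integrable_mult:
  assumes "L2_fun M f" "L2_fun M g" shows "integrable M (\<lambda>x. f x * g x)"
proof (rule Bochner_Integration.integrable_bound)
  show "integrable M (\<lambda>x. (f x)\<^sup>2 + (g x)\<^sup>2)" using assms by (auto simp: L2_fun_def)
  show "(\<lambda>x. f x * g x) \<in> borel_measurable M"
    using assms by (auto simp: L2_fun_def intro!: borel_measurable_times)
  have "\<bar>a * b\<bar> \<le> a\<^sup>2 + b\<^sup>2" for a b :: real
    using sum_squares_bound[of "\<bar>a\<bar>" "\<bar>b\<bar>"] mult_nonneg_nonneg[of "\<bar>a\<bar>" "\<bar>b\<bar>"]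
    unfolding abs_mult power2_abs by linarith
  then show "AE x in M. norm (f x * g x) \<le> norm ((f x)\<^sup>2 + (g x)\<^sup>2)" by auto
qed

lemma ennreal_tendsto_0_le:
  fixes a b :: "'b \<Rightarrow> ennreal"
  assumes "\<And>j. a j \<le> b j" "(b \<longlongrightarrow> 0) F"
  shows "(a \<longlongrightarrow> 0) F"
  by (rule tendsto_sandwich[OF _ _ tendsto_const assms(2)]) (simp_all add: assms(1))

lemma L2_tendsto_add:
  assumes [measurable]: "\<And>j. F j \<in> borel_measurable M" "\<And>j. G j \<in> borel_measurable M"
      "f \<in> borel_measurable M" "g \<in> borel_measurable M"
    and F: "L2_tendsto M F f" and G: "L2_tendsto M G g"
  shows "L2_tendsto M (\<lambda>j x. F j x + G j x) (\<lambda>x. f x + g x)"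
proof -
  let ?F = "\<lambda>j. \<integral>\<^sup>+x. ennreal ((F j x - f x)\<^sup>2) \<partial>M" and ?G = "\<lambda>j. \<integral>\<^sup>+x. ennreal ((G j x - g x)\<^sup>2) \<partial>M"
  have "(\<integral>\<^sup>+x. ennreal ((F j x + G j x - (f x + g x))\<^sup>2) \<partial>M) \<le> 2 * ?F j + 2 * ?G j" for j
  proof -
    have "(\<integral>\<^sup>+x. ennreal ((F j x + G j x - (f x + g x))\<^sup>2) \<partial>M)
        \<le> (\<integral>\<^sup>+x. 2 * ennreal ((F j x - f x)\<^sup>2) + 2 * ennreal ((G j x - g x)\<^sup>2) \<partial>M)"
    proof (rule nn_integral_mono)
      fix x
      have "F j x + G j x - (f x + g x) = (F j x - f x) + (G j x - g x)" by simp
      then have "ennreal ((F j x + G j x - (f x + g x))\<^sup>2)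
          \<le> ennreal (2 * (F j x - f x)\<^sup>2 + 2 * (G j x - g x)\<^sup>2)"
        using sum_sq_le[of "F j x - f x" "G j x - g x"] by (intro ennreal_leI) (simp only:)
      also have "\<dots> = 2 * ennreal ((F j x - f x)\<^sup>2) + 2 * ennreal ((G j x - g x)\<^sup>2)"
        by (simp add: ennreal_mult')
      finally show "ennreal ((F j x + G j x - (f x + g x))\<^sup>2) \<le> \<dots>" .
    qed
    also have "\<dots> = 2 * ?F j + 2 * ?G j"
      by (subst nn_integral_add, measurable) (simp add: nn_integral_cmult)
    finally show ?thesis .
  qed
  moreover have "(\<lambda>j. 2 * ?F j + 2 * ?G j) \<longlonglongrightarrow> 0"
    using tendsto_add[OF ennreal_tendsto_cmult[OF _ F[unfolded L2_tendsto_def], of 2]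
        ennreal_tendsto_cmult[OF _ G[unfolded L2_tendsto_def], of 2]] by simp
  ultimately show ?thesis unfolding L2_tendsto_def by (rule ennreal_tendsto_0_le)
qed

lemma L2_tendsto_bounded_mult:
  assumes [measurable]: "\<And>j. F j \<in> borel_measurable M" "f \<in> borel_measurable M"
    and F: "L2_tendsto M F f" and C: "\<And>x. x \<in> space M \<Longrightarrow> \<bar>h x\<bar> \<le> C"
  shows "L2_tendsto M (\<lambda>j x. h x * F j x) (\<lambda>x. h x * f x)"
proof -
  let ?F = "\<lambda>j. \<integral>\<^sup>+x. ennreal ((F j x - f x)\<^sup>2) \<partial>M"
  have "(\<integral>\<^sup>+x. ennreal ((h x * F j x - h x * f x)\<^sup>2) \<partial>M) \<le> ennreal (C\<^sup>2) * ?F j" for j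
  proof -
    have "(\<integral>\<^sup>+x. ennreal ((h x * F j x - h x * f x)\<^sup>2) \<partial>M)
        \<le> (\<integral>\<^sup>+x. ennreal (C\<^sup>2) * ennreal ((F j x - f x)\<^sup>2) \<partial>M)"
    proof (rule nn_integral_mono)
      fix x assume "x \<in> space M"
      from power_mono[OF C[OF this], of 2]
      have "(h x * F j x - h x * f x)\<^sup>2 \<le> C\<^sup>2 * (F j x - f x)\<^sup>2"
        unfolding right_diff_distrib[symmetric] power_mult_distrib
        by (intro mult_right_mono) auto
      then show "ennreal ((h x * F j x - h x * f x)\<^sup>2) \<le> ennreal (C\<^sup>2) * ennreal ((F j x - f x)\<^sup>2)"
        by (simp add: ennreal_mult'[symmetric] ennreal_leI)
    qed
    also have "\<dots> = ennreal (C\<^sup>2) * ?F j" by (simp add: nn_integral_cmult)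
    finally show ?thesis .
  qed
  moreover have "(\<lambda>j. ennreal (C\<^sup>2) * ?F j) \<longlonglongrightarrow> 0"
    using ennreal_tendsto_cmult[OF _ F[unfolded L2_tendsto_def], of "ennreal (C\<^sup>2)"] by simp
  ultimately show ?thesis unfolding L2_tendsto_def by (rule ennreal_tendsto_0_le)
qed

lemma L2_tendsto_cong:
  assumes "L2_tendsto M F f" "AE x in M. f x = g x" "\<And>j. AE x in M. F j x = G j x"
  shows "L2_tendsto M G g"
proof -
  have "(\<integral>\<^sup>+x. ennreal ((F j x - f x)\<^sup>2) \<partial>M) = (\<integral>\<^sup>+x. ennreal ((G j x - g x)\<^sup>2) \<partial>M)" for j
    using assms(2) assms(3)[of j] by (intro nn_integral_cong_AE) auto
  with assms(1) show ?thesis by (simp add: L2_tendsto_def)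
qed

lemma L2_tendsto_cmult:
  assumes "\<And>j. F j \<in> borel_measurable M" "f \<in> borel_measurable M" "L2_tendsto M F f"
  shows "L2_tendsto M (\<lambda>j x. c * F j x) (\<lambda>x. c * f x)"
  by (rule L2_tendsto_bounded_mult[OF assms, of _ "\<bar>c\<bar>"]) auto

lemma L2_tendsto_sum:
  assumes "\<And>i j. i \<in> I \<Longrightarrow> F i j \<in> borel_measurable M" "\<And>i. i \<in> I \<Longrightarrow> f i \<in> borel_measurable M"
    and "\<And>i. i \<in> I \<Longrightarrow> L2_tendsto M (F i) (f i)"
  shows "L2_tendsto M (\<lambda>j x. \<Sum>i\<in>I. F i j x) (\<lambda>x. \<Sum>i\<in>I. f i x)"
  using assms
  by (induction I rule: infinite_finite_induct)
    (auto intro!: L2_tendsto_add borel_measurable_sum, auto simp: L2_tendsto_def)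

text \<open>The Borel sets over which \<open>f\<close> integrates to 0 are closed under countable
  disjoint unions and, since the total integral is 0, under complements. Open boxes generate the
  Borel sets and are stable under intersection, so these are all Borel sets.\<close>

lemma AE_eq_0_if_box_integrals_eq_0:
  fixes f :: "'a::euclidean_space \<Rightarrow> real"
  assumes f: "integrable lborel f" and z: "(\<integral>x. f x \<partial>lborel) = 0"
    and box: "\<And>l u. (LINT x:box l u|lborel. f x) = 0"
  shows "AE x in lborel. f x = 0"
proof (rule density_unique_real[OF f, of "\<lambda>x. 0"])
  fix A assume "A \<in> sets (lborel :: 'a measure)"
  then have A: "A \<in> sigma_sets UNIV (range (\<lambda>(a, b). box a b::'a set))"
    by (simp add: borel_eq_box)
  have f': "set_integrable lborel B f" if "B \<in> sets borel" for B
    using f that unfolding set_integrable_def by (intro integrable_mult_indicator) auto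
  have "(LINT x:A|lborel. f x) = 0"
  proof (rule sigma_sets_induct_disjoint[OF _ _ A])
    show "Int_stable (range (\<lambda>(a, b). box a b::'a set))"
      by (auto simp: Int_stable_def box_Int_box)
    show "(LINT x:B|lborel. f x) = 0" if "B \<in> range (\<lambda>(a, b). box a b)" for B
      using that box by auto
    show "(LINT x:UNIV - B|lborel. f x) = 0"
      if "B \<in> sigma_sets UNIV (range (\<lambda>(a, b). box a b))" "(LINT x:B|lborel. f x) = 0" for B
    proof -
      have "B \<in> sets borel" using that by (simp add: borel_eq_box)
      then have "(LINT x:B \<union> (UNIV - B)|lborel. f x) = (LINT x:B|lborel. f x) + (LINT x:UNIV - B|lborel. f x)"
        by (intro set_integral_Un f') auto
      moreover have "B \<union> (UNIV - B) = UNIV" by auto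
      moreover have "(LINT x:UNIV|lborel. f x) = 0"
        using z unfolding set_lebesgue_integral_def by simp
      ultimately show ?thesis using that by simp
    qed
    show "(LINT x:(\<Union>i. B i)|lborel. f x) = 0"
      if "disjoint_family B" "range B \<subseteq> sigma_sets UNIV (range (\<lambda>(a, b). box a b))"
        "\<And>i. (LINT x:B i|lborel. f x) = 0" for B :: "nat \<Rightarrow> _"
    proof -
      have B: "B i \<in> sets borel" for i using that by (auto simp: borel_eq_box)
      then have "(LINT x:(\<Union>i. B i)|lborel. f x) = (\<Sum>i. LINT x:B i|lborel. f x)"
        using that(1) by (intro lebesgue_integral_countable_add f') (auto simp: disjoint_family_on_def)
      with that(3) show ?thesis by simp
    qed
  qed (auto simp: set_lebesgue_integral_def)
  then show "(LINT x:A|lborel. f x) = (LINT x:A|lborel. 0)" by (simp add: set_lebesgue_integral_def)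
qed simp

text \<open>Smooth approximations of the indicator of an open box from below: each factor is 0 if
  its coordinate gap is not positive, and otherwise equals 1 as soon as
  \<open>real m * flat_exp\<close> of the gap reaches 1.\<close>

definition box_bump :: "'a::euclidean_space \<Rightarrow> 'a \<Rightarrow> nat \<Rightarrow> 'a \<Rightarrow> real" where
  "box_bump a b m x = (\<Prod>i\<in>Basis. (1 - cut_off (real m * flat_exp (x \<bullet> i - a \<bullet> i))) *
     (1 - cut_off (real m * flat_exp (b \<bullet> i - x \<bullet> i))))"

lemma smooth_fun_box_bump: "smooth_fun (box_bump a b m)"
proof -
  have *: "smooth_fun (\<lambda>x. 1 - cut_off (real m * flat_exp (g x)))" if "smooth_fun g" for g :: "'a \<Rightarrow> real"
    by (intro smooth_fun_diff[OF smooth_fun_const] smooth_fun_compose[OF smooth_real_cut_off]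
        smooth_fun_mult[OF smooth_fun_const] smooth_fun_compose[OF smooth_real_flat_exp that])
  show ?thesis unfolding box_bump_def
    by (intro smooth_fun_prod smooth_fun_mult * smooth_fun_diff smooth_fun_const smooth_fun_inner)
qed

lemma box_bump_bounds: "0 \<le> box_bump a b m x" "box_bump a b m x \<le> 1"
proof -
  have *: "0 \<le> 1 - cut_off (real m * flat_exp t)" "1 - cut_off (real m * flat_exp t) \<le> 1" for t
    using cut_off_le_1[of "real m * flat_exp t"] cut_off_nonneg by (auto simp: flat_exp_nonneg)
  show "0 \<le> box_bump a b m x" unfolding box_bump_def
    by (intro prod_nonneg mult_nonneg_nonneg * ballI)
  show "box_bump a b m x \<le> 1" unfolding box_bump_def
    by (intro prod_le_1 conjI mult_nonneg_nonneg mult_le_one *)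
qed

lemma box_bump_outside: "x \<notin> box a b \<Longrightarrow> box_bump a b m x = 0"
  by (force simp: box_bump_def mem_box flat_exp_def not_less intro!: prod_zero)

lemma box_bump_tendsto: "(\<lambda>m. box_bump a b m x) \<longlonglongrightarrow> indicator (box a b) x"
proof (cases "x \<in> box a b")
  case True
  have *: "(\<lambda>m. 1 - cut_off (real m * flat_exp t)) \<longlonglongrightarrow> 1" if "0 < t" for t
  proof (rule Lim_transform_eventually[OF tendsto_const])
    have "0 < flat_exp t" using that by (simp add: flat_exp_def)
    then obtain N :: nat where "1 < real N * flat_exp t" using reals_Archimedean3 by blast
    moreover have "real N * flat_exp t \<le> real m * flat_exp t" if "N \<le> m" for m
      using that \<open>0 < flat_exp t\<close> by (intro mult_right_mono) auto
    ultimately have "1 \<le> real m * flat_exp t" if "N \<le> m" for m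
      using that by fastforce
    then show "\<forall>\<^sub>F m in sequentially. 1 = 1 - cut_off (real m * flat_exp t)"
      unfolding eventually_sequentially by (intro exI[of _ N]) (simp add: cut_off_ge_1)
  qed
  have "(\<lambda>m. box_bump a b m x) \<longlonglongrightarrow> (\<Prod>i\<in>(Basis :: 'a set). 1 * 1)"
    unfolding box_bump_def
    by (intro tendsto_prod tendsto_mult *) (use True in \<open>auto simp: mem_box\<close>)
  with True show ?thesis by simp
qed (simp add: box_bump_outside)

lemma test_fun_box_bump:
  assumes "cbox a b \<subseteq> \<Omega>" shows "test_fun \<Omega> (box_bump a b m)"
proof -
  have "closure {x. box_bump a b m x \<noteq> 0} \<subseteq> cbox a b"
    using box_bump_outside[of _ a b m] box_subset_cbox by (intro closure_minimal) auto
  moreover from this have "compact (closure {x. box_bump a b m x \<noteq> 0})"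
    unfolding compact_eq_bounded_closed using bounded_subset[OF bounded_cbox] by blast
  ultimately show ?thesis unfolding test_fun_def using assms smooth_fun_box_bump by blast
qed

lemma borel_measurable_lebesgue_on: "f \<in> borel_measurable borel \<Longrightarrow> f \<in> borel_measurable (lebesgue_on S)"
  by (intro measurable_restrict_space1 measurable_completion) simp

lemma smooth_lebesgue_on: "smooth_fun f \<Longrightarrow> f \<in> borel_measurable (lebesgue_on S)"
  by (intro borel_measurable_lebesgue_on smooth_fun_measurable)

text \<open>Test with \<open>box_bump a b m\<close> and let \<open>m\<close> tend to infinity. Since
  \<open>w\<close> is square integrable, dominated convergence rests on |w| c \<le> c + w^2 for 0
  \<le> c \<le> 1.\<close>

lemma lebesgue_on_integral_zero_box:
  assumes \<Omega>: "open \<Omega>" and w: "L2_fun (lebesgue_on \<Omega>) w"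
    and t: "\<forall>\<phi>. test_fun \<Omega> \<phi> \<longrightarrow> (\<integral>x. w x * \<phi> x \<partial>lebesgue_on \<Omega>) = 0"
    and ab: "cbox a b \<subseteq> \<Omega>"
  shows "integrable (lebesgue_on \<Omega>) (\<lambda>x. w x * indicator (box a b) x)"
    and "(\<integral>x. w x * indicator (box a b) x \<partial>lebesgue_on \<Omega>) = 0"
proof -
  let ?M = "lebesgue_on \<Omega>"
  have S: "\<Omega> \<inter> space lebesgue \<in> sets lebesgue" using \<Omega> by auto
  have [measurable]: "w \<in> borel_measurable ?M" using w by (auto simp: L2_fun_def)
  note [measurable] = smooth_lebesgue_on[OF smooth_fun_box_bump]
  have [measurable]: "indicator (box a b) \<in> borel_measurable ?M"
    by (rule borel_measurable_lebesgue_on) simp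
  have sub: "box a b \<subseteq> \<Omega>" using ab box_subset_cbox[of a b] by auto
  have ind: "integrable ?M (indicator (box a b) :: _ \<Rightarrow> real)"
  proof (rule integrable_real_indicator)
    show "box a b \<in> sets ?M" using sub \<Omega> by (subst sets_restrict_space_iff) auto
    have "emeasure ?M (box a b) = emeasure lborel (box a b)"
      using sub \<Omega> by (subst emeasure_restrict_space) (auto simp: emeasure_completion)
    then show "emeasure ?M (box a b) < \<infinity>"
      using emeasure_lborel_box_finite[of a b] by simp
  qed
  have dom: "integrable ?M (\<lambda>x. indicator (box a b) x + (w x)\<^sup>2)"
    using w ind by (auto simp: L2_fun_def)
  have le: "\<bar>w x\<bar> * c \<le> c + (w x)\<^sup>2" if "0 \<le> c" "c \<le> 1" for c x
  proof -
    have "\<bar>w x\<bar> \<le> 1 + (w x)\<^sup>2"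
      using sum_squares_bound[of 1 "\<bar>w x\<bar>"] abs_ge_zero[of "w x"] unfolding power2_abs by simp
    then have "\<bar>w x\<bar> * c \<le> c + (w x)\<^sup>2 * c"
      using that mult_right_mono[of "\<bar>w x\<bar>" "1 + (w x)\<^sup>2" c] by (simp add: algebra_simps)
    also have "(w x)\<^sup>2 * c \<le> (w x)\<^sup>2" using that by (simp add: mult_left_le)
    finally show ?thesis by simp
  qed
  show "integrable ?M (\<lambda>x. w x * indicator (box a b) x)"
    by (rule Bochner_Integration.integrable_bound[OF dom])
      (measurable, simp add: abs_mult le)
  have "(\<lambda>m. \<integral>x. w x * box_bump a b m x \<partial>?M) \<longlonglongrightarrow> (\<integral>x. w x * indicator (box a b) x \<partial>?M)"
  proof (rule integral_dominated_convergence[OF _ _ dom])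
    show "AE x in ?M. norm (w x * box_bump a b m x) \<le> indicator (box a b) x + (w x)\<^sup>2" for m
    proof (intro AE_I2)
      fix x show "norm (w x * box_bump a b m x) \<le> indicator (box a b) x + (w x)\<^sup>2"
        using le[of "box_bump a b m x" x] box_bump_bounds[of a b m x] box_bump_outside[of x a b m]
        by (cases "x \<in> box a b") (auto simp: abs_mult)
    qed
  qed (measurable, auto intro!: AE_I2 tendsto_mult box_bump_tendsto)
  moreover have "(\<integral>x. w x * box_bump a b m x \<partial>?M) = 0" for m
    using t test_fun_box_bump[OF ab] by blast
  ultimately show "(\<integral>x. w x * indicator (box a b) x \<partial>?M) = 0"
    using LIMSEQ_unique[OF _ tendsto_const] by auto
qed

text \<open>The truncation of \<open>w\<close> to the box integrates to 0 over every box, because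
  two open boxes meet in an open box. The Dynkin argument lives on Borel sets, hence the detour
  through a Borel representative \<open>f\<close> of the truncation \<open>f0\<close>.\<close>

lemma fundamental_lemma_box:
  assumes \<Omega>: "open \<Omega>" and w: "L2_fun (lebesgue_on \<Omega>) w"
    and t: "\<forall>\<phi>. test_fun \<Omega> \<phi> \<longrightarrow> (\<integral>x. w x * \<phi> x \<partial>lebesgue_on \<Omega>) = 0"
    and ab: "cbox a b \<subseteq> \<Omega>"
  shows "AE x in lebesgue. x \<in> box a b \<longrightarrow> w x = 0"
proof -
  have S: "\<Omega> \<inter> space lebesgue \<in> sets lebesgue" using \<Omega> by auto
  define f0 where "f0 x = w x * indicator (box a b) x" for x
  have ind: "indicator \<Omega> x *\<^sub>R (w x * indicator (box a b) x) = f0 x" for x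
    using ab box_subset_cbox[of a b] by (auto simp: f0_def split: split_indicator)
  have f0: "integrable lebesgue f0"
    using lebesgue_on_integral_zero_box(1)[OF \<Omega> w t ab, unfolded integrable_restrict_space[OF S] ind] .
  then obtain f where f [measurable]: "f \<in> borel_measurable lborel" and eq: "AE x in lborel. f0 x = f x"
    using completion_ex_borel_measurable_real[of f0 lborel] by auto
  have eq': "AE x in lebesgue. f0 x = f x" using eq by (rule AE_completion)
  have f_int: "integrable lborel f"
    using integrable_cong_AE_imp[OF f0 measurable_completion[OF f] eq'] integrable_completion[OF f]
    by simp
  have box: "(LINT x:box l u|lborel. f x) = 0" for l u
  proof -
    obtain c d where cd: "box a b \<inter> box l u = box c d" unfolding box_Int_box by blast
    \<comment> \<open>Only a nonempty open box has \<open>cbox c d\<close> as its closure; if the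
      open box is empty, the closed one may leave the domain, but then the integral is trivially
      0.\<close>
    have "cbox c d \<subseteq> \<Omega> \<or> box c d = {}"
    proof (cases "box c d = {}")
      case False
      then have "box c d \<subseteq> cbox a b" using cd box_subset_cbox[of a b] by auto
      then have "closure (box c d) \<subseteq> cbox a b" by (intro closure_minimal closed_cbox)
      then have "cbox c d \<subseteq> cbox a b" using closure_box[OF False] by simp
      with ab show ?thesis by auto
    qed simp
    then have "(\<integral>x. w x * indicator (box c d) x \<partial>lebesgue_on \<Omega>) = 0"
      using lebesgue_on_integral_zero_box(2)[OF \<Omega> w t] by auto
    then have "0 = (\<integral>x. indicator \<Omega> x *\<^sub>R (w x * indicator (box c d) x) \<partial>lebesgue)"
      unfolding integral_restrict_space[OF S] by simp
    also have "\<dots> = (\<integral>x. indicator (box l u) x *\<^sub>R f x \<partial>lebesgue)"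
    proof (rule integral_cong_AE)
      have e: "indicator \<Omega> x *\<^sub>R (w x * indicator (box c d) x) = indicator (box l u) x *\<^sub>R f0 x" for x
        unfolding ind[symmetric] cd[symmetric] by (auto split: split_indicator)
      show "AE x in lebesgue. indicator \<Omega> x *\<^sub>R (w x * indicator (box c d) x) = indicator (box l u) x *\<^sub>R f x"
        unfolding e using eq' by auto
      show "(\<lambda>x. indicator \<Omega> x *\<^sub>R (w x * indicator (box c d) x)) \<in> borel_measurable lebesgue"
        unfolding e by (intro borel_measurable_scaleR borel_measurable_indicator borel_measurable_integrable f0) simp
      show "(\<lambda>x. indicator (box l u) x *\<^sub>R f x) \<in> borel_measurable lebesgue"
        by (rule measurable_completion) measurable
    qed
    also have "\<dots> = (LINT x:box l u|lborel. f x)"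
      unfolding set_lebesgue_integral_def by (rule integral_completion) measurable
    finally show ?thesis by simp
  qed
  have "(\<integral>x. f x \<partial>lborel) = (\<integral>x. f x \<partial>lebesgue)" using integral_completion[OF f] by simp
  also have "\<dots> = (\<integral>x. f0 x \<partial>lebesgue)"
  proof (rule integral_cong_AE)
    show "f \<in> borel_measurable lebesgue" using f by (rule measurable_completion)
    show "f0 \<in> borel_measurable lebesgue" using f0 by (rule borel_measurable_integrable)
    show "AE x in lebesgue. f x = f0 x" using eq' by eventually_elim simp
  qed
  also have "\<dots> = 0"
    using lebesgue_on_integral_zero_box(2)[OF \<Omega> w t ab, unfolded integral_restrict_space[OF S] ind] .
  finally have "AE x in lborel. f x = 0"
    using AE_eq_0_if_box_integrals_eq_0[OF f_int] box by blast
  then have "AE x in lebesgue. f x = 0" by (rule AE_completion)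
  with eq' show ?thesis by eventually_elim (auto simp: f0_def split: split_indicator_asm)
qed

text \<open>Countably many closed boxes exhaust the domain, and the faces missed by the open boxes
  are null sets.\<close>

lemma fundamental_lemma:
  assumes \<Omega>: "open \<Omega>" and w: "L2_fun (lebesgue_on \<Omega>) w"
    and t: "\<forall>\<phi>. test_fun \<Omega> \<phi> \<longrightarrow> (\<integral>x. w x * \<phi> x \<partial>lebesgue_on \<Omega>) = 0"
  shows "AE x in lebesgue_on \<Omega>. w x = 0"
proof -
  obtain D where D: "countable D" "D \<subseteq> Pow \<Omega>" "\<And>X. X \<in> D \<Longrightarrow> \<exists>a b. X = cbox a b" "\<Union>D = \<Omega>"
    using open_countable_Union_open_cbox[OF \<Omega>] by metis
  have "AE x in lebesgue. x \<in> X \<longrightarrow> w x = 0" if "X \<in> D" for X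
  proof -
    from D(2) D(3)[OF that] that obtain a b where X: "X = cbox a b" "cbox a b \<subseteq> \<Omega>" by blast
    have "AE x in lebesgue. x \<notin> cbox a b - box a b"
      using negligible_frontier_interval[of a b] negligible_iff_null_sets AE_not_in by blast
    with fundamental_lemma_box[OF \<Omega> w t X(2)] show ?thesis
      unfolding X(1) by eventually_elim auto
  qed
  then have "AE x in lebesgue. \<forall>X\<in>D. x \<in> X \<longrightarrow> w x = 0"
    by (subst AE_ball_countable[OF D(1)]) blast
  then have "AE x in lebesgue. x \<in> \<Omega> \<longrightarrow> w x = 0"
    by eventually_elim (use D(4) in auto)
  then show ?thesis using \<Omega> by (subst AE_restrict_space_iff) auto
qed

section \<open>Weak derivatives and traces\<close>

lemma smooth_fun_bounded:
  assumes "bounded S" "smooth_fun f"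
  obtains C where "\<And>x. x \<in> closure S \<Longrightarrow> \<bar>f x\<bar> \<le> C"
proof -
  have "compact (f ` closure S)"
    using assms by (intro compact_continuous_image smooth_fun_continuous) auto
  then have "bounded (f ` closure S)" by (rule compact_imp_bounded)
  then obtain C where "\<forall>y\<in>f ` closure S. norm y \<le> C" unfolding bounded_iff by blast
  then show ?thesis using that by auto
qed

lemma L2_fun_smooth:
  assumes "open \<Omega>" "bounded \<Omega>" "smooth_fun f" shows "L2_fun (lebesgue_on \<Omega>) f"
proof -
  obtain C where C: "\<And>x. x \<in> closure \<Omega> \<Longrightarrow> \<bar>f x\<bar> \<le> C"
    using smooth_fun_bounded[OF assms(2,3)] by blast
  have "\<Omega> \<in> lmeasurable" using assms by (simp add: bounded_set_imp_lmeasurable)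
  then have "integrable (lebesgue_on \<Omega>) (\<lambda>x. 1 :: real)"
    by (intro finite_measure.integrable_const finite_measure_lebesgue_on)
  then have "L2_fun (lebesgue_on \<Omega>) (\<lambda>x. 1)" by (simp add: L2_fun_def)
  from L2_fun_bounded_mult[OF this smooth_lebesgue_on[OF assms(3)], of C] C closure_subset[of \<Omega>]
  show ?thesis by auto
qed

lemma L2_fun_smooth_mult:
  assumes "bounded \<Omega>" "smooth_fun f" "L2_fun (lebesgue_on \<Omega>) u"
  shows "L2_fun (lebesgue_on \<Omega>) (\<lambda>x. f x * u x)"
proof -
  obtain C where C: "\<And>x. x \<in> closure \<Omega> \<Longrightarrow> \<bar>f x\<bar> \<le> C"
    using smooth_fun_bounded[OF assms(1,2)] by blast
  show ?thesis
    by (rule L2_fun_bounded_mult[OF assms(3) smooth_lebesgue_on[OF assms(2)], of C])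
      (use C closure_subset[of \<Omega>] in auto)
qed

lemma L2_measurable: "L2_fun M f \<Longrightarrow> f \<in> borel_measurable M"
  by (simp add: L2_fun_def)

lemma L2_tendsto_smooth_mult:
  assumes "bounded \<Omega>" "smooth_fun f" "\<And>j. smooth_fun (U j)" "L2_fun (lebesgue_on \<Omega>) u"
    "L2_tendsto (lebesgue_on \<Omega>) U u"
  shows "L2_tendsto (lebesgue_on \<Omega>) (\<lambda>j x. f x * U j x) (\<lambda>x. f x * u x)"
proof -
  obtain C where C: "\<And>x. x \<in> closure \<Omega> \<Longrightarrow> \<bar>f x\<bar> \<le> C"
    using smooth_fun_bounded[OF assms(1,2)] by blast
  show ?thesis
    by (rule L2_tendsto_bounded_mult[OF smooth_lebesgue_on[OF assms(3)] L2_measurable[OF assms(4)]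
          assms(5), of _ C])
      (use C closure_subset[of \<Omega>] in auto)
qed

lemma test_fun_smooth: "test_fun \<Omega> \<phi> \<Longrightarrow> smooth_fun \<phi>"
  by (simp add: test_fun_def)

lemma test_fun_mult:
  assumes "smooth_fun f" "test_fun \<Omega> \<phi>" shows "test_fun \<Omega> (\<lambda>x. f x * \<phi> x)"
proof -
  have "closure {x. f x * \<phi> x \<noteq> 0} \<subseteq> closure {x. \<phi> x \<noteq> 0}" by (intro closure_mono) auto
  moreover from this have "compact (closure {x. f x * \<phi> x \<noteq> 0})"
    using assms(2) bounded_subset unfolding test_fun_def compact_eq_bounded_closed by blast
  ultimately show ?thesis
    using assms unfolding test_fun_def by (blast intro: smooth_fun_mult)
qed

lemma is_weak_partial_L2: "is_weak_partial \<Omega> b u w \<Longrightarrow> L2_fun (lebesgue_on \<Omega>) w"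
  by (simp add: is_weak_partial_def)

lemma W12_L2: "W12 \<Omega> u \<Longrightarrow> L2_fun (lebesgue_on \<Omega>) u"
  by (simp add: W12_def)

lemma weak_partial_works: "W12 \<Omega> u \<Longrightarrow> b \<in> Basis \<Longrightarrow> is_weak_partial \<Omega> b u (weak_partial \<Omega> b u)"
  unfolding W12_def weak_partial_def by (metis someI_ex)

lemma weak_partial_L2: "W12 \<Omega> u \<Longrightarrow> b \<in> Basis \<Longrightarrow> L2_fun (lebesgue_on \<Omega>) (weak_partial \<Omega> b u)"
  using weak_partial_works is_weak_partial_L2 by blast

lemma sets_hausdorff_measure: "sets (hausdorff_measure s) = sets borel"
  unfolding hausdorff_measure_def using sets.sigma_sets_eq[of borel] by simp

lemma sets_surface_measure: "sets (surface_measure \<Omega>) = sets (restrict_space borel (frontier \<Omega>))"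
  unfolding surface_measure_def by (intro sets_restrict_space_cong sets_hausdorff_measure)

lemma space_surface_measure: "space (surface_measure \<Omega>) = frontier \<Omega>"
  using sets_eq_imp_space_eq[OF sets_surface_measure[of \<Omega>]] by (simp add: space_restrict_space)

lemma smooth_surface: "smooth_fun f \<Longrightarrow> f \<in> borel_measurable (surface_measure \<Omega>)"
  unfolding measurable_cong_sets[OF sets_surface_measure refl]
  by (intro measurable_restrict_space1 smooth_fun_measurable)

context
  fixes \<Omega> :: "'a::euclidean_space set"
  assumes \<Omega>: "open \<Omega>" "bounded \<Omega>"
begin

lemma is_weak_partial_add:
  assumes "b \<in> Basis" "L2_fun (lebesgue_on \<Omega>) u" "L2_fun (lebesgue_on \<Omega>) v"
    and u: "is_weak_partial \<Omega> b u w" and v: "is_weak_partial \<Omega> b v z"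
  shows "is_weak_partial \<Omega> b (\<lambda>x. u x + c * v x) (\<lambda>x. w x + c * z x)"
  unfolding is_weak_partial_def
proof (intro conjI allI impI)
  note L2 = is_weak_partial_L2[OF u] is_weak_partial_L2[OF v]
  show "L2_fun (lebesgue_on \<Omega>) (\<lambda>x. w x + c * z x)" by (intro L2_fun_add L2_fun_cmult L2)
  fix \<phi> assume t: "test_fun \<Omega> \<phi>"
  let ?D = "partial_deriv b \<phi>"
  have D: "L2_fun (lebesgue_on \<Omega>) ?D" and P: "L2_fun (lebesgue_on \<Omega>) \<phi>"
    using L2_fun_smooth[OF \<Omega>] smooth_fun_partial test_fun_smooth[OF t] assms(1) by blast+
  have "(\<integral>x. (u x + c * v x) * ?D x \<partial>lebesgue_on \<Omega>)
      = (\<integral>x. u x * ?D x + c * (v x * ?D x) \<partial>lebesgue_on \<Omega>)" by (simp add: algebra_simps)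
  also have "\<dots> = (\<integral>x. u x * ?D x \<partial>lebesgue_on \<Omega>) + c * (\<integral>x. v x * ?D x \<partial>lebesgue_on \<Omega>)"
    using assms(2,3) D by (simp add: L2_fun_integrable_mult)
  also have "\<dots> = - ((\<integral>x. w x * \<phi> x \<partial>lebesgue_on \<Omega>) + c * (\<integral>x. z x * \<phi> x \<partial>lebesgue_on \<Omega>))"
    using u v t by (simp add: is_weak_partial_def)
  also have "\<dots> = - (\<integral>x. w x * \<phi> x + c * (z x * \<phi> x) \<partial>lebesgue_on \<Omega>)"
    using L2 P by (simp add: L2_fun_integrable_mult)
  also have "\<dots> = - (\<integral>x. (w x + c * z x) * \<phi> x \<partial>lebesgue_on \<Omega>)" by (simp add: algebra_simps)
  finally show "(\<integral>x. (u x + c * v x) * ?D x \<partial>lebesgue_on \<Omega>)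
      = - (\<integral>x. (w x + c * z x) * \<phi> x \<partial>lebesgue_on \<Omega>)" .
qed

text \<open>The factor moves onto the test function: f \<partial>\<phi> = \<partial>(f \<phi>) -
  (\<partial>f) \<phi>, where f \<phi> is again a test function.\<close>

lemma is_weak_partial_mult:
  assumes b: "b \<in> Basis" and f: "smooth_fun f" and uL: "L2_fun (lebesgue_on \<Omega>) u"
    and u: "is_weak_partial \<Omega> b u w"
  shows "is_weak_partial \<Omega> b (\<lambda>x. f x * u x) (\<lambda>x. f x * w x + partial_deriv b f x * u x)"
  unfolding is_weak_partial_def
proof (intro conjI allI impI)
  note wL = is_weak_partial_L2[OF u]
  note mult = L2_fun_smooth_mult[OF \<Omega>(2)]
  show "L2_fun (lebesgue_on \<Omega>) (\<lambda>x. f x * w x + partial_deriv b f x * u x)"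
    by (intro L2_fun_add mult wL uL f smooth_fun_partial b)
  fix \<phi> assume t: "test_fun \<Omega> \<phi>"
  let ?D = "partial_deriv b"
  note s = test_fun_smooth[OF t]
  have i1: "integrable (lebesgue_on \<Omega>) (\<lambda>x. u x * ?D (\<lambda>x. f x * \<phi> x) x)"
    by (intro L2_fun_integrable_mult uL L2_fun_smooth \<Omega> smooth_fun_partial b smooth_fun_mult f s)
  have i2: "integrable (lebesgue_on \<Omega>) (\<lambda>x. ?D f x * u x * \<phi> x)"
    by (intro L2_fun_integrable_mult mult uL L2_fun_smooth \<Omega> smooth_fun_partial b f s)
  have i3: "integrable (lebesgue_on \<Omega>) (\<lambda>x. f x * w x * \<phi> x)"
    by (intro L2_fun_integrable_mult mult wL L2_fun_smooth \<Omega> smooth_fun_partial b f s)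
  have "(\<integral>x. f x * u x * ?D \<phi> x \<partial>lebesgue_on \<Omega>)
      = (\<integral>x. u x * ?D (\<lambda>x. f x * \<phi> x) x - ?D f x * u x * \<phi> x \<partial>lebesgue_on \<Omega>)"
    using smooth_differentiable[OF f] smooth_differentiable[OF s]
    by (simp add: partial_deriv_mult algebra_simps)
  also have "\<dots> = (\<integral>x. u x * ?D (\<lambda>x. f x * \<phi> x) x \<partial>lebesgue_on \<Omega>) - (\<integral>x. ?D f x * u x * \<phi> x \<partial>lebesgue_on \<Omega>)"
    using i1 i2 by simp
  also have "(\<integral>x. u x * ?D (\<lambda>x. f x * \<phi> x) x \<partial>lebesgue_on \<Omega>) = - (\<integral>x. f x * w x * \<phi> x \<partial>lebesgue_on \<Omega>)"
    using u test_fun_mult[OF f t] unfolding is_weak_partial_def by (simp add: mult_ac)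
  also have "- (\<integral>x. f x * w x * \<phi> x \<partial>lebesgue_on \<Omega>) - (\<integral>x. ?D f x * u x * \<phi> x \<partial>lebesgue_on \<Omega>)
      = - (\<integral>x. f x * w x * \<phi> x + ?D f x * u x * \<phi> x \<partial>lebesgue_on \<Omega>)"
    using i2 i3 by simp
  also have "\<dots> = - (\<integral>x. (f x * w x + ?D f x * u x) * \<phi> x \<partial>lebesgue_on \<Omega>)"
    by (simp add: distrib_right)
  finally show "(\<integral>x. f x * u x * ?D \<phi> x \<partial>lebesgue_on \<Omega>)
      = - (\<integral>x. (f x * w x + ?D f x * u x) * \<phi> x \<partial>lebesgue_on \<Omega>)" .
qed

text \<open>Since \<open>weak_partial\<close> is an arbitrary choice, its calculus rules can only
  hold almost everywhere; this lemma derives them from the rules for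
  \<open>is_weak_partial\<close>.\<close>

lemma is_weak_partial_unique:
  assumes b: "b \<in> Basis" and u: "is_weak_partial \<Omega> b u w" "is_weak_partial \<Omega> b u z"
  shows "AE x in lebesgue_on \<Omega>. w x = z x"
proof -
  note L2 = u[THEN is_weak_partial_L2]
  have "(\<integral>x. (w x - z x) * \<phi> x \<partial>lebesgue_on \<Omega>) = 0" if t: "test_fun \<Omega> \<phi>" for \<phi>
  proof -
    have "(\<integral>x. (w x - z x) * \<phi> x \<partial>lebesgue_on \<Omega>) = (\<integral>x. w x * \<phi> x - z x * \<phi> x \<partial>lebesgue_on \<Omega>)"
      by (simp add: left_diff_distrib)
    also have "\<dots> = (\<integral>x. w x * \<phi> x \<partial>lebesgue_on \<Omega>) - (\<integral>x. z x * \<phi> x \<partial>lebesgue_on \<Omega>)"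
      using L2 L2_fun_smooth[OF \<Omega> test_fun_smooth[OF t]] by (simp add: L2_fun_integrable_mult)
    also have "\<dots> = 0" using u t unfolding is_weak_partial_def by fastforce
    finally show ?thesis .
  qed
  then have "AE x in lebesgue_on \<Omega>. w x - z x = 0"
    by (intro fundamental_lemma \<Omega> L2_fun_diff L2) auto
  then show ?thesis by eventually_elim simp
qed

lemma W12_add: "W12 \<Omega> u \<Longrightarrow> W12 \<Omega> v \<Longrightarrow> W12 \<Omega> (\<lambda>x. u x + c * v x)"
  unfolding W12_def by (fast intro: is_weak_partial_add L2_fun_add L2_fun_cmult)

lemma W12_mult: "W12 \<Omega> u \<Longrightarrow> smooth_fun f \<Longrightarrow> W12 \<Omega> (\<lambda>x. f x * u x)"
  unfolding W12_def by (fast intro: is_weak_partial_mult L2_fun_smooth_mult \<Omega>)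

lemma weak_partial_add:
  assumes "W12 \<Omega> u" "W12 \<Omega> v" "b \<in> Basis"
  shows "AE x in lebesgue_on \<Omega>. weak_partial \<Omega> b (\<lambda>x. u x + c * v x) x
    = weak_partial \<Omega> b u x + c * weak_partial \<Omega> b v x"
  using assms by (intro is_weak_partial_unique[of b "\<lambda>x. u x + c * v x"] is_weak_partial_add
      weak_partial_works W12_add W12_L2)

lemma weak_partial_mult:
  assumes "W12 \<Omega> u" "smooth_fun f" "b \<in> Basis"
  shows "AE x in lebesgue_on \<Omega>. weak_partial \<Omega> b (\<lambda>x. f x * u x) x
    = f x * weak_partial \<Omega> b u x + partial_deriv b f x * u x"
  using assms by (intro is_weak_partial_unique[of b "\<lambda>x. f x * u x"] is_weak_partial_mult
      weak_partial_works W12_mult W12_L2)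

lemma weak_partial_AE_zero:
  assumes "W12 \<Omega> u" "AE x in lebesgue_on \<Omega>. u x = 0" "b \<in> Basis"
  shows "AE x in lebesgue_on \<Omega>. weak_partial \<Omega> b u x = 0"
proof (rule is_weak_partial_unique[OF assms(3) weak_partial_works[OF assms(1,3)]])
  have "(\<integral>x. u x * partial_deriv b \<phi> x \<partial>lebesgue_on \<Omega>) = 0" for \<phi>
    using assms(2) by (intro integral_eq_zero_AE) auto
  then show "is_weak_partial \<Omega> b u (\<lambda>x. 0)" by (simp add: is_weak_partial_def)
qed

end

context
  fixes \<Omega> :: "'a::euclidean_space set"
  assumes \<Omega>: "open \<Omega>" "bounded \<Omega>"
begin

lemma L2_surface_mult:
  assumes f: "smooth_fun f" and g: "L2_fun (surface_measure \<Omega>) g"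
  shows "L2_fun (surface_measure \<Omega>) (\<lambda>x. f x * g x)"
    and "\<And>U. (\<And>j. smooth_fun (U j)) \<Longrightarrow> L2_tendsto (surface_measure \<Omega>) U g \<Longrightarrow>
      L2_tendsto (surface_measure \<Omega>) (\<lambda>j x. f x * U j x) (\<lambda>x. f x * g x)"
proof -
  obtain C where C: "\<And>x. x \<in> closure \<Omega> \<Longrightarrow> \<bar>f x\<bar> \<le> C"
    using smooth_fun_bounded[OF \<Omega>(2) f] by blast
  then have C': "x \<in> space (surface_measure \<Omega>) \<Longrightarrow> \<bar>f x\<bar> \<le> C" for x
    by (auto simp: space_surface_measure frontier_def)
  show "L2_fun (surface_measure \<Omega>) (\<lambda>x. f x * g x)"
    by (rule L2_fun_bounded_mult[OF g smooth_surface[OF f] C'])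
  show "L2_tendsto (surface_measure \<Omega>) (\<lambda>j x. f x * U j x) (\<lambda>x. f x * g x)"
    if "\<And>j. smooth_fun (U j)" "L2_tendsto (surface_measure \<Omega>) U g" for U
    by (rule L2_tendsto_bounded_mult[OF smooth_surface[OF that(1)] L2_measurable[OF g] that(2) C'])
qed

lemma has_trace_add:
  assumes "has_trace \<Omega> u g" "has_trace \<Omega> v h"
  shows "has_trace \<Omega> (\<lambda>x. u x + c * v x) (\<lambda>x. g x + c * h x)"
proof -
  obtain U where u: "W12 \<Omega> u" "L2_fun (surface_measure \<Omega>) g" and U: "\<And>j. smooth_fun (U j)"
      "L2_tendsto (lebesgue_on \<Omega>) U u"
      "\<And>b. b\<in>Basis \<Longrightarrow> L2_tendsto (lebesgue_on \<Omega>) (\<lambda>j. partial_deriv b (U j)) (weak_partial \<Omega> b u)"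
      "L2_tendsto (surface_measure \<Omega>) U g"
    using assms(1) unfolding has_trace_def by blast
  obtain V where v: "W12 \<Omega> v" "L2_fun (surface_measure \<Omega>) h" and V: "\<And>j. smooth_fun (V j)"
      "L2_tendsto (lebesgue_on \<Omega>) V v"
      "\<And>b. b\<in>Basis \<Longrightarrow> L2_tendsto (lebesgue_on \<Omega>) (\<lambda>j. partial_deriv b (V j)) (weak_partial \<Omega> b v)"
      "L2_tendsto (surface_measure \<Omega>) V h"
    using assms(2) unfolding has_trace_def by blast
  have s: "smooth_fun (\<lambda>x. U j x + c * V j x)" for j
    by (intro smooth_fun_add smooth_fun_mult U V smooth_fun_const)
  have sc: "smooth_fun (\<lambda>x. c * V j x)" for j by (intro smooth_fun_mult V smooth_fun_const)
  have 1: "L2_tendsto (lebesgue_on \<Omega>) (\<lambda>j x. U j x + c * V j x) (\<lambda>x. u x + c * v x)"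
    by (intro L2_tendsto_add L2_tendsto_cmult smooth_lebesgue_on U V sc L2_measurable W12_L2 u v L2_fun_cmult)
  have 2: "L2_tendsto (surface_measure \<Omega>) (\<lambda>j x. U j x + c * V j x) (\<lambda>x. g x + c * h x)"
    by (intro L2_tendsto_add L2_tendsto_cmult smooth_surface U V sc L2_measurable u v L2_fun_cmult)
  have 3: "L2_tendsto (lebesgue_on \<Omega>) (\<lambda>j. partial_deriv b (\<lambda>x. U j x + c * V j x))
      (weak_partial \<Omega> b (\<lambda>x. u x + c * v x))" if b: "b \<in> Basis" for b
  proof (rule L2_tendsto_cong)
    show "L2_tendsto (lebesgue_on \<Omega>) (\<lambda>j x. partial_deriv b (U j) x + c * partial_deriv b (V j) x)
        (\<lambda>x. weak_partial \<Omega> b u x + c * weak_partial \<Omega> b v x)"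
      by (intro L2_tendsto_add L2_tendsto_cmult L2_measurable L2_fun_cmult weak_partial_L2 u v U V b
          L2_fun_smooth \<Omega> smooth_fun_partial)
    show "AE x in lebesgue_on \<Omega>. weak_partial \<Omega> b u x + c * weak_partial \<Omega> b v x
        = weak_partial \<Omega> b (\<lambda>x. u x + c * v x) x"
      using weak_partial_add[OF \<Omega> u(1) v(1) b, of c] by eventually_elim simp
    show "AE x in lebesgue_on \<Omega>. partial_deriv b (U j) x + c * partial_deriv b (V j) x
        = partial_deriv b (\<lambda>x. U j x + c * V j x) x" for j
      by (simp add: partial_deriv_add partial_deriv_mult smooth_differentiable U V sc)
  qed
  show ?thesis unfolding has_trace_def
    by (intro conjI W12_add \<Omega> u v L2_fun_add L2_fun_cmult exI[of _ "\<lambda>j x. U j x + c * V j x"] allI ballI s 1 2 3)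
qed

lemma partial_deriv_mult_L2_tendsto:
  assumes f: "smooth_fun f" and u: "W12 \<Omega> u" and U: "\<And>j. smooth_fun (U j)"
      "L2_tendsto (lebesgue_on \<Omega>) U u"
      "L2_tendsto (lebesgue_on \<Omega>) (\<lambda>j. partial_deriv b (U j)) (weak_partial \<Omega> b u)" and b: "b \<in> Basis"
  shows "L2_tendsto (lebesgue_on \<Omega>) (\<lambda>j. partial_deriv b (\<lambda>x. f x * U j x))
    (weak_partial \<Omega> b (\<lambda>x. f x * u x))"
proof (rule L2_tendsto_cong)
  show "L2_tendsto (lebesgue_on \<Omega>) (\<lambda>j x. f x * partial_deriv b (U j) x + partial_deriv b f x * U j x)
      (\<lambda>x. f x * weak_partial \<Omega> b u x + partial_deriv b f x * u x)"
    by (intro L2_tendsto_add L2_tendsto_smooth_mult L2_measurable L2_fun_smooth_mult W12_L2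
        weak_partial_L2 u U b f L2_fun_smooth \<Omega> smooth_fun_partial)
  show "AE x in lebesgue_on \<Omega>. f x * weak_partial \<Omega> b u x + partial_deriv b f x * u x
      = weak_partial \<Omega> b (\<lambda>x. f x * u x) x"
    using weak_partial_mult[OF \<Omega> u f b] by eventually_elim simp
  show "AE x in lebesgue_on \<Omega>. f x * partial_deriv b (U j) x + partial_deriv b f x * U j x
      = partial_deriv b (\<lambda>x. f x * U j x) x" for j
    by (simp add: partial_deriv_mult smooth_differentiable U f)
qed

lemma has_trace_mult:
  assumes f: "smooth_fun f" and "has_trace \<Omega> u g"
  shows "has_trace \<Omega> (\<lambda>x. f x * u x) (\<lambda>x. f x * g x)"
proof -
  obtain U where u: "W12 \<Omega> u" "L2_fun (surface_measure \<Omega>) g" and U: "\<And>j. smooth_fun (U j)"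
      "L2_tendsto (lebesgue_on \<Omega>) U u"
      "\<And>b. b\<in>Basis \<Longrightarrow> L2_tendsto (lebesgue_on \<Omega>) (\<lambda>j. partial_deriv b (U j)) (weak_partial \<Omega> b u)"
      "L2_tendsto (surface_measure \<Omega>) U g"
    using assms(2) unfolding has_trace_def by blast
  have s: "smooth_fun (\<lambda>x. f x * U j x)" for j by (intro smooth_fun_mult U f)
  have 3: "L2_tendsto (lebesgue_on \<Omega>) (\<lambda>j. partial_deriv b (\<lambda>x. f x * U j x))
      (weak_partial \<Omega> b (\<lambda>x. f x * u x))" if b: "b \<in> Basis" for b
    by (intro partial_deriv_mult_L2_tendsto f u U b)
  show ?thesis unfolding has_trace_def
    by (intro conjI W12_mult \<Omega> u f L2_surface_mult U exI[of _ "\<lambda>j x. f x * U j x"] allI ballI s 3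
        L2_tendsto_smooth_mult W12_L2)
qed

lemma has_trace_cong:
  assumes "has_trace \<Omega> u g" "\<And>x. x \<in> frontier \<Omega> \<Longrightarrow> g x = h x"
  shows "has_trace \<Omega> u h"
proof -
  have "L2_fun (surface_measure \<Omega>) g = L2_fun (surface_measure \<Omega>) h"
    unfolding L2_fun_def
    by (intro conj_cong measurable_cong Bochner_Integration.integrable_cong refl)
      (auto simp: space_surface_measure assms(2))
  moreover have "L2_tendsto (surface_measure \<Omega>) U h" if "L2_tendsto (surface_measure \<Omega>) U g" for U
    by (rule L2_tendsto_cong[OF that]) (auto simp: space_surface_measure assms(2))
  ultimately show ?thesis using assms(1) unfolding has_trace_def by blast
qed

end

section \<open>Boundary charts\<close>

lemma inner_gradient: "f differentiable at x \<Longrightarrow> v \<bullet> gradient f x = partial_deriv v f x"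
proof -
  assume "f differentiable at x"
  then have l: "linear (\<lambda>v. partial_deriv v f x)" by (rule partial_deriv_linear)
  have "partial_deriv v f x = partial_deriv (\<Sum>b\<in>Basis. (v \<bullet> b) *\<^sub>R b) f x"
    by (simp add: euclidean_representation)
  also have "\<dots> = (\<Sum>b\<in>Basis. (v \<bullet> b) * partial_deriv b f x)"
    using linear_sum[OF l, of "\<lambda>b. (v \<bullet> b) *\<^sub>R b" Basis] linear_scale[OF l] by simp
  also have "\<dots> = v \<bullet> gradient f x"
    by (simp add: gradient_def inner_sum_right mult.commute)
  finally show ?thesis by simp
qed

lemma partial_deriv_expansion:
  assumes "smooth_fun F"
  shows "partial_deriv v F x = (\<Sum>b\<in>Basis. (v \<bullet> b) * partial_deriv b F x)"
  using inner_gradient[OF smooth_differentiable[OF assms], of v]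
  by (simp add: gradient_def inner_sum_right mult.commute)

text \<open>\<open>outer_normal\<close> at a point refers to charts centred at that point, whereas a
  finite cover supplies charts centred elsewhere.\<close>

lemma boundary_graph_shift:
  assumes "boundary_graph \<Omega> p r e \<gamma>" "q \<in> ball p r"
  shows "boundary_graph \<Omega> q (r - dist p q) e \<gamma>"
proof -
  have sub: "ball q (r - dist p q) \<subseteq> ball p r"
  proof
    fix y assume "y \<in> ball q (r - dist p q)"
    then show "y \<in> ball p r" using dist_triangle[of p y q] by simp
  qed
  have eq: "x \<in> \<Omega> \<longleftrightarrow> \<gamma> x < x \<bullet> e" if "x \<in> ball p r" for x
    using assms(1) that unfolding boundary_graph_def by blast
  have "\<Omega> \<inter> ball q (r - dist p q) = {x \<in> ball q (r - dist p q). \<gamma> x < x \<bullet> e}"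
    using sub eq by blast
  with assms show ?thesis unfolding boundary_graph_def by simp
qed

locale boundary_chart =
  fixes \<Omega> :: "'a::euclidean_space set" and p :: 'a and r :: real and e :: 'a and \<gamma> :: "'a \<Rightarrow> real"
  assumes chart: "boundary_graph \<Omega> p r e \<gamma>" and open_domain: "open \<Omega>"
begin

abbreviation (input) "vol \<equiv> lebesgue_on \<Omega>"

abbreviation (input) "surf \<equiv> surface_measure \<Omega>"

text \<open>Measured along \<open>e\<close>, so in general not the distance to the boundary. In
  exchange it is smooth on the whole space and grows with exactly unit speed along \<open>e\<close>,
  which makes shifts along \<open>e\<close> compatible with strips.\<close>

definition height :: "'a \<Rightarrow> real" where
  "height x = x \<bullet> e - \<gamma> x"

definition foot :: "'a \<Rightarrow> 'a" where
  "foot x = x - height x *\<^sub>R e"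

lemma r_pos: "0 < r"
  using chart by (simp add: boundary_graph_def)

lemma e_e [simp]: "e \<bullet> e = 1"
proof -
  have "e \<in> Basis \<or> - e \<in> Basis" using chart by (simp add: boundary_graph_def)
  then show ?thesis using inner_same_Basis[of e] inner_same_Basis[of "- e"] by auto
qed

lemma norm_e [simp]: "norm e = 1"
  by (simp add: norm_eq_sqrt_inner)

lemma smooth_gamma: "smooth_fun \<gamma>"
  using chart by (simp add: boundary_graph_def)

lemma smooth_height: "smooth_fun height"
  unfolding height_def by (intro smooth_fun_diff smooth_fun_inner smooth_gamma)

lemma gamma_shift [simp]: "\<gamma> (x + t *\<^sub>R e) = \<gamma> x" "\<gamma> (x - t *\<^sub>R e) = \<gamma> x"
proof -
  show *: "\<gamma> (x + t *\<^sub>R e) = \<gamma> x" for t using chart by (simp add: boundary_graph_def)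
  from *[of "- t"] show "\<gamma> (x - t *\<^sub>R e) = \<gamma> x" by simp
qed

lemma height_shift [simp]: "height (x + t *\<^sub>R e) = height x + t" "height (x - t *\<^sub>R e) = height x - t"
  by (simp_all add: height_def inner_add_left inner_diff_left)

lemma height_foot [simp]: "height (foot x) = 0"
  by (simp add: foot_def)

lemma foot_shift [simp]: "foot (x + t *\<^sub>R e) = foot x" "foot (x - t *\<^sub>R e) = foot x"
  by (simp_all add: foot_def algebra_simps)

lemma foot_eq: "height x = 0 \<Longrightarrow> foot x = x"
  by (simp add: foot_def)

lemma mem_domain: "x \<in> ball p r \<Longrightarrow> x \<in> \<Omega> \<longleftrightarrow> 0 < height x"
  using chart unfolding boundary_graph_def height_def by (simp add: set_eq_iff) blast

lemma height_measurable [measurable]: "height \<in> borel_measurable borel"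
  using smooth_height by (rule smooth_fun_measurable)

lemma foot_measurable [measurable]: "foot \<in> borel_measurable borel"
  unfolding foot_def by measurable

lemma continuous_height: "continuous_on S height"
  using smooth_height by (rule smooth_fun_continuous)

text \<open>A point of negative height has a neighbourhood that misses the domain; a point of height
  0 is a limit of points shifted upwards along \<open>e\<close>.\<close>

lemma mem_frontier:
  assumes "x \<in> ball p r" shows "x \<in> frontier \<Omega> \<longleftrightarrow> height x = 0"
proof
  assume x: "x \<in> frontier \<Omega>"
  then have nx: "x \<notin> \<Omega>" using open_domain by (simp add: frontier_def interior_open)
  with assms have le: "height x \<le> 0" using mem_domain by force
  show "height x = 0"
  proof (rule ccontr)
    assume "height x \<noteq> 0"
    with le have "x \<in> {y. height y < 0} \<inter> ball p r" using assms by auto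
    moreover have "open ({y. height y < 0} \<inter> ball p r)"
      by (intro open_Int open_ball open_Collect_less continuous_height continuous_on_const)
    moreover have "{y. height y < 0} \<inter> ball p r \<inter> \<Omega> = {}" using mem_domain by force
    ultimately have "x \<notin> closure \<Omega>" using open_Int_closure_eq_empty by blast
    with x show False by (simp add: frontier_def)
  qed
next
  assume h: "height x = 0"
  then have nx: "x \<notin> \<Omega>" using assms mem_domain by auto
  have "x \<in> closure \<Omega>"
    unfolding closure_approachable
  proof (intro allI impI)
    fix \<epsilon> :: real assume "0 < \<epsilon>"
    define t where "t = min \<epsilon> (r - dist p x) / 2"
    have t: "0 < t" "t < \<epsilon>" "t < r - dist p x" using \<open>0 < \<epsilon>\<close> assms by (auto simp: t_def)
    have d: "dist (x + t *\<^sub>R e) x = t" using t by (simp add: dist_norm)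
    then have "x + t *\<^sub>R e \<in> ball p r"
      using t dist_triangle[of p "x + t *\<^sub>R e" x] by (simp add: dist_commute)
    then have "x + t *\<^sub>R e \<in> \<Omega>" using mem_domain t h by simp
    then show "\<exists>y\<in>\<Omega>. dist y x < \<epsilon>" using d t by (intro bexI[of _ "x + t *\<^sub>R e"]) auto
  qed
  with nx open_domain show "x \<in> frontier \<Omega>" by (simp add: frontier_def interior_open)
qed

lemma partial_deriv_height: "partial_deriv v height x = v \<bullet> (e - gradient \<gamma> x)"
  unfolding height_def inner_diff_right inner_gradient[OF smooth_differentiable[OF smooth_gamma]]
  by (simp add: partial_deriv_diff smooth_differentiable smooth_gamma smooth_fun_inner partial_deriv_inner)

lemma height_along:
  "((\<lambda>t. height (x + t *\<^sub>R v)) has_real_derivative v \<bullet> (e - gradient \<gamma> x)) (at 0)"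
proof -
  have 1: "((\<lambda>t. x + t *\<^sub>R v) has_derivative (\<lambda>t. t *\<^sub>R v)) (at 0)"
    by (auto intro!: derivative_eq_intros)
  have 2: "(height has_derivative (\<lambda>v. v \<bullet> (e - gradient \<gamma> x))) (at (x + 0 *\<^sub>R v))"
    using smooth_fun_has_derivative[OF smooth_height, of x] by (simp add: partial_deriv_height)
  show ?thesis
    using has_derivative_compose[OF 1 2] by (simp add: has_field_derivative_def mult_commute_abs)
qed

lemma partial_deriv_e_height: "partial_deriv e height x = 1"
proof -
  have "((\<lambda>t. height (x + t *\<^sub>R e)) has_real_derivative 1) (at 0)"
    by (auto intro!: derivative_eq_intros)
  then show ?thesis using DERIV_unique[OF height_along] by (simp add: partial_deriv_height)
qed

lemma normal_nonzero: "e - gradient \<gamma> x \<noteq> 0"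
  using partial_deriv_e_height[of x] partial_deriv_height[of e x] by auto

text \<open>The vector \<open>e - gradient \<gamma> p\<close> points inwards. Whether a ray enters
  or avoids the domain does not depend on the chart, so this is the criterion by which the normals
  of two charts are compared.\<close>

lemma eventually_in_domain:
  assumes p: "p \<in> frontier \<Omega>"
  shows "0 < v \<bullet> (e - gradient \<gamma> p) \<Longrightarrow> \<exists>d>0. \<forall>t>0. t < d \<longrightarrow> p + t *\<^sub>R v \<in> \<Omega>"
    and "v \<bullet> (e - gradient \<gamma> p) < 0 \<Longrightarrow> \<exists>d>0. \<forall>t>0. t < d \<longrightarrow> p + t *\<^sub>R v \<notin> \<Omega>"
proof -
  have h0: "height p = 0" using mem_frontier[of p] p r_pos by simp
  \<comment> \<open>The summand 1 in the witness covers \<open>v = 0\<close>.\<close>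
  obtain d' where d': "0 < d'" "\<And>t. 0 < t \<Longrightarrow> t < d' \<Longrightarrow> p + t *\<^sub>R v \<in> ball p r"
  proof (rule that[of "r / (norm v + 1)"])
    show "0 < r / (norm v + 1)" using r_pos by (simp add: add_nonneg_pos)
    fix t assume "0 < t" "t < r / (norm v + 1)"
    then have "t * (norm v + 1) < r" by (simp add: pos_less_divide_eq add_nonneg_pos)
    then show "p + t *\<^sub>R v \<in> ball p r" using \<open>0 < t\<close> by (simp add: dist_norm algebra_simps)
  qed
  show "\<exists>d>0. \<forall>t>0. t < d \<longrightarrow> p + t *\<^sub>R v \<in> \<Omega>" if pos: "0 < v \<bullet> (e - gradient \<gamma> p)"
  proof -
    obtain d where "0 < d" "\<And>t. 0 < t \<Longrightarrow> t < d \<Longrightarrow> 0 < height (p + t *\<^sub>R v)"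
      using DERIV_pos_inc_right[OF height_along pos] h0 by auto
    then show ?thesis using d' mem_domain by (intro exI[of _ "min d d'"]) auto
  qed
  show "\<exists>d>0. \<forall>t>0. t < d \<longrightarrow> p + t *\<^sub>R v \<notin> \<Omega>" if neg: "v \<bullet> (e - gradient \<gamma> p) < 0"
  proof -
    obtain d where d: "0 < d" "\<And>t. 0 < t \<Longrightarrow> t < d \<Longrightarrow> height (p + t *\<^sub>R v) < 0"
      using DERIV_neg_dec_right[OF height_along neg] h0 by auto
    have "p + t *\<^sub>R v \<notin> \<Omega>" if "0 < t" "t < min d d'" for t
      using d(2)[of t] d'(2)[of t] mem_domain[of "p + t *\<^sub>R v"] that by auto
    then show ?thesis using d' d by (intro exI[of _ "min d d'"]) auto
  qed
qed

lemma height_lipschitz: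
  assumes "0 \<le> R"
  obtains L where "0 \<le> L" "\<And>x y. x \<in> cball 0 R \<Longrightarrow> y \<in> cball 0 R \<Longrightarrow> \<bar>height x - height y\<bar> \<le> L * norm (x - y)"
proof -
  have "continuous_on (cball 0 R) (\<lambda>x. gradient height x)" unfolding gradient_def
    by (intro continuous_intros smooth_fun_continuous smooth_fun_partial smooth_height)
  then have "bounded (gradient height ` cball 0 R)"
    by (intro compact_imp_bounded compact_continuous_image) auto
  then obtain L where L: "\<And>x. x \<in> cball 0 R \<Longrightarrow> norm (gradient height x) \<le> L"
    unfolding bounded_iff by blast
  have "0 \<le> L" using L[of 0] assms norm_ge_zero[of "gradient height 0"] by (simp del: norm_ge_zero)
  moreover have "norm (height x - height y) \<le> L * norm (x - y)" if "x \<in> cball 0 R" "y \<in> cball 0 R" for x y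
  proof (rule differentiable_bound[OF convex_cball _ _ that])
    fix z :: 'a assume z: "z \<in> cball 0 R"
    show "(height has_derivative (\<lambda>v. partial_deriv v height z)) (at z within cball 0 R)"
      using smooth_fun_has_derivative[OF smooth_height] has_derivative_at_withinI by blast
    show "onorm (\<lambda>v. partial_deriv v height z) \<le> L"
    proof (rule onorm_bound[OF \<open>0 \<le> L\<close>])
      fix v
      have "norm (partial_deriv v height z) \<le> norm v * norm (gradient height z)"
        unfolding inner_gradient[OF smooth_differentiable[OF smooth_height], symmetric]
        by (simp add: Cauchy_Schwarz_ineq2)
      also have "\<dots> \<le> norm v * L" using L[OF z] by (intro mult_left_mono) auto
      finally show "norm (partial_deriv v height z) \<le> L * norm v" by (simp add: mult.commute)
    qed
  qed
  ultimately show ?thesis using that by auto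
qed

lemma e_basis:
  obtains e0 where "e0 \<in> Basis" "\<bar>e \<bullet> e0\<bar> = 1" "\<And>b. b \<in> Basis \<Longrightarrow> b \<noteq> e0 \<Longrightarrow> e \<bullet> b = 0"
proof (cases "e \<in> Basis")
  case True
  then show ?thesis by (intro that[of e]) (auto simp: inner_Basis)
next
  case False
  then have e': "- e \<in> Basis" using chart by (simp add: boundary_graph_def)
  show ?thesis
  proof (rule that[OF e'])
    show "e \<bullet> b = 0" if "b \<in> Basis" "b \<noteq> - e" for b
      using inner_not_same_Basis[OF e' that(1)] that(2) by auto
  qed simp
qed

end

text \<open>The \<open>THE\<close> requires independence of the chart. If the unit inward normals a
  and b of two charts differed, then a - b would have a positive product with a and a negative one
  with b, so short steps in this direction would lie inside the domain by one chart and outside by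
  the other.\<close>

lemma outer_normal_eq:
  assumes "open \<Omega>" "boundary_graph \<Omega> p r e \<gamma>" "q \<in> ball p r" "q \<in> frontier \<Omega>"
  shows "outer_normal \<Omega> q = sgn (gradient \<gamma> q - e)"
proof -
  have b: "boundary_graph \<Omega> q (r - dist p q) e \<gamma>" by (rule boundary_graph_shift[OF assms(2,3)])
  have uniq: "sgn (gradient \<gamma>1 q - e1) = sgn (gradient \<gamma>2 q - e2)"
    if c1: "boundary_graph \<Omega> q r1 e1 \<gamma>1" and c2: "boundary_graph \<Omega> q r2 e2 \<gamma>2" for r1 e1 \<gamma>1 r2 e2 \<gamma>2
  proof (rule ccontr)
    interpret A: boundary_chart \<Omega> q r1 e1 \<gamma>1 using c1 assms(1) by unfold_locales
    interpret B: boundary_chart \<Omega> q r2 e2 \<gamma>2 using c2 assms(1) by unfold_locales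
    define a where "a = e1 - gradient \<gamma>1 q"
    define b where "b = e2 - gradient \<gamma>2 q"
    have nz: "a \<noteq> 0" "b \<noteq> 0" using A.normal_nonzero B.normal_nonzero by (auto simp: a_def b_def)
    assume "\<not> ?thesis"
    then have ne: "sgn a \<noteq> sgn b" unfolding a_def b_def
      by (metis minus_diff_eq sgn_minus)
    have u: "sgn a \<bullet> sgn a = 1" "sgn b \<bullet> sgn b = 1" "sgn b \<bullet> sgn a = sgn a \<bullet> sgn b"
      using nz by (simp_all add: dot_square_norm norm_sgn inner_commute)
    have "0 < (sgn a - sgn b) \<bullet> (sgn a - sgn b)" using ne by simp
    then have lt: "sgn a \<bullet> sgn b < 1" using u by (simp add: inner_diff_left inner_diff_right)
    have "(sgn a - sgn b) \<bullet> sgn a > 0" "(sgn a - sgn b) \<bullet> sgn b < 0"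
      using lt u by (simp_all add: inner_diff_left)
    moreover have "(sgn a - sgn b) \<bullet> sgn c = (sgn a - sgn b) \<bullet> c / norm c" for c
      by (simp add: sgn_div_norm divide_inverse mult.commute)
    ultimately have s: "(sgn a - sgn b) \<bullet> a > 0" "(sgn a - sgn b) \<bullet> b < 0"
      using nz by (simp_all add: zero_less_divide_iff divide_less_0_iff)
    obtain d where d: "0 < d" "\<And>t. 0 < t \<Longrightarrow> t < d \<Longrightarrow> q + t *\<^sub>R (sgn a - sgn b) \<in> \<Omega>"
      using A.eventually_in_domain(1)[OF assms(4)] s(1) unfolding a_def by blast
    obtain d' where d': "0 < d'" "\<And>t. 0 < t \<Longrightarrow> t < d' \<Longrightarrow> q + t *\<^sub>R (sgn a - sgn b) \<notin> \<Omega>"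
      using B.eventually_in_domain(2)[OF assms(4)] s(2) unfolding b_def by blast
    have "0 < min d d' / 2" "min d d' / 2 < d" "min d d' / 2 < d'" using d(1) d'(1) by auto
    then show False using d(2) d'(2) by blast
  qed
  show ?thesis unfolding outer_normal_def
    by (rule the_equality) (use b uniq in blast)+
qed

section \<open>Surface measure and the volume of tubes\<close>

context boundary_chart
begin

text \<open>Surface measure and tube volume are only compared up to constants, which avoids the
  isodiametric inequality.\<close>

definition tube :: "'a set \<Rightarrow> 'a set" where
  "tube A = {x. 0 < height x \<and> height x < 1 \<and> foot x \<in> A}"

lemma tube_measurable [measurable]: "A \<in> sets borel \<Longrightarrow> tube A \<in> sets borel"
proof -
  assume "A \<in> sets borel"
  then have "foot -` A \<in> sets borel" using measurable_sets_borel[OF foot_measurable] by simp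
  moreover have "{x. 0 < height x \<and> height x < 1} \<in> sets borel" by measurable
  moreover have "tube A = {x. 0 < height x \<and> height x < 1} \<inter> foot -` A" by (auto simp: tube_def)
  ultimately show ?thesis by auto
qed

lemma prod_basis_e: "(\<Prod>b\<in>Basis. c + 2 * \<bar>e \<bullet> b\<bar>) = c ^ (DIM('a) - 1) * (c + 2)" for c :: real
proof -
  obtain e0 where e0: "e0 \<in> Basis" "\<bar>e \<bullet> e0\<bar> = 1" "\<And>b. b \<in> Basis \<Longrightarrow> b \<noteq> e0 \<Longrightarrow> e \<bullet> b = 0"
    using e_basis by blast
  have "(\<Prod>b\<in>Basis. c + 2 * \<bar>e \<bullet> b\<bar>) = (c + 2) * (\<Prod>b\<in>Basis - {e0}. c + 2 * \<bar>e \<bullet> b\<bar>)"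
    using e0 by (subst prod.remove[of _ e0]) auto
  also have "(\<Prod>b\<in>Basis - {e0}. c + 2 * \<bar>e \<bullet> b\<bar>) = (\<Prod>b\<in>Basis - {e0}. c)"
    using e0(3) by (intro prod.cong) auto
  also have "\<dots> = c ^ (DIM('a) - 1)" using e0(1) by (simp add: card_Diff_singleton)
  finally show ?thesis by (simp add: mult.commute)
qed

text \<open>If d is the diameter of \<open>C\<close> and n the dimension, the tube lies in a box
  with half-sides d across \<open>e\<close> and d + 1 along \<open>e\<close>. For d \<le> 1 its
  volume is at most 4 (2 d)^(n-1) = 4^n (d/2)^(n-1), which explains the constant 4^n.\<close>

lemma tube_le_hausdorff_cost:
  assumes "bounded C" "diameter C \<le> 1"
  obtains B where "tube C \<subseteq> B" "B \<in> sets borel"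
    "ennreal (unit_ball_vol (real (DIM('a) - 1)) / 4 ^ DIM('a)) * emeasure lborel B
      \<le> hausdorff_cost (DIM('a) - 1) C"
proof (cases "C = {}")
  case True
  then show ?thesis by (intro that[of "{}"]) (auto simp: tube_def)
next
  case False
  then obtain c0 where c0: "c0 \<in> C" by blast
  define d where "d = diameter C"
  have d: "0 \<le> d" "d \<le> 1" using assms diameter_ge_0[OF assms(1)] by (auto simp: d_def)
  define h where "h = (\<Sum>b\<in>Basis. (d + \<bar>e \<bullet> b\<bar>) *\<^sub>R b)"
  have hb: "h \<bullet> b = d + \<bar>e \<bullet> b\<bar>" if "b \<in> Basis" for b
    using that by (simp add: h_def)
  define n where "n = DIM('a) - 1"
  have n: "DIM('a) = Suc n" using DIM_positive[where 'a='a] by (simp add: n_def)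
  show ?thesis
  proof (rule that[of "cbox (c0 - h) (c0 + h)"])
    show "tube C \<subseteq> cbox (c0 - h) (c0 + h)"
    proof
      fix x assume x: "x \<in> tube C"
      have "x \<bullet> b \<le> (c0 + h) \<bullet> b \<and> (c0 - h) \<bullet> b \<le> x \<bullet> b" if b: "b \<in> Basis" for b
      proof -
        have "dist (foot x) c0 \<le> d" unfolding d_def
          using x c0 by (intro diameter_bounded_bound assms(1)) (auto simp: tube_def)
        then have 1: "\<bar>foot x \<bullet> b - c0 \<bullet> b\<bar> \<le> d"
          using Basis_le_norm[OF b, of "foot x - c0"] by (simp add: dist_norm inner_diff_left)
        have "x \<bullet> b = foot x \<bullet> b + height x * (e \<bullet> b)" by (simp add: foot_def inner_diff_left)
        moreover have "\<bar>height x * (e \<bullet> b)\<bar> \<le> \<bar>e \<bullet> b\<bar>"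
          using x by (auto simp: tube_def abs_mult intro!: mult_left_le_one_le)
        ultimately show ?thesis using 1 unfolding abs_le_iff
          by (simp add: inner_add_left inner_diff_left hb[OF b])
      qed
      then show "x \<in> cbox (c0 - h) (c0 + h)" by (auto simp: mem_box)
    qed
    have "emeasure lborel (cbox (c0 - h) (c0 + h)) = ennreal (\<Prod>b\<in>Basis. ((c0 + h) - (c0 - h)) \<bullet> b)"
      using d by (subst emeasure_lborel_cbox_eq) (auto simp: inner_add_left inner_diff_left hb)
    also have "(\<Prod>b\<in>Basis. ((c0 + h) - (c0 - h)) \<bullet> b) = (\<Prod>b\<in>Basis. 2 * d + 2 * \<bar>e \<bullet> b\<bar>)"
      by (intro prod.cong) (auto simp: inner_add_left inner_diff_left hb)
    also have "\<dots> = (2 * d) ^ n * (2 * d + 2)" using prod_basis_e[of "2 * d"] by (simp add: n_def)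
    also have "ennreal ((2 * d) ^ n * (2 * d + 2)) \<le> ennreal ((2 * d) ^ n * 4)"
      using d by (intro ennreal_leI mult_left_mono) auto
    finally have "ennreal (unit_ball_vol (real n) / 4 ^ Suc n) * emeasure lborel (cbox (c0 - h) (c0 + h))
        \<le> ennreal (unit_ball_vol (real n) / 4 ^ Suc n) * ennreal ((2 * d) ^ n * 4)"
      by (intro mult_left_mono) auto
    also have "\<dots> = ennreal (unit_ball_vol (real n) / 4 ^ Suc n * ((2 * d) ^ n * 4))"
      using d by (intro ennreal_mult[symmetric]) auto
    also have "unit_ball_vol (real n) / 4 ^ Suc n * ((2 * d) ^ n * 4) = unit_ball_vol (real n) * (d / 2) ^ n"
    proof -
      have "(2 * d) ^ n = (4 * (d / 2)) ^ n" by simp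
      also have "\<dots> = 4 ^ n * (d / 2) ^ n" by (rule power_mult_distrib)
      finally show ?thesis by (simp del: power_divide power_mult_distrib)
    qed
    finally show "ennreal (unit_ball_vol (real (DIM('a) - 1)) / 4 ^ DIM('a)) * emeasure lborel (cbox (c0 - h) (c0 + h))
        \<le> hausdorff_cost (DIM('a) - 1) C"
      using False by (simp add: hausdorff_cost_def n d_def)
  qed simp
qed

text \<open>The supremum over mesh sizes is at least its value at mesh 1. The covering sets are
  arbitrary and the tubes over them perhaps not Borel, so boxes containing these tubes are summed
  instead.\<close>

lemma tube_le_hausdorff_outer:
  assumes A: "A \<in> sets borel"
  shows "ennreal (unit_ball_vol (real (DIM('a) - 1)) / 4 ^ DIM('a)) * emeasure lborel (tube A)
      \<le> hausdorff_outer (DIM('a) - 1) A" (is "?c * _ \<le> _")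
  unfolding hausdorff_outer_def
proof (rule SUP_upper2[of 1])
  show "?c * emeasure lborel (tube A) \<le> (INF C\<in>{C. (\<forall>j. bounded (C j) \<and> diameter (C j) \<le> 1) \<and> A \<subseteq> (\<Union>j. C j)}.
        \<Sum>j. hausdorff_cost (DIM('a) - 1) (C j))"
  proof (rule INF_greatest)
    fix C :: "nat \<Rightarrow> 'a set"
    assume C: "C \<in> {C. (\<forall>j. bounded (C j) \<and> diameter (C j) \<le> 1) \<and> A \<subseteq> (\<Union>j. C j)}"
    have "\<forall>j. \<exists>B. tube (C j) \<subseteq> B \<and> B \<in> sets borel \<and>
        ?c * emeasure lborel B \<le> hausdorff_cost (DIM('a) - 1) (C j)"
      (is "\<forall>j. ?P j")
    proof
      fix j
      have "bounded (C j)" "diameter (C j) \<le> 1" using C by auto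
      then show "?P j"
        using tube_le_hausdorff_cost by metis
    qed
    then obtain B where B: "\<And>j. tube (C j) \<subseteq> B j" "\<And>j. B j \<in> sets borel"
        "\<And>j. ?c * emeasure lborel (B j) \<le> hausdorff_cost (DIM('a) - 1) (C j)"
      by metis
    have "tube A \<subseteq> (\<Union>j. B j)"
    proof
      fix x assume x: "x \<in> tube A"
      then have "foot x \<in> (\<Union>j. C j)" using C by (auto simp: tube_def)
      then obtain j where "x \<in> tube (C j)" using x by (auto simp: tube_def)
      then show "x \<in> (\<Union>j. B j)" using B(1) by blast
    qed
    then have "emeasure lborel (tube A) \<le> emeasure lborel (\<Union>j. B j)"
      using B(2) by (intro emeasure_mono) auto
    also have "\<dots> \<le> (\<Sum>j. emeasure lborel (B j))"
      using B(2) by (intro emeasure_subadditive_countably) auto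
    finally have "?c * emeasure lborel (tube A) \<le> ?c * (\<Sum>j. emeasure lborel (B j))"
      by (intro mult_left_mono) auto
    also have "\<dots> = (\<Sum>j. ?c * emeasure lborel (B j))" by simp
    also have "\<dots> \<le> (\<Sum>j. hausdorff_cost (DIM('a) - 1) (C j))"
      using B(3) by (intro suminf_le) auto
    finally show "?c * emeasure lborel (tube A) \<le> (\<Sum>j. hausdorff_cost (DIM('a) - 1) (C j))" .
  qed
qed simp

end

text \<open>Outer regularity gives an open \<open>T\<close> of small volume around \<open>N\<close>.
  The dyadic cubes of \<open>covering_lemma\<close> lie in \<open>T\<close> and have disjoint
  interiors, so their volumes add up to at most that of \<open>T\<close>.\<close>

lemma null_set_cube_cover:
  fixes N :: "'a::euclidean_space set"
  assumes N: "N \<in> null_sets lborel" "bounded N" and \<eta>: "0 < (\<eta> :: real)" and \<delta>: "0 < \<delta>"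
  obtains K :: "nat \<Rightarrow> 'a set" and l :: "nat \<Rightarrow> real"
  where "N \<subseteq> (\<Union>j. K j)" "\<And>j. bounded (K j)" "\<And>j. diameter (K j) \<le> \<delta>" "\<And>j. 0 \<le> l j"
    "\<And>j x y. x \<in> K j \<Longrightarrow> y \<in> K j \<Longrightarrow> norm (x - y) \<le> real DIM('a) * l j"
    "(\<Sum>j. ennreal (l j ^ DIM('a))) \<le> ennreal \<eta>" "\<And>j. K j \<noteq> {} \<Longrightarrow> K j \<inter> N \<noteq> {}"
proof -
  obtain R where R: "0 < R" "\<And>x. x \<in> N \<Longrightarrow> norm x \<le> R"
    using N(2) bounded_pos by blast
  \<comment> \<open>The bounding box is a cube, so that all its dyadic cells are cubes.\<close>
  define a where "a = (\<Sum>b\<in>Basis. R *\<^sub>R (b :: 'a))"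
  have ab: "a \<bullet> b = R" if "b \<in> Basis" for b using that by (simp add: a_def)
  have sub: "N \<subseteq> cbox (- a) a"
  proof
    fix x assume "x \<in> N"
    then have "\<bar>x \<bullet> b\<bar> \<le> R" if "b \<in> Basis" for b using R(2) Basis_le_norm[OF that, of x] by fastforce
    then show "x \<in> cbox (- a) a" using ab by (auto simp: mem_box abs_le_iff) (smt (verit))
  qed
  have ne: "box (- a) a \<noteq> {}" using R(1) ab by (auto simp: box_ne_empty)
  obtain T where T: "open T" "N \<subseteq> T" "emeasure lborel (T - N) < ennreal \<eta>"
    using outer_regular_lborel[of N \<eta>] null_setsD2[OF N(1)] \<eta> by auto
  have "emeasure lborel T = emeasure lborel (T - N)"
    using N(1) T(1) by (intro emeasure_Diff_null_set[symmetric]) auto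
  with T(3) have T\<eta>: "emeasure lborel T \<le> ennreal \<eta>" by simp
  \<comment> \<open>Each cube will lie in \<open>g x\<close> for a point \<open>x\<close> of
    \<open>N\<close>: this places it inside \<open>T\<close> and bounds its diameter by
    \<delta>.\<close>
  have "\<exists>g. gauge g \<and> (\<forall>x\<in>N. g x \<subseteq> T) \<and> (\<forall>x. g x \<subseteq> ball x (\<delta> / 2))"
    by (rule exI[of _ "\<lambda>x. ball x (\<delta> / 2) \<inter> (if x \<in> T then T else UNIV)"])
      (use T \<delta> in \<open>auto simp: gauge_def\<close>)
  then obtain g where g: "gauge g" "\<And>x. x \<in> N \<Longrightarrow> g x \<subseteq> T" "\<And>x. g x \<subseteq> ball x (\<delta> / 2)" by blast
  obtain D where D: "countable D" "\<And>K. K \<in> D \<Longrightarrow> interior K \<noteq> {} \<and> (\<exists>c d. K = cbox c d)"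
      "pairwise (\<lambda>A B. interior A \<inter> interior B = {}) D"
      "\<And>K. K \<in> D \<Longrightarrow> \<exists>x \<in> N \<inter> K. K \<subseteq> g x"
      "\<And>u v. cbox u v \<in> D \<Longrightarrow> \<exists>n. \<forall>i \<in> Basis. v \<bullet> i - u \<bullet> i = (a \<bullet> i - (- a) \<bullet> i) / 2^n"
      "N \<subseteq> \<Union>D"
    by (rule covering_lemma[OF sub ne g(1)]) blast
  have cube: "\<exists>u v l. K = cbox u v \<and> 0 < l \<and> (\<forall>i\<in>Basis. v \<bullet> i - u \<bullet> i = l)" if KD: "K \<in> D" for K
  proof -
    obtain u v where K: "K = cbox u v" using D(2)[OF KD] by blast
    with D(5) KD obtain n where n: "\<forall>i \<in> Basis. v \<bullet> i - u \<bullet> i = (a \<bullet> i - (- a) \<bullet> i) / 2^n" by blast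
    with K R(1) show ?thesis by (intro exI[of _ u] exI[of _ v] exI[of _ "2 * R / 2 ^ n"]) (auto simp: ab)
  qed
  \<comment> \<open>\<open>D\<close> may be finite, so its enumeration is padded with empty sets;
    they get side length 0 and, the dimension being positive, contribute volume 0.\<close>
  define K where "K j = (if j \<in> to_nat_on D ` D then from_nat_into D j else {})" for j
  have KD: "K j \<in> D \<or> K j = {}" for j
    using D(1) by (auto simp: K_def)
  have disj: "interior (K i) \<inter> interior (K j) = {}" if "i \<noteq> j" for i j
  proof (cases "K i = {} \<or> K j = {}")
    case False
    then have ij: "i \<in> to_nat_on D ` D" "j \<in> to_nat_on D ` D" by (auto simp: K_def split: if_splits)
    then have "K i \<noteq> K j" using that D(1) by (auto simp: K_def)
    then show ?thesis using KD[of i] KD[of j] False D(3) by (auto simp: pairwise_def)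
  qed auto
  have "\<forall>j. \<exists>l u v. 0 \<le> l \<and> (K j = {} \<longrightarrow> l = 0) \<and> (K j \<noteq> {} \<longrightarrow> K j = cbox u v \<and> (\<forall>i\<in>Basis. v \<bullet> i - u \<bullet> i = l))"
    (is "\<forall>j. ?P j")
  proof
    fix j
    show "?P j"
    proof (cases "K j = {}")
      case False
      then obtain u v l where "K j = cbox u v" "0 < l" "\<forall>i\<in>Basis. v \<bullet> i - u \<bullet> i = l"
        using cube KD[of j] by blast
      then show ?thesis using False by (intro exI[of _ l] exI[of _ u] exI[of _ v]) auto
    qed auto
  qed
  then obtain l u v where l: "\<And>j. 0 \<le> l j" "\<And>j. K j = {} \<Longrightarrow> l j = 0"
      "\<And>j. K j \<noteq> {} \<Longrightarrow> K j = cbox (u j) (v j)" "\<And>j i. K j \<noteq> {} \<Longrightarrow> i \<in> Basis \<Longrightarrow> v j \<bullet> i - u j \<bullet> i = l j"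
    by metis
  have in_g: "\<exists>x \<in> N \<inter> K j. K j \<subseteq> g x" if "K j \<noteq> {}" for j
    using D(4) KD[of j] that by blast
  show ?thesis
  proof (rule that[of K l])
    show "N \<subseteq> (\<Union>j. K j)"
    proof
      fix x assume "x \<in> N"
      then obtain X where X: "X \<in> D" "x \<in> X" using D(6) by blast
      then have "K (to_nat_on D X) = X" using D(1) by (simp add: K_def)
      with X(2) show "x \<in> (\<Union>j. K j)" by blast
    qed
    show "bounded (K j)" for j
    proof (cases "K j = {}")
      case False
      then show ?thesis using l(3) bounded_cbox by metis
    qed simp
    show "K j \<noteq> {} \<Longrightarrow> K j \<inter> N \<noteq> {}" for j using in_g by blast
    show "diameter (K j) \<le> \<delta>" for j
    proof (rule diameter_le)
      show "K j \<noteq> {} \<or> 0 \<le> \<delta>" using \<delta> by simp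
      fix x y assume xy: "x \<in> K j" "y \<in> K j"
      then obtain z where "K j \<subseteq> ball z (\<delta> / 2)" using in_g[of j] g(3) by blast
      then show "norm (x - y) \<le> \<delta>" using xy dist_triangle_half_r[of z x \<delta> y] by (force simp: dist_norm)
    qed
    show "0 \<le> l j" for j by (rule l)
    show "norm (x - y) \<le> real DIM('a) * l j" if "x \<in> K j" "y \<in> K j" for j x y
    proof -
      have ne: "K j \<noteq> {}" using that by auto
      have "norm (x - y) \<le> (\<Sum>i\<in>Basis. \<bar>(x - y) \<bullet> i\<bar>)" by (rule norm_le_l1)
      also have "\<dots> \<le> (\<Sum>i\<in>(Basis::'a set). l j)"
      proof (rule sum_mono)
        fix i :: 'a assume i: "i \<in> Basis"
        have "u j \<bullet> i \<le> x \<bullet> i" "x \<bullet> i \<le> v j \<bullet> i" "u j \<bullet> i \<le> y \<bullet> i" "y \<bullet> i \<le> v j \<bullet> i"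
          using that i unfolding l(3)[OF ne] by (auto simp: mem_box)
        then show "\<bar>(x - y) \<bullet> i\<bar> \<le> l j" using l(4)[OF ne i] by (simp add: inner_diff_left)
      qed
      finally show ?thesis by simp
    qed
    have em: "emeasure lborel (interior (K j)) = ennreal (l j ^ DIM('a))" for j
    proof (cases "K j = {}")
      case True
      then show ?thesis using l(2) DIM_positive[where 'a='a] by (simp add: power_0_left)
    next
      case False
      then have "\<forall>i\<in>Basis. u j \<bullet> i \<le> v j \<bullet> i" using l(1)[of j] l(4)[of j] by fastforce
      then have "emeasure lborel (interior (K j)) = ennreal (\<Prod>i\<in>Basis. (v j - u j) \<bullet> i)"
        using l(3)[OF False] by (simp add: emeasure_lborel_box_eq interior_cbox)
      also have "(\<Prod>i\<in>Basis. (v j - u j) \<bullet> i) = (\<Prod>i\<in>(Basis::'a set). l j)"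
        using l(4)[OF False] by (intro prod.cong) (auto simp: inner_diff_left)
      finally show ?thesis by simp
    qed
    have "(\<Sum>j. ennreal (l j ^ DIM('a))) = emeasure lborel (\<Union>j. interior (K j))"
      unfolding em[symmetric] using disj by (intro suminf_emeasure) (auto simp: disjoint_family_on_def)
    also have "\<dots> \<le> emeasure lborel T"
    proof (rule emeasure_mono)
      have "K j \<subseteq> T" for j using in_g[of j] g(2) by (cases "K j = {}") blast+
      then show "(\<Union>j. interior (K j)) \<subseteq> T" using interior_subset by blast
    qed (use T(1) in simp)
    also note T\<eta>
    finally show "(\<Sum>j. ennreal (l j ^ DIM('a))) \<le> ennreal \<eta>" .
  qed
qed

text \<open>Cover the null set \<open>tube A\<close> by cubes of total volume \<open>\<eta>\<close>. As \<open>height\<close> is Lipschitz, a cube of side \<open>l\<close>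
  meets the translates \<open>A + t e\<close> only for \<open>t\<close> in an interval of length \<open>O(l)\<close>, so averaging over \<open>t\<close>
  yields one translate covered by cubes with \<open>\<Sum> l\<^sup>n\<^sup>-\<^sup>1 = O(\<eta>)\<close>.\<close>

lemma (in boundary_chart) hausdorff_outer_null:
  assumes A: "\<And>x. x \<in> A \<Longrightarrow> height x = 0" "bounded A" and null: "tube A \<in> null_sets lborel"
  shows "hausdorff_outer (DIM('a) - 1) A = 0"
proof -
  define n where "n = DIM('a) - 1"
  have n: "DIM('a) = Suc n" using DIM_positive[where 'a='a] by (simp add: n_def)
  obtain R where R: "0 < R" "\<And>x. x \<in> A \<Longrightarrow> norm x \<le> R" using A(2) bounded_pos by blast
  have N_cball: "norm x \<le> R + 1" if "x \<in> tube A" for x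
  proof -
    have "x = foot x + height x *\<^sub>R e" by (simp add: foot_def)
    then have "norm x \<le> norm (foot x) + norm (height x *\<^sub>R e)" by (metis norm_triangle_ineq)
    then show ?thesis using that R(2)[of "foot x"] by (simp add: tube_def)
  qed
  obtain L where L: "0 \<le> L" "\<And>x y. x \<in> cball 0 (R + 2) \<Longrightarrow> y \<in> cball 0 (R + 2) \<Longrightarrow>
      \<bar>height x - height y\<bar> \<le> L * norm (x - y)"
    using height_lipschitz[of "R + 2"] R(1) by auto
  \<comment> \<open>A set of diameter at most (n + 1) l has cost at most c l^n. Likewise w l, for
    the w defined next, is the half-length of the interval of shifts t for which A + t e can meet a
    cube of side l.\<close>
  define c where "c = unit_ball_vol (real n) * (real (Suc n) / 2) ^ n"
  have c: "0 \<le> c" by (simp add: c_def)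
  define w where "w = L * real (Suc n)"
  have w: "0 \<le> w" using L(1) by (simp add: w_def)
  have le: "(INF C\<in>{C. (\<forall>j. bounded (C j) \<and> diameter (C j) \<le> \<delta>) \<and> A \<subseteq> (\<Union>j. C j)}.
        \<Sum>j. hausdorff_cost n (C j)) \<le> ennreal \<epsilon>" if "0 < \<delta>" "0 < \<epsilon>" for \<delta> \<epsilon>
  proof -
    \<comment> \<open>Chosen so that 2 w c \<eta> < \<epsilon>; the summand 1 keeps the denominator
      positive if w c = 0.\<close>
    define \<eta> where "\<eta> = \<epsilon> / 2 / (2 * w * c + 1)"
    have \<eta>: "0 < \<eta>" using that w c by (simp add: \<eta>_def add_nonneg_pos)
    have \<eta>': "2 * w * c * \<eta> < \<epsilon>"
    proof -
      have D: "D * (X / D) = X" if "0 < D" for D X :: real using that by simp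
      have "(2 * w * c + 1) * \<eta> = \<epsilon> / 2"
        unfolding \<eta>_def using w c by (intro D add_nonneg_pos) auto
      then show ?thesis using \<eta> \<open>0 < \<epsilon>\<close> by (simp add: distrib_right)
    qed
    have "bounded (tube A)" using N_cball unfolding bounded_iff by blast
    moreover have "0 < min \<delta> 1" using that by simp
    ultimately obtain K l where K: "tube A \<subseteq> (\<Union>j. K j)" "\<And>j. bounded (K j)" "\<And>j. diameter (K j) \<le> min \<delta> 1"
        "\<And>j. 0 \<le> l j" "\<And>j x y. x \<in> K j \<Longrightarrow> y \<in> K j \<Longrightarrow> norm (x - y) \<le> real DIM('a) * l j"
        "(\<Sum>j. ennreal (l j ^ DIM('a))) \<le> ennreal \<eta>" "\<And>j. K j \<noteq> {} \<Longrightarrow> K j \<inter> tube A \<noteq> {}"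
      using null_set_cube_cover[OF null _ \<eta>] by metis
    have K_cball: "x \<in> cball 0 (R + 2)" if x: "x \<in> K j" for x j
    proof -
      have "K j \<inter> tube A \<noteq> {}" using x by (intro K(7)) auto
      then obtain y where y: "y \<in> K j" "y \<in> tube A" by blast
      have "dist x y \<le> 1" using diameter_bounded_bound[OF K(2) x y(1)] K(3)[of j] by simp
      then show ?thesis using N_cball[OF y(2)] norm_triangle_sub[of x y] by (simp add: dist_norm)
    qed
    \<comment> \<open>The cover of the translate A + t e, moved back to A. For 0 < t < 1 it covers
      all of A, because the translate lies in the tube.\<close>
    define C where "C t j = {a \<in> A. a + t *\<^sub>R e \<in> K j}" for t j
    have C_bdd: "bounded (C t j)" for t j
      by (rule bounded_subset[OF A(2)]) (auto simp: C_def)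
    have C_dist: "norm (a - b) \<le> diameter (K j)" "norm (a - b) \<le> real (Suc n) * l j"
      if "a \<in> C t j" "b \<in> C t j" for a b t j
    proof -
      have ab: "a + t *\<^sub>R e \<in> K j" "b + t *\<^sub>R e \<in> K j" using that by (auto simp: C_def)
      show "norm (a - b) \<le> diameter (K j)"
        using diameter_bounded_bound[OF K(2) ab] by (simp add: dist_norm)
      show "norm (a - b) \<le> real (Suc n) * l j" using K(5)[OF ab] by (simp add: n)
    qed
    have "\<forall>j. \<exists>\<tau>. \<forall>t. C t j \<noteq> {} \<longrightarrow> \<bar>t - \<tau>\<bar> \<le> w * l j"
    proof
      fix j
      show "\<exists>\<tau>. \<forall>t. C t j \<noteq> {} \<longrightarrow> \<bar>t - \<tau>\<bar> \<le> w * l j"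
      proof (cases "\<exists>\<tau>. C \<tau> j \<noteq> {}")
        case True
        then obtain \<tau> b where b: "b \<in> C \<tau> j" by blast
        have "\<bar>t - \<tau>\<bar> \<le> w * l j" if "a \<in> C t j" for t a
        proof -
          have ab: "a + t *\<^sub>R e \<in> K j" "b + \<tau> *\<^sub>R e \<in> K j" using that b by (auto simp: C_def)
          have "height a = 0" "height b = 0" using that b A(1) by (auto simp: C_def)
          then have "\<bar>t - \<tau>\<bar> = \<bar>height (a + t *\<^sub>R e) - height (b + \<tau> *\<^sub>R e)\<bar>" by simp
          also have "\<dots> \<le> L * norm ((a + t *\<^sub>R e) - (b + \<tau> *\<^sub>R e))"
          using ab by (intro L(2) K_cball)
          also have "\<dots> \<le> L * (real (Suc n) * l j)"
          using K(5)[OF ab] L(1) unfolding n by (intro mult_left_mono)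
          finally show ?thesis by (simp add: w_def)
        qed
        then show ?thesis by blast
      qed auto
    qed
    then obtain \<tau> where \<tau>: "\<And>t j. C t j \<noteq> {} \<Longrightarrow> \<bar>t - \<tau> j\<bar> \<le> w * l j" by metis
    define f where "f j t = ennreal (c * l j ^ n) * indicator {\<tau> j - w * l j .. \<tau> j + w * l j} t" for j t
    have [measurable]: "f j \<in> borel_measurable borel" for j unfolding f_def by measurable
    have cost: "hausdorff_cost n (C t j) \<le> f j t" for t j
    proof (cases "C t j = {}")
      case False
      have "diameter (C t j) \<le> real (Suc n) * l j"
        using C_dist(2) False by (intro diameter_le) auto
      then have "(diameter (C t j) / 2) ^ n \<le> (real (Suc n) / 2 * l j) ^ n"
        using diameter_ge_0[OF C_bdd] by (intro power_mono) auto
      then have "unit_ball_vol (real n) * (diameter (C t j) / 2) ^ n \<le> c * l j ^ n"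
        unfolding c_def power_mult_distrib mult.assoc by (intro mult_left_mono) auto
      then have "hausdorff_cost n (C t j) \<le> ennreal (c * l j ^ n)"
        using False by (simp add: hausdorff_cost_def ennreal_leI)
      moreover have "t \<in> {\<tau> j - w * l j .. \<tau> j + w * l j}" using \<tau>[OF False] by (simp add: abs_le_iff)
      ultimately show ?thesis by (simp add: f_def)
    qed (simp add: hausdorff_cost_def)
    have "(\<integral>\<^sup>+t. (\<Sum>j. f j t) \<partial>lborel) = (\<Sum>j. \<integral>\<^sup>+t. f j t \<partial>lborel)"
      by (rule nn_integral_suminf) simp
    also have "(\<lambda>j. \<integral>\<^sup>+t. f j t \<partial>lborel) = (\<lambda>j. ennreal (2 * w * c) * ennreal (l j ^ DIM('a)))"
    proof
      fix j
      have "(\<integral>\<^sup>+t. f j t \<partial>lborel) = ennreal (c * l j ^ n) * ennreal (2 * (w * l j))"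
        using w K(4)[of j] by (simp add: f_def nn_integral_cmult_indicator)
      also have "\<dots> = ennreal (c * l j ^ n * (2 * (w * l j)))"
        using c w K(4)[of j] by (intro ennreal_mult[symmetric]) auto
      also have "c * l j ^ n * (2 * (w * l j)) = 2 * w * c * l j ^ DIM('a)" by (simp add: n)
      also have "ennreal \<dots> = ennreal (2 * w * c) * ennreal (l j ^ DIM('a))"
        using c w K(4)[of j] by (intro ennreal_mult) auto
      finally show "(\<integral>\<^sup>+t. f j t \<partial>lborel) = ennreal (2 * w * c) * ennreal (l j ^ DIM('a))" .
    qed
    also have "(\<Sum>j. ennreal (2 * w * c) * ennreal (l j ^ DIM('a))) = ennreal (2 * w * c) * (\<Sum>j. ennreal (l j ^ DIM('a)))"
      by simp
    also have "\<dots> \<le> ennreal (2 * w * c) * ennreal \<eta>" using K(6) by (intro mult_left_mono) auto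
    also have "\<dots> = ennreal (2 * w * c * \<eta>)" using c w \<eta> by (intro ennreal_mult[symmetric]) auto
    also have "\<dots> < ennreal \<epsilon>" using \<eta>' that by (intro ennreal_lessI)
    finally have small: "(\<integral>\<^sup>+t. (\<Sum>j. f j t) \<partial>lborel) < ennreal \<epsilon>" .
    \<comment> \<open>The interval (0, 1) has length 1, so a function with integral below \<epsilon>
      cannot exceed \<epsilon> throughout it.\<close>
    have "\<exists>t. 0 < t \<and> t < 1 \<and> (\<Sum>j. f j t) \<le> ennreal \<epsilon>"
    proof (rule ccontr)
      assume "\<not> ?thesis"
      then have "ennreal \<epsilon> * indicator {0<..<1} t \<le> (\<Sum>j. f j t)" for t :: real
        by (auto split: split_indicator simp: not_le intro: less_imp_le)
      then have "(\<integral>\<^sup>+t. ennreal \<epsilon> * indicator {0<..<1::real} t \<partial>lborel) \<le> (\<integral>\<^sup>+t. (\<Sum>j. f j t) \<partial>lborel)"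
        by (intro nn_integral_mono)
      moreover have "(\<integral>\<^sup>+t. ennreal \<epsilon> * indicator {0<..<1::real} t \<partial>lborel) = ennreal \<epsilon>"
        by (simp add: nn_integral_cmult_indicator)
      ultimately show False using small by simp
    qed
    then obtain t where t: "0 < t" "t < 1" "(\<Sum>j. f j t) \<le> ennreal \<epsilon>" by blast
    show ?thesis
    proof (rule INF_lower2[of "C t"])
      have "diameter (C t j) \<le> \<delta>" for j
      proof (rule diameter_le)
        show "norm (x - y) \<le> \<delta>" if "x \<in> C t j" "y \<in> C t j" for x y
          using C_dist(1)[OF that] K(3)[of j] by simp
      qed (use that(1) in simp)
      moreover have "A \<subseteq> (\<Union>j. C t j)"
      proof
        fix a assume a: "a \<in> A"
        then have "a + t *\<^sub>R e \<in> tube A" using t A(1)[OF a] foot_eq[of a] by (simp add: tube_def)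
        then show "a \<in> (\<Union>j. C t j)" using K(1) a by (auto simp: C_def)
      qed
      ultimately show "C t \<in> {C. (\<forall>j. bounded (C j) \<and> diameter (C j) \<le> \<delta>) \<and> A \<subseteq> (\<Union>j. C j)}"
        using C_bdd by simp
      have "(\<Sum>j. hausdorff_cost n (C t j)) \<le> (\<Sum>j. f j t)"
        using cost by (intro suminf_le) auto
      with t(3) show "(\<Sum>j. hausdorff_cost n (C t j)) \<le> ennreal \<epsilon>" by simp
    qed
  qed
  have "hausdorff_outer n A \<le> ennreal \<epsilon>" if "0 < \<epsilon>" for \<epsilon>
    unfolding hausdorff_outer_def using le that by (intro SUP_least) auto
  then have "hausdorff_outer n A \<le> 0 + ennreal \<epsilon>" if "0 < \<epsilon>" for \<epsilon> using that by simp
  then have "hausdorff_outer n A \<le> 0" by (rule ennreal_le_epsilon)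
  then show ?thesis by (simp add: n_def)
qed

section \<open>Estimates along lines\<close>

lemma nn_integral_lebesgue_on:
  "S \<in> sets lebesgue \<Longrightarrow> (\<integral>\<^sup>+x. f x \<partial>lebesgue_on S) = (\<integral>\<^sup>+x. f x * indicator S x \<partial>lborel)"
  by (subst nn_integral_restrict_space) (auto simp: nn_integral_completion)

text \<open>Cauchy-Schwarz, obtained by expanding the nonnegative integral of (g - a/s)^2, where a/s
  is the mean of \<open>g\<close>.\<close>

lemma integral_square_le:
  fixes g :: "real \<Rightarrow> real"
  assumes g: "continuous_on {0..s} g" and s: "0 \<le> s"
  shows "(integral {0..s} g)\<^sup>2 \<le> s * integral {0..s} (\<lambda>t. (g t)\<^sup>2)"
proof (cases "s = 0")
  case False
  with s have s: "0 < s" by simp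
  define a where "a = integral {0..s} g"
  define b where "b = integral {0..s} (\<lambda>t. (g t)\<^sup>2)"
  have 1: "(g has_integral a) {0..s}" and 2: "((\<lambda>t. (g t)\<^sup>2) has_integral b) {0..s}"
    unfolding a_def b_def
    by (intro integrable_integral integrable_continuous_interval continuous_intros g)+
  have "((\<lambda>t. (g t)\<^sup>2 - 2 * (a / s) * g t + (a / s)\<^sup>2) has_integral (b - 2 * (a / s) * a + (a / s)\<^sup>2 * s)) {0..s}"
    using has_integral_const_real[of "(a / s)\<^sup>2" 0 s] s
    by (intro has_integral_add has_integral_diff has_integral_mult_right 1 2) (simp add: mult.commute)
  moreover have "(g t)\<^sup>2 - 2 * (a / s) * g t + (a / s)\<^sup>2 = (g t - a / s)\<^sup>2" for t
    by (simp add: power2_diff)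
  ultimately have "0 \<le> b - 2 * (a / s) * a + (a / s)\<^sup>2 * s"
    by (auto intro: has_integral_nonneg)
  also have "\<dots> = b - a\<^sup>2 / s" using s by (simp add: power2_eq_square field_simps)
  finally have "a\<^sup>2 / s \<le> b" by simp
  then show ?thesis using s by (simp add: a_def b_def pos_divide_le_eq mult.commute)
qed simp

context boundary_chart
begin

definition strip :: "real \<Rightarrow> 'a set" where
  "strip w = {x. 0 < height x \<and> height x < w}"

lemma strip_measurable [measurable]: "strip w \<in> sets borel"
  unfolding strip_def by measurable

lemma line_difference:
  assumes F: "smooth_fun F" and s: "0 \<le> s"
  shows "ennreal ((F x - F (x - s *\<^sub>R e))\<^sup>2)
    \<le> ennreal s * (\<integral>\<^sup>+t. indicator {0..s} t * ennreal ((partial_deriv e F (x - t *\<^sub>R e))\<^sup>2) \<partial>lborel)"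
proof -
  define G where "G = partial_deriv e F"
  have eq: "G = (\<lambda>y. \<Sum>b\<in>Basis. (e \<bullet> b) * partial_deriv b F y)"
    unfolding G_def using partial_deriv_expansion[OF F] by (intro ext)
  have G: "continuous_on UNIV G"
    unfolding eq by (intro continuous_intros smooth_fun_continuous smooth_fun_partial F)
  have g: "continuous_on {0..s} (\<lambda>t. G (x - t *\<^sub>R e))"
    by (rule continuous_on_compose2[OF G]) (auto intro!: continuous_intros)
  have "((\<lambda>t. - F (x - t *\<^sub>R e)) has_vector_derivative G (x - t *\<^sub>R e)) (at t within {0..s})" for t
  proof -
    have 1: "((\<lambda>t. x - t *\<^sub>R e) has_derivative (\<lambda>h. - (h *\<^sub>R e))) (at t)"
      by (auto intro!: derivative_eq_intros)
    have l: "linear (\<lambda>v. partial_deriv v F y)" for y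
      using partial_deriv_linear[OF smooth_differentiable[OF F]] .
    have "((\<lambda>t. - F (x - t *\<^sub>R e)) has_derivative (\<lambda>h. - partial_deriv (- (h *\<^sub>R e)) F (x - t *\<^sub>R e))) (at t)"
      by (rule has_derivative_minus, rule has_derivative_compose[OF 1 smooth_fun_has_derivative[OF F]])
    moreover have "- partial_deriv (- (h *\<^sub>R e)) F y = h *\<^sub>R G y" for h y
      using linear_neg[OF l[of y], of "h *\<^sub>R e"] linear_scale[OF l[of y], of h e] by (simp add: G_def)
    ultimately show ?thesis unfolding has_vector_derivative_def
      by (auto intro: has_derivative_at_withinI)
  qed
  then have "((\<lambda>t. G (x - t *\<^sub>R e)) has_integral (- F (x - s *\<^sub>R e) - - F (x - 0 *\<^sub>R e))) {0..s}"
    by (intro fundamental_theorem_of_calculus s) auto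
  then have "F x - F (x - s *\<^sub>R e) = integral {0..s} (\<lambda>t. G (x - t *\<^sub>R e))"
    by (simp add: integral_unique)
  then have "(F x - F (x - s *\<^sub>R e))\<^sup>2 \<le> s * integral {0..s} (\<lambda>t. (G (x - t *\<^sub>R e))\<^sup>2)"
    using integral_square_le[OF g s] by simp
  then have "ennreal ((F x - F (x - s *\<^sub>R e))\<^sup>2) \<le> ennreal s * ennreal (integral {0..s} (\<lambda>t. (G (x - t *\<^sub>R e))\<^sup>2))"
    using s by (simp add: ennreal_mult'[symmetric] ennreal_leI)
  also have "ennreal (integral {0..s} (\<lambda>t. (G (x - t *\<^sub>R e))\<^sup>2))
      = (\<integral>\<^sup>+t. ennreal (indicator {0..s} t * (G (x - t *\<^sub>R e))\<^sup>2) \<partial>lborel)"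
    by (rule nn_integral_has_integral_lebesgue[symmetric])
      (auto intro!: integrable_integral integrable_continuous_interval continuous_intros g)
  also have "\<dots> = (\<integral>\<^sup>+t. indicator {0..s} t * ennreal ((G (x - t *\<^sub>R e))\<^sup>2) \<partial>lborel)"
    by (intro nn_integral_cong) (auto split: split_indicator)
  finally show ?thesis unfolding G_def .
qed

lemma partial_deriv_e_measurable:
  assumes "smooth_fun F" shows "partial_deriv e F \<in> borel_measurable borel"
proof -
  have "partial_deriv e F = (\<lambda>y. \<Sum>b\<in>Basis. (e \<bullet> b) * partial_deriv b F y)"
    using partial_deriv_expansion[OF assms] by (intro ext)
  then show ?thesis
    by (simp add: borel_measurable_sum borel_measurable_times smooth_fun_measurable smooth_fun_partial assms)
qed

text \<open>The boundary is never parametrised: integrating the fundamental theorem of calculus along \<open>e\<close>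
  over an \<open>n\<close>-dimensional strip and substituting \<open>y = x - t e\<close> replaces Fubini on \<open>\<real>\<^sup>n\<^sup>-\<^sup>1 \<times> \<real>\<close>.\<close>

lemma line_estimate:
  assumes F: "smooth_fun F" and w: "0 < w"
  shows "(\<integral>\<^sup>+x. indicator (strip w) x * ennreal ((F x - F (foot x))\<^sup>2) \<partial>lborel)
    \<le> ennreal (w\<^sup>2) * (\<integral>\<^sup>+x. indicator (strip w) x * ennreal ((partial_deriv e F x)\<^sup>2) \<partial>lborel)"
proof -
  define G where "G = partial_deriv e F"
  let ?X = "\<integral>\<^sup>+y. indicator (strip w) y * ennreal ((G y)\<^sup>2) \<partial>lborel"
  have G [measurable]: "G \<in> borel_measurable borel"
    unfolding G_def by (rule partial_deriv_e_measurable[OF F])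
  \<comment> \<open>The region of pairs (t, x) is chosen so that y = x - t e always has height in
    (0, w), which keeps y in the same strip. One factor w comes from Cauchy-Schwarz on each segment,
    the other from integrating over t.\<close>
  define H where "H t x = (if 0 \<le> t \<and> t < height x \<and> height x < w then ennreal ((G (x - t *\<^sub>R e))\<^sup>2) else 0)"
    for t x
  have H [measurable]: "case_prod H \<in> borel_measurable (lborel \<Otimes>\<^sub>M lborel)"
    unfolding H_def by measurable
  have H1 [measurable]: "H t \<in> borel_measurable borel" "(\<lambda>t. H t x) \<in> borel_measurable borel" for t x
    unfolding H_def by measurable
  have pw: "indicator (strip w) x * ennreal ((F x - F (foot x))\<^sup>2) \<le> ennreal w * (\<integral>\<^sup>+t. H t x \<partial>lborel)" for x
  proof (cases "x \<in> strip w")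
    case True
    then have h: "0 < height x" "height x < w" by (auto simp: strip_def)
    have "ennreal ((F x - F (foot x))\<^sup>2)
        \<le> ennreal (height x) * (\<integral>\<^sup>+t. indicator {0..height x} t * ennreal ((G (x - t *\<^sub>R e))\<^sup>2) \<partial>lborel)"
      using line_difference[OF F, of "height x" x] h unfolding G_def foot_def by simp
    also have "(\<integral>\<^sup>+t. indicator {0..height x} t * ennreal ((G (x - t *\<^sub>R e))\<^sup>2) \<partial>lborel) = (\<integral>\<^sup>+t. H t x \<partial>lborel)"
    proof (rule nn_integral_cong_AE)
      show "AE t in lborel. indicator {0..height x} t * ennreal ((G (x - t *\<^sub>R e))\<^sup>2) = H t x"
        using AE_lborel_singleton[of "height x"]
        by eventually_elim (use h in \<open>auto simp: H_def split: split_indicator\<close>)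
    qed
    also have "ennreal (height x) * (\<integral>\<^sup>+t. H t x \<partial>lborel) \<le> ennreal w * (\<integral>\<^sup>+t. H t x \<partial>lborel)"
      using h by (intro mult_right_mono ennreal_leI) auto
    finally show ?thesis using True by simp
  qed simp
  have "(\<integral>\<^sup>+x. indicator (strip w) x * ennreal ((F x - F (foot x))\<^sup>2) \<partial>lborel)
      \<le> (\<integral>\<^sup>+x. ennreal w * (\<integral>\<^sup>+t. H t x \<partial>lborel) \<partial>lborel)"
    by (intro nn_integral_mono pw)
  also have "\<dots> = ennreal w * (\<integral>\<^sup>+x. (\<integral>\<^sup>+t. H t x \<partial>lborel) \<partial>lborel)"
    by (rule nn_integral_cmult) measurable
  also have "(\<integral>\<^sup>+x. (\<integral>\<^sup>+t. H t x \<partial>lborel) \<partial>lborel) = (\<integral>\<^sup>+t. (\<integral>\<^sup>+x. H t x \<partial>lborel) \<partial>lborel)"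
    by (rule lborel_pair.Fubini'[OF H])
  also have "\<dots> \<le> (\<integral>\<^sup>+t. indicator {0..w} t * ?X \<partial>lborel)"
  proof (rule nn_integral_mono)
    fix t :: real
    have "(\<integral>\<^sup>+x. H t x \<partial>lborel) = (\<integral>\<^sup>+x. H t x \<partial>distr lborel borel ((+) (t *\<^sub>R e)))"
      by (simp add: lborel_distr_plus)
    also have "\<dots> = (\<integral>\<^sup>+y. H t (t *\<^sub>R e + y) \<partial>lborel)"
      by (rule nn_integral_distr) auto
    also have "\<dots> \<le> (\<integral>\<^sup>+y. indicator {0..w} t * (indicator (strip w) y * ennreal ((G y)\<^sup>2)) \<partial>lborel)"
    proof (rule nn_integral_mono)
      fix y
      have "height (t *\<^sub>R e + y) = height y + t" by (metis add.commute height_shift(1))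
      then show "H t (t *\<^sub>R e + y) \<le> indicator {0..w} t * (indicator (strip w) y * ennreal ((G y)\<^sup>2))"
        by (auto simp: H_def strip_def split: split_indicator)
    qed
    also have "\<dots> = indicator {0..w} t * ?X"
      by (rule nn_integral_cmult) measurable
    finally show "(\<integral>\<^sup>+x. H t x \<partial>lborel) \<le> indicator {0..w} t * ?X" .
  qed
  also have "\<dots> = ennreal w * ?X"
    using w by (simp add: nn_integral_multc)
  also have "ennreal w * (ennreal w * ?X)
     = ennreal (w\<^sup>2) * ?X"
    using w by (simp add: mult.assoc[symmetric] ennreal_mult'[symmetric] power2_eq_square)
  finally show ?thesis unfolding G_def by (simp add: mult_left_mono)
qed

end

section \<open>Values of the surface measure, and its degenerate case\<close>

definition hausdorff_additive :: "'a::euclidean_space itself \<Rightarrow> bool" where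
  "hausdorff_additive _ \<longleftrightarrow>
    measure_space UNIV (sets borel) (hausdorff_outer (DIM('a) - 1) :: 'a set \<Rightarrow> ennreal)"

lemma space_hausdorff_measure: "space (hausdorff_measure s) = UNIV"
  unfolding hausdorff_measure_def by (rule space_measure_of) auto

lemma emeasure_hausdorff_measure:
  fixes A :: "'a::euclidean_space set"
  assumes "A \<in> sets borel"
  shows "emeasure (hausdorff_measure (DIM('a) - 1)) A
    = (if hausdorff_additive TYPE('a) then hausdorff_outer (DIM('a) - 1) A else 0)"
  unfolding hausdorff_measure_def hausdorff_additive_def
  using assms sets.sigma_sets_eq[of "borel :: 'a measure"]
  by (subst emeasure_measure_of_conv) simp

lemma emeasure_surface:
  fixes \<Omega> :: "'a::euclidean_space set"
  assumes "hausdorff_additive TYPE('a)" and "A \<in> sets borel" "A \<subseteq> frontier \<Omega>"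
  shows "emeasure (surface_measure \<Omega>) A = hausdorff_outer (DIM('a) - 1) A"
proof -
  have "emeasure (surface_measure \<Omega>) A = emeasure (hausdorff_measure (DIM('a) - 1)) A"
    unfolding surface_measure_def
    using assms by (intro emeasure_restrict_space) (auto simp: sets_hausdorff_measure space_hausdorff_measure)
  then show ?thesis using assms by (simp add: emeasure_hausdorff_measure del: One_nat_def)
qed

text \<open>\<open>measure_of\<close> is the zero measure unless its argument is countably additive on the Borel sets;
  countable additivity of \<open>hausdorff_outer\<close> therefore never has to be proved.\<close>

lemma surface_measure_degenerate:
  fixes \<Omega> :: "'a::euclidean_space set"
  assumes "\<not> hausdorff_additive TYPE('a)"
  shows "AE x in surface_measure \<Omega>. P x"
proof -
  have "frontier \<Omega> \<in> null_sets (hausdorff_measure (DIM('a) - 1))"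
    using assms
    by (simp add: null_sets_def emeasure_hausdorff_measure sets_hausdorff_measure del: One_nat_def)
  then have "AE x in hausdorff_measure (DIM('a) - 1). x \<notin> frontier \<Omega>" by (rule AE_not_in)
  then have "AE x in hausdorff_measure (DIM('a) - 1). x \<in> frontier \<Omega> \<longrightarrow> P x" by eventually_elim simp
  then show ?thesis unfolding surface_measure_def
    by (subst AE_restrict_space_iff) (auto simp: sets_hausdorff_measure space_hausdorff_measure)
qed

section \<open>Hardy inequality and uniqueness of traces\<close>

lemma nn_integral_square_le:
  assumes [measurable]: "u \<in> borel_measurable M" "v \<in> borel_measurable M" "A \<in> sets M"
  shows "(\<integral>\<^sup>+x. indicator A x * ennreal ((u x)\<^sup>2) \<partial>M)
    \<le> 2 * (\<integral>\<^sup>+x. indicator A x * ennreal ((v x)\<^sup>2) \<partial>M) + 2 * (\<integral>\<^sup>+x. indicator A x * ennreal ((u x - v x)\<^sup>2) \<partial>M)"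
proof -
  have "(\<integral>\<^sup>+x. indicator A x * ennreal ((u x)\<^sup>2) \<partial>M)
      \<le> (\<integral>\<^sup>+x. 2 * (indicator A x * ennreal ((v x)\<^sup>2)) + 2 * (indicator A x * ennreal ((u x - v x)\<^sup>2)) \<partial>M)"
  proof (rule nn_integral_mono)
    fix x
    have "ennreal ((u x)\<^sup>2) \<le> ennreal (2 * (v x)\<^sup>2 + 2 * (u x - v x)\<^sup>2)"
      using sum_sq_le[of "v x" "u x - v x"] by (intro ennreal_leI) simp
    also have "\<dots> = 2 * ennreal ((v x)\<^sup>2) + 2 * ennreal ((u x - v x)\<^sup>2)"
      by (simp add: ennreal_mult')
    finally show "indicator A x * ennreal ((u x)\<^sup>2)
        \<le> 2 * (indicator A x * ennreal ((v x)\<^sup>2)) + 2 * (indicator A x * ennreal ((u x - v x)\<^sup>2))"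
      by (simp split: split_indicator)
  qed
  also have "\<dots> = 2 * (\<integral>\<^sup>+x. indicator A x * ennreal ((v x)\<^sup>2) \<partial>M) + 2 * (\<integral>\<^sup>+x. indicator A x * ennreal ((u x - v x)\<^sup>2) \<partial>M)"
    by (subst nn_integral_add, measurable) (simp add: nn_integral_cmult)
  finally show ?thesis .
qed

lemma L2_tendsto_indicator_0:
  assumes "L2_tendsto M F f"
  shows "(\<lambda>j. \<integral>\<^sup>+x. indicator A x * ennreal ((F j x - f x)\<^sup>2) \<partial>M) \<longlonglongrightarrow> 0"
  by (rule ennreal_tendsto_0_le[OF _ assms[unfolded L2_tendsto_def]])
    (auto intro!: nn_integral_mono split: split_indicator)

lemma le_LIMSEQ_ennreal:
  fixes X :: ennreal
  assumes "\<And>j. X \<le> a j" "a \<longlonglongrightarrow> c" shows "X \<le> c"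
  using LIMSEQ_le_const[OF assms(2), of X] assms(1) by blast

definition tube_const :: "nat \<Rightarrow> real" where
  "tube_const d = 4 ^ d / unit_ball_vol (real (d - 1))"

context boundary_chart
begin

text \<open>Lebesgue measure on the tube over the frontier is pushed forward by \<open>foot\<close>.
  The preimage of a boundary set A is the tube over A, so the estimate for tubes says that a
  multiple of this image measure is dominated by surface measure; integrals then compare as
  well.\<close>

lemma nn_integral_tube_le:
  assumes hm: "hausdorff_additive TYPE('a)"
    and h [measurable]: "h \<in> borel_measurable borel"
  shows "(\<integral>\<^sup>+x. indicator (tube (frontier \<Omega>)) x * h (foot x) \<partial>lborel)
    \<le> ennreal (tube_const DIM('a)) * (\<integral>\<^sup>+x. h x \<partial>surf)"
proof -
  define S where "S = surf"
  define T where "T = tube (frontier \<Omega>)"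
  define \<kappa> where "\<kappa> = unit_ball_vol (real (DIM('a) - 1)) / 4 ^ DIM('a)"
  have \<kappa>: "0 < \<kappa>" by (simp add: \<kappa>_def)
  have T [measurable]: "T \<in> sets borel" unfolding T_def by (rule tube_measurable) simp
  have setsS: "sets S = sets (restrict_space borel (frontier \<Omega>))" unfolding S_def by (rule sets_surface_measure)
  have foot: "foot \<in> measurable (restrict_space lborel T) S"
    unfolding measurable_cong_sets[OF refl setsS]
    by (intro measurable_restrict_space2 measurable_restrict_space1)
      (auto simp: space_restrict_space T_def tube_def)
  have hS: "h \<in> borel_measurable S"
    unfolding measurable_cong_sets[OF setsS refl] by (intro measurable_restrict_space1 h)
  define M' where "M' = scale_measure (ennreal \<kappa>) (distr (restrict_space lborel T) S foot)"
  have sets': "sets M' = sets S" by (simp add: M'_def)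
  have "M' \<le> S"
  proof (subst le_measure[OF sets'], intro ballI)
    fix A assume "A \<in> sets M'"
    then have A: "A \<in> sets S" by (simp add: sets')
    then have A': "A \<in> sets borel" "A \<subseteq> frontier \<Omega>"
      unfolding setsS by (auto simp: sets_restrict_space)
    have "foot -` A \<inter> T = tube A" using A'(2) by (auto simp: T_def tube_def)
    then have "emeasure (distr (restrict_space lborel T) S foot) A = emeasure (restrict_space lborel T) (tube A)"
      by (subst emeasure_distr[OF foot A]) (simp add: space_restrict_space)
    also have "\<dots> = emeasure lborel (tube A)"
      using A'(2) T by (intro emeasure_restrict_space) (auto simp: T_def tube_def)
    finally have "emeasure (distr (restrict_space lborel T) S foot) A = emeasure lborel (tube A)" .
    then have "emeasure M' A = ennreal \<kappa> * emeasure lborel (tube A)" by (simp add: M'_def)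
    also have "\<dots> \<le> hausdorff_outer (DIM('a) - 1) A" unfolding \<kappa>_def by (rule tube_le_hausdorff_outer[OF A'(1)])
    also have "\<dots> = emeasure S A" unfolding S_def by (rule emeasure_surface[OF hm A', symmetric])
    finally show "emeasure M' A \<le> emeasure S A" .
  qed
  then have "(\<integral>\<^sup>+x. h x \<partial>M') \<le> (\<integral>\<^sup>+x. h x \<partial>S)" by (intro nn_integral_mono_measure sets')
  moreover have "(\<integral>\<^sup>+x. h x \<partial>M') = ennreal \<kappa> * (\<integral>\<^sup>+x. indicator T x * h (foot x) \<partial>lborel)"
    unfolding M'_def using hS foot
    by (simp add: nn_integral_scale_measure nn_integral_distr nn_integral_restrict_space mult.commute)
  ultimately have "ennreal (1 / \<kappa>) * (ennreal \<kappa> * (\<integral>\<^sup>+x. indicator T x * h (foot x) \<partial>lborel))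
      \<le> ennreal (1 / \<kappa>) * (\<integral>\<^sup>+x. h x \<partial>S)"
    by (intro mult_left_mono) auto
  moreover have "ennreal (1 / \<kappa>) * (ennreal \<kappa> * X) = X" for X
    using \<kappa> by (simp add: mult.assoc[symmetric] ennreal_mult'[symmetric])
  moreover have "1 / \<kappa> = tube_const DIM('a)" by (simp add: \<kappa>_def tube_const_def)
  ultimately show ?thesis by (simp add: T_def S_def)
qed

text \<open>Outside the ball the strip has nothing to do with the domain, hence the intersection.
  For functions supported in the ball the integral equals one over the full strip in
  \<open>lborel\<close>, where shifts along \<open>e\<close> are available.\<close>

definition strip_sq :: "real \<Rightarrow> ('a \<Rightarrow> real) \<Rightarrow> ennreal" where
  "strip_sq w u = (\<integral>\<^sup>+x. indicator (strip w \<inter> ball p r) x * ennreal ((u x)\<^sup>2) \<partial>vol)"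

lemma strip_sq_lborel:
  assumes "\<And>x. x \<notin> ball p r \<Longrightarrow> u x = 0"
  shows "strip_sq w u = (\<integral>\<^sup>+x. indicator (strip w) x * ennreal ((u x)\<^sup>2) \<partial>lborel)"
proof -
  have sub: "x \<in> \<Omega>" if "x \<in> strip w" "x \<in> ball p r" for x
    using mem_domain that by (auto simp: strip_def)
  have "(\<integral>\<^sup>+x. indicator (strip w \<inter> ball p r) x * ennreal ((u x)\<^sup>2) \<partial>vol)
      = (\<integral>\<^sup>+x. indicator (strip w \<inter> ball p r) x * ennreal ((u x)\<^sup>2) * indicator \<Omega> x \<partial>lborel)"
    using open_domain by (intro nn_integral_lebesgue_on) auto
  also have "\<dots> = (\<integral>\<^sup>+x. indicator (strip w) x * ennreal ((u x)\<^sup>2) \<partial>lborel)"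
  proof (rule nn_integral_cong)
    fix x
    show "indicator (strip w \<inter> ball p r) x * ennreal ((u x)\<^sup>2) * indicator \<Omega> x
        = indicator (strip w) x * ennreal ((u x)\<^sup>2)"
      using sub[of x] assms[of x] by (cases "x \<in> ball p r"; cases "x \<in> strip w") auto
  qed
  finally show ?thesis unfolding strip_sq_def .
qed

lemma strip_set_measurable: "strip w \<inter> ball p r \<in> sets vol"
proof -
  have "strip w \<inter> ball p r \<subseteq> \<Omega>" using mem_domain by (auto simp: strip_def)
  then show ?thesis using open_domain by (subst sets_restrict_space_iff) auto
qed

lemma strip_sq_le:
  assumes "u \<in> borel_measurable vol" "v \<in> borel_measurable vol"
  shows "strip_sq w u \<le> 2 * strip_sq w v + 2 * strip_sq w (\<lambda>x. u x - v x)"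
  unfolding strip_sq_def
  using assms by (intro nn_integral_square_le strip_set_measurable)

context
  fixes R :: real and F :: "'a \<Rightarrow> real"
  assumes R: "R < r" and F: "smooth_fun F" and out: "\<And>x. R < dist p x \<Longrightarrow> F x = 0"
begin

text \<open>The gap \<open>R < r\<close> makes \<open>F\<close> vanish on an open set containing the
  whole complement of the ball, its bounding sphere included.\<close>

lemma partial_deriv_outside: "x \<notin> ball p r \<Longrightarrow> partial_deriv v F x = 0"
proof -
  assume "x \<notin> ball p r"
  then have x: "x \<in> - cball p R" using R by auto
  have "((\<lambda>x. 0) has_derivative (\<lambda>v. 0)) (at x)" by simp
  then have "(F has_derivative (\<lambda>v. 0)) (at x)"
    by (rule has_derivative_transform_within_open[where s = "- cball p R"]) (use x out in auto)
  then show ?thesis by (rule partial_deriv_eq)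
qed

lemma outside_ball: "x \<notin> ball p r \<Longrightarrow> F x = 0"
  using out[of x] R by simp

text \<open>A foot outside the ball contributes 0; a foot inside it has height 0 and therefore lies
  on the frontier. Tubes have height 1, hence \<open>w \<le> 1\<close>.\<close>

lemma foot_integral_le_tube:
  assumes "w \<le> 1"
  shows "(\<integral>\<^sup>+x. indicator (strip w) x * ennreal ((F (foot x))\<^sup>2) \<partial>lborel)
    \<le> (\<integral>\<^sup>+x. indicator (tube (frontier \<Omega>)) x * ennreal ((F (foot x))\<^sup>2) \<partial>lborel)"
proof (rule nn_integral_mono)
  fix x
  show "indicator (strip w) x * ennreal ((F (foot x))\<^sup>2)
      \<le> indicator (tube (frontier \<Omega>)) x * ennreal ((F (foot x))\<^sup>2)"
  proof (cases "foot x \<in> ball p r")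
    case True
    then show ?thesis using mem_frontier[OF True] assms
      by (auto simp: strip_def tube_def split: split_indicator)
  qed (simp add: outside_ball)
qed

lemma difference_integral_le:
  assumes "0 < w"
  shows "(\<integral>\<^sup>+x. indicator (strip w) x * ennreal ((F x - F (foot x))\<^sup>2) \<partial>lborel)
    \<le> ennreal (w\<^sup>2) * strip_sq w (partial_deriv e F)"
  using line_estimate[OF F assms] by (subst strip_sq_lborel[OF partial_deriv_outside]) auto

text \<open>Split F(x) into its value at the foot, controlled by the surface integral, and the
  increment along \<open>e\<close>, controlled by the derivative.\<close>

lemma strip_sq_smooth_le:
  assumes hm: "hausdorff_additive TYPE('a)"
    and w: "0 < w" "w \<le> 1"
  shows "strip_sq w F \<le> 2 * (ennreal (tube_const DIM('a)) * (\<integral>\<^sup>+x. ennreal ((F x)\<^sup>2) \<partial>surf))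
    + 2 * (ennreal (w\<^sup>2) * strip_sq w (partial_deriv e F))"
proof -
  note [measurable] = smooth_fun_measurable[OF F]
  have "strip_sq w F = (\<integral>\<^sup>+x. indicator (strip w) x * ennreal ((F x)\<^sup>2) \<partial>lborel)"
    by (rule strip_sq_lborel[OF outside_ball])
  also have "\<dots> \<le> 2 * (\<integral>\<^sup>+x. indicator (strip w) x * ennreal ((F (foot x))\<^sup>2) \<partial>lborel)
      + 2 * (\<integral>\<^sup>+x. indicator (strip w) x * ennreal ((F x - F (foot x))\<^sup>2) \<partial>lborel)"
    by (rule nn_integral_square_le) measurable
  also have "\<dots> \<le> 2 * (ennreal (tube_const DIM('a)) * (\<integral>\<^sup>+x. ennreal ((F x)\<^sup>2) \<partial>surf))
    + 2 * (ennreal (w\<^sup>2) * strip_sq w (partial_deriv e F))"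
    by (intro add_mono mult_left_mono order_trans[OF foot_integral_le_tube] nn_integral_tube_le[OF hm]
        difference_integral_le w) auto
  finally show ?thesis .
qed

text \<open>The same splitting read backwards: values at the foot are controlled by the interior.
  This is the direction that shows uniqueness of traces.\<close>

lemma foot_integral_le:
  assumes w: "0 < w"
  shows "(\<integral>\<^sup>+x. indicator (strip w) x * ennreal ((F (foot x))\<^sup>2) \<partial>lborel)
    \<le> 2 * strip_sq w F + 2 * (ennreal (w\<^sup>2) * strip_sq w (partial_deriv e F))"
proof -
  note [measurable] = smooth_fun_measurable[OF F]
  have "(\<integral>\<^sup>+x. indicator (strip w) x * ennreal ((F (foot x))\<^sup>2) \<partial>lborel)
      \<le> 2 * (\<integral>\<^sup>+x. indicator (strip w) x * ennreal ((F x)\<^sup>2) \<partial>lborel)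
      + 2 * (\<integral>\<^sup>+x. indicator (strip w) x * ennreal ((F (foot x) - F x)\<^sup>2) \<partial>lborel)"
    by (rule nn_integral_square_le) measurable
  also have "(\<integral>\<^sup>+x. indicator (strip w) x * ennreal ((F x)\<^sup>2) \<partial>lborel) = strip_sq w F"
    by (rule strip_sq_lborel[OF outside_ball, symmetric])
  also have "(\<integral>\<^sup>+x. indicator (strip w) x * ennreal ((F (foot x) - F x)\<^sup>2) \<partial>lborel)
      = (\<integral>\<^sup>+x. indicator (strip w) x * ennreal ((F x - F (foot x))\<^sup>2) \<partial>lborel)"
    by (simp add: power2_commute)
  also have "2 * strip_sq w F + 2 * \<dots> \<le> 2 * strip_sq w F + 2 * (ennreal (w\<^sup>2) * strip_sq w (partial_deriv e F))"
    by (intro add_mono mult_left_mono difference_integral_le w) auto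
  finally show ?thesis .
qed

end

text \<open>Hardy's inequality in a boundary strip. A bounded factor on the surface integral is enough,
  because that integral tends to \<open>0\<close> along the approximating sequence for fixed \<open>w\<close>.\<close>

lemma hardy_strip:
  assumes hm: "hausdorff_additive TYPE('a)"
    and R: "R < r" and F: "\<And>j. smooth_fun (F j)" and out: "\<And>j x. R < dist p x \<Longrightarrow> F j x = 0"
    and f: "f \<in> borel_measurable vol" "f' \<in> borel_measurable vol"
    and lim: "L2_tendsto vol F f" "L2_tendsto vol (\<lambda>j. partial_deriv e (F j)) f'"
      "L2_tendsto surf F (\<lambda>x. 0)"
    and w: "0 < w" "w \<le> 1"
  shows "strip_sq w f \<le> 8 * (ennreal (w\<^sup>2) * strip_sq w f')"
proof -
  let ?c = "ennreal (tube_const DIM('a))"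
  let ?a = "\<lambda>j. strip_sq w (\<lambda>x. F j x - f x)"
  let ?b = "\<lambda>j. \<integral>\<^sup>+x. ennreal ((F j x - 0)\<^sup>2) \<partial>surf"
  let ?d = "\<lambda>j. strip_sq w (\<lambda>x. partial_deriv e (F j) x - f' x)"
  \<comment> \<open>The final constant 8 is 2 * 2 * 2: one factor for passing from \<open>f\<close>
    to \<open>F j\<close>, one for splitting off the boundary value, one for passing from the
    derivative of \<open>F j\<close> to \<open>f'\<close>.\<close>
  let ?B = "\<lambda>j. 2 * (2 * (?c * ?b j) + 2 * (ennreal (w\<^sup>2) * (2 * strip_sq w f' + 2 * ?d j))) + 2 * ?a j"
  note m = smooth_lebesgue_on[OF F] borel_measurable_lebesgue_on[OF partial_deriv_e_measurable[OF F]]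
  have le: "strip_sq w f \<le> ?B j" for j
  proof -
    have "strip_sq w f \<le> 2 * strip_sq w (F j) + 2 * strip_sq w (\<lambda>x. f x - F j x)"
      by (rule strip_sq_le[OF f(1) m(1)])
    also have "strip_sq w (\<lambda>x. f x - F j x) = ?a j"
      by (simp add: strip_sq_def power2_commute)
    also have "2 * strip_sq w (F j) + 2 * ?a j
        \<le> 2 * (2 * (?c * ?b j) + 2 * (ennreal (w\<^sup>2) * strip_sq w (partial_deriv e (F j)))) + 2 * ?a j"
      using strip_sq_smooth_le[OF R F out hm w, of j] by (intro add_mono mult_left_mono) auto
    also have "\<dots> \<le> ?B j"
      by (intro add_mono mult_left_mono strip_sq_le m f) auto
    finally show ?thesis .
  qed
  have a: "?a \<longlonglongrightarrow> 0" and d: "?d \<longlonglongrightarrow> 0"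
    unfolding strip_sq_def by (rule L2_tendsto_indicator_0, rule lim)+
  have b: "?b \<longlonglongrightarrow> 0" using lim(3) unfolding L2_tendsto_def .
  have "?B
      \<longlonglongrightarrow> 2 * (2 * (?c * 0) + 2 * (ennreal (w\<^sup>2) * (2 * strip_sq w f' + 2 * 0))) + 2 * 0"
    by (intro tendsto_add ennreal_tendsto_cmult tendsto_const a b d) auto
  also have "2 * (2 * (?c * 0) + 2 * (ennreal (w\<^sup>2) * (2 * strip_sq w f' + 2 * 0))) + 2 * 0
      = 8 * (ennreal (w\<^sup>2) * strip_sq w f')"
    by (simp add: mult_ac)
  finally show ?thesis by (rule le_LIMSEQ_ennreal[OF le])
qed

text \<open>Over the tube of height 1, the functions x \<mapsto> F j (foot x) tend in L2 to 0,
  because \<open>F j\<close> and its derivative do so in the interior, and also to g (foot x),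
  because surface integrals dominate tube integrals. So g (foot x) = 0 almost everywhere on the
  tube, and the set where \<open>g\<close> is nonzero has a null tube, hence is null itself.\<close>

lemma trace_of_zero:
  assumes hm: "hausdorff_additive TYPE('a)"
    and R: "R < r" and F: "\<And>j. smooth_fun (F j)" and out: "\<And>j x. R < dist p x \<Longrightarrow> F j x = 0"
    and g: "g \<in> borel_measurable surf"
    and lim: "L2_tendsto vol F (\<lambda>x. 0)" "L2_tendsto vol (\<lambda>j. partial_deriv e (F j)) (\<lambda>x. 0)"
      "L2_tendsto surf F g"
  shows "AE x in surf. x \<in> ball p r \<longrightarrow> g x = 0"
proof -
  let ?c = "ennreal (tube_const DIM('a))"
  \<comment> \<open>The extension by 0 is Borel on the whole space, as the comparison of tube and
    surface integrals demands.\<close>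
  define h where "h x = indicator (frontier \<Omega>) x *\<^sub>R g x" for x
  have h [measurable]: "h \<in> borel_measurable borel"
    using g unfolding h_def measurable_cong_sets[OF sets_surface_measure refl]
    by (subst (asm) borel_measurable_restrict_space_iff) auto
  note [measurable] = smooth_fun_measurable[OF F]
  have T [measurable]: "tube (frontier \<Omega>) \<in> sets borel" by (rule tube_measurable) simp
  let ?T = "\<lambda>u. \<integral>\<^sup>+x. indicator (tube (frontier \<Omega>)) x * ennreal ((u x)\<^sup>2) \<partial>lborel"
  define X where "X = ?T (\<lambda>x. h (foot x))"
  let ?a = "\<lambda>j. strip_sq 1 (\<lambda>x. F j x - 0)"
  let ?b = "\<lambda>j. \<integral>\<^sup>+x. ennreal ((F j x - g x)\<^sup>2) \<partial>surf"
  let ?d = "\<lambda>j. strip_sq 1 (\<lambda>x. partial_deriv e (F j) x - 0)"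
  let ?B = "\<lambda>j. 2 * (2 * ?a j + 2 * (ennreal (1\<^sup>2) * ?d j)) + 2 * (?c * ?b j)"
  have "X \<le> ?B j" for j
  proof -
    have 1: "?T (\<lambda>x. F j (foot x))
        \<le> 2 * ?a j + 2 * (ennreal (1\<^sup>2) * ?d j)"
    proof (rule order_trans)
      show "?T (\<lambda>x. F j (foot x))
          \<le> (\<integral>\<^sup>+x. indicator (strip 1) x * ennreal ((F j (foot x))\<^sup>2) \<partial>lborel)"
        by (rule nn_integral_mono) (auto simp: tube_def strip_def split: split_indicator)
      show "\<dots> \<le> 2 * ?a j + 2 * (ennreal (1\<^sup>2) * ?d j)"
        using foot_integral_le[OF R F out, of 1 j] by simp
    qed
    have 2: "?T (\<lambda>x. h (foot x) - F j (foot x)) \<le> ?c * ?b j"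
    proof -
      have "(\<integral>\<^sup>+x. ennreal ((h x - F j x)\<^sup>2) \<partial>surf) = ?b j"
        by (rule nn_integral_cong) (simp add: space_surface_measure h_def power2_commute)
      then show ?thesis using nn_integral_tube_le[OF hm, of "\<lambda>x. ennreal ((h x - F j x)\<^sup>2)"] by simp
    qed
    have "X \<le> 2 * ?T (\<lambda>x. F j (foot x))
        + 2 * ?T (\<lambda>x. h (foot x) - F j (foot x))"
      unfolding X_def by (rule nn_integral_square_le) measurable
    also have "\<dots> \<le> ?B j"
      by (intro add_mono mult_left_mono 1 2) auto
    finally show ?thesis .
  qed
  moreover have "?B \<longlonglongrightarrow> 0"
  proof -
    have a: "?a \<longlonglongrightarrow> 0" and d: "?d \<longlonglongrightarrow> 0"
      unfolding strip_sq_def by (rule L2_tendsto_indicator_0, rule lim)+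
    have b: "?b \<longlonglongrightarrow> 0" using lim(3) unfolding L2_tendsto_def .
    have "?B
        \<longlonglongrightarrow> 2 * (2 * 0 + 2 * (ennreal (1\<^sup>2) * 0)) + 2 * (?c * 0)"
      by (intro tendsto_add ennreal_tendsto_cmult a b d) auto
    then show ?thesis by simp
  qed
  ultimately have "X \<le> 0" by (rule le_LIMSEQ_ennreal)
  then have "AE x in lborel. indicator (tube (frontier \<Omega>)) x * ennreal ((h (foot x))\<^sup>2) = 0"
    unfolding X_def by (subst (asm) le_zero_eq, subst (asm) nn_integral_0_iff_AE) auto
  moreover define A where "A = {x \<in> frontier \<Omega> \<inter> ball p r. h x \<noteq> 0}"
  ultimately have ae: "AE x in lborel. x \<notin> tube A"
    by (elim eventually_mono) (auto simp: A_def tube_def split: split_indicator_asm)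
  have A: "A \<in> sets borel" unfolding A_def by measurable
  have "tube A \<in> null_sets lborel"
    using ae tube_measurable[OF A] by (simp add: AE_iff_null_sets)
  then have "hausdorff_outer (DIM('a) - 1) A = 0"
    using mem_frontier by (intro hausdorff_outer_null bounded_subset[OF bounded_ball]) (auto simp: A_def)
  moreover have "A \<subseteq> frontier \<Omega>" by (auto simp: A_def)
  ultimately have "emeasure surf A = 0" using emeasure_surface[OF hm A] by simp
  moreover have "A \<in> sets surf"
    unfolding sets_surface_measure using A \<open>A \<subseteq> frontier \<Omega>\<close> by (subst sets_restrict_space_iff) auto
  ultimately have "A \<in> null_sets surf" by auto
  then have "AE x in surf. x \<notin> A" by (rule AE_not_in)
  then show ?thesis using AE_space
    by eventually_elim (auto simp: A_def h_def space_surface_measure)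
qed

end

section \<open>Limits of the cut-off terms in a single chart\<close>

lemma deriv_cut_off_bounded: obtains M where "\<And>t. 0 \<le> t \<Longrightarrow> \<bar>deriv cut_off t\<bar> \<le> M"
proof -
  have "compact (deriv cut_off ` {0..1})"
    by (intro compact_continuous_image smooth_real_continuous smooth_real_deriv smooth_real_cut_off) auto
  then have "bounded (deriv cut_off ` {0..1})" by (rule compact_imp_bounded)
  then obtain M where M: "\<And>t. t \<in> {0..1} \<Longrightarrow> \<bar>deriv cut_off t\<bar> \<le> M"
    unfolding bounded_iff by (auto simp del: atLeastAtMost_iff)
  have "\<bar>deriv cut_off t\<bar> \<le> M" if "0 \<le> t" for t
  proof (cases "t \<le> 1")
    case False
    then have "deriv cut_off t = 0" by (intro deriv_cut_off_ge_1) simp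
    then show ?thesis using M[of 0] abs_ge_zero[of "deriv cut_off 0"] by simp
  qed (use M that in auto)
  then show ?thesis using that by blast
qed

context boundary_chart
begin

lemma eventually_height_large:
  assumes "0 < height x"
  shows "\<forall>\<^sub>F n in sequentially. 1 \<le> real (Suc n) * height x"
proof -
  obtain N :: nat where N: "1 < real N * height x" using reals_Archimedean3[OF assms] by blast
  have "1 \<le> real (Suc n) * height x" if "N \<le> n" for n
  proof -
    have "real N * height x \<le> real (Suc n) * height x" using that assms by (intro mult_right_mono) auto
    with N show ?thesis by simp
  qed
  then show ?thesis unfolding eventually_sequentially by blast
qed

lemma smooth_fun_scaled_height: "smooth_fun (\<lambda>x. c * height x)"
  by (intro smooth_fun_mult smooth_fun_const smooth_height)

text \<open>Where \<open>w\<close> is nonzero in the domain the height is positive, so the factor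
  lies in [0, 1] and is eventually 0; dominated convergence applies.\<close>

lemma cut_off_L2_tendsto:
  assumes w: "L2_fun vol w" and out: "\<And>x. x \<notin> ball p r \<Longrightarrow> w x = 0"
  shows "L2_tendsto vol (\<lambda>n x. cut_off (real (Suc n) * height x) * w x) (\<lambda>x. 0)"
proof -
  note [measurable] = L2_measurable[OF w]
    smooth_lebesgue_on[OF smooth_fun_compose[OF smooth_real_cut_off smooth_fun_scaled_height]]
  have pos: "0 < height x" if "x \<in> \<Omega>" "w x \<noteq> 0" for x
    using mem_domain[of x] out[of x] that by auto
  have "(\<lambda>n. \<integral>\<^sup>+x. ennreal ((cut_off (real (Suc n) * height x) * w x - 0)\<^sup>2) \<partial>vol)
      \<longlonglongrightarrow> (\<integral>\<^sup>+x. 0 \<partial>vol)"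
  proof (rule nn_integral_dominated_convergence)
    show "(\<lambda>x. ennreal ((w x)\<^sup>2)) \<in> borel_measurable vol" by measurable
    show "(\<integral>\<^sup>+x. ennreal ((w x)\<^sup>2) \<partial>vol) < \<infinity>"
      using w by (simp add: L2_fun_def nn_integral_eq_integral)
    show "AE x in vol. ennreal ((cut_off (real (Suc n) * height x) * w x - 0)\<^sup>2) \<le> ennreal ((w x)\<^sup>2)" for n
    proof (rule AE_I2)
      fix x assume "x \<in> space vol"
      then have x: "x \<in> \<Omega>" by simp
      show "ennreal ((cut_off (real (Suc n) * height x) * w x - 0)\<^sup>2) \<le> ennreal ((w x)\<^sup>2)"
      proof (cases "w x = 0")
        case False
        have "0 \<le> cut_off (real (Suc n) * height x)" "cut_off (real (Suc n) * height x) \<le> 1"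
          using pos[OF x False] by (auto intro!: cut_off_nonneg cut_off_le_1 mult_nonneg_nonneg)
        then have "(cut_off (real (Suc n) * height x))\<^sup>2 \<le> 1" by (simp add: power_le_one)
        from mult_right_mono[OF this, of "(w x)\<^sup>2"] show ?thesis
          by (simp add: power_mult_distrib ennreal_leI)
      qed simp
    qed
    show "AE x in vol. (\<lambda>n. ennreal ((cut_off (real (Suc n) * height x) * w x - 0)\<^sup>2)) \<longlonglongrightarrow> 0"
    proof (rule AE_I2)
      fix x assume "x \<in> space vol"
      then have x: "x \<in> \<Omega>" by simp
      show "(\<lambda>n. ennreal ((cut_off (real (Suc n) * height x) * w x - 0)\<^sup>2)) \<longlonglongrightarrow> 0"
      proof (cases "w x = 0")
        case False
        show ?thesis
          by (rule tendsto_eventually, rule eventually_mono[OF eventually_height_large[OF pos[OF x False]]])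
          (simp add: cut_off_ge_1)
      qed simp
    qed
  qed measurable
  then show ?thesis unfolding L2_tendsto_def by simp
qed

text \<open>The strips decrease to the empty set. This supplies the decay that remains after n has
  been cancelled against the strip width.\<close>

lemma strip_sq_tendsto_0:
  assumes f': "L2_fun vol f'"
  shows "(\<lambda>n. strip_sq (1 / real (Suc n)) f') \<longlonglongrightarrow> 0"
proof -
  note [measurable] = L2_measurable[OF f'] strip_set_measurable
  have "(\<lambda>n. strip_sq (1 / real (Suc n)) f') \<longlonglongrightarrow> (\<integral>\<^sup>+x. 0 \<partial>vol)"
    unfolding strip_sq_def
  proof (rule nn_integral_dominated_convergence)
    show "(\<lambda>x. ennreal ((f' x)\<^sup>2)) \<in> borel_measurable vol" by measurable
    show "(\<integral>\<^sup>+x. ennreal ((f' x)\<^sup>2) \<partial>vol) < \<infinity>"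
      using f' by (simp add: L2_fun_def nn_integral_eq_integral)
    show "AE x in vol. (\<lambda>n. indicator (strip (1 / real (Suc n)) \<inter> ball p r) x * ennreal ((f' x)\<^sup>2)) \<longlonglongrightarrow> 0"
    proof (rule AE_I2)
      fix x
      show "(\<lambda>n. indicator (strip (1 / real (Suc n)) \<inter> ball p r) x * ennreal ((f' x)\<^sup>2)) \<longlonglongrightarrow> 0"
      proof (cases "0 < height x")
        case True
        have "\<forall>\<^sub>F n in sequentially. indicator (strip (1 / real (Suc n)) \<inter> ball p r) x * ennreal ((f' x)\<^sup>2) = 0"
          using eventually_height_large[OF True]
        proof eventually_elim
          case (elim n)
          then have "1 / real (Suc n) \<le> height x" by (simp add: field_simps)
          then have "x \<notin> strip (1 / real (Suc n))" by (simp add: strip_def)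
          then show ?case by simp
        qed
        then show ?thesis by (rule tendsto_eventually)
      qed (simp add: strip_def)
    qed
  qed (measurable, auto split: split_indicator)
  then show ?thesis by simp
qed

text \<open>With N = n + 1, the integrand lives on the strip of width 1/N and carries the factor
  N^2. Hardy's inequality at this width contributes 1/N^2, leaving 8 M^2 times the integral of f'^2
  over the shrinking strip.\<close>

lemma cut_off_deriv_L2_tendsto:
  assumes f: "L2_fun vol f" and out: "\<And>x. x \<notin> ball p r \<Longrightarrow> f x = 0"
    and f': "L2_fun vol f'"
    and hardy: "\<And>w. 0 < w \<Longrightarrow> w \<le> 1 \<Longrightarrow> strip_sq w f \<le> 8 * (ennreal (w\<^sup>2) * strip_sq w f')"
  shows "L2_tendsto vol
    (\<lambda>n x. real (Suc n) * deriv cut_off (real (Suc n) * height x) * f x) (\<lambda>x. 0)"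
proof -
  obtain M where M: "\<And>t. 0 \<le> t \<Longrightarrow> \<bar>deriv cut_off t\<bar> \<le> M" using deriv_cut_off_bounded by blast
  note [measurable] = L2_measurable[OF f] strip_set_measurable
  have "(\<integral>\<^sup>+x. ennreal ((real (Suc n) * deriv cut_off (real (Suc n) * height x) * f x - 0)\<^sup>2) \<partial>vol)
      \<le> 8 * ennreal (M\<^sup>2) * strip_sq (1 / real (Suc n)) f'" for n
  proof -
    define N where "N = real (Suc n)"
    have N: "1 \<le> N" by (simp add: N_def)
    have "(\<integral>\<^sup>+x. ennreal ((N * deriv cut_off (N * height x) * f x - 0)\<^sup>2) \<partial>vol)
        \<le> (\<integral>\<^sup>+x. ennreal (M\<^sup>2 * N\<^sup>2) * (indicator (strip (1 / N) \<inter> ball p r) x * ennreal ((f x)\<^sup>2)) \<partial>vol)"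
    proof (rule nn_integral_mono)
      fix x assume "x \<in> space vol"
      then have x: "x \<in> \<Omega>" by simp
      show "ennreal ((N * deriv cut_off (N * height x) * f x - 0)\<^sup>2)
          \<le> ennreal (M\<^sup>2 * N\<^sup>2) * (indicator (strip (1 / N) \<inter> ball p r) x * ennreal ((f x)\<^sup>2))"
      proof (cases "f x = 0 \<or> deriv cut_off (N * height x) = 0")
        case False
        then have b: "x \<in> ball p r" using out by blast
        then have h: "0 < height x" using mem_domain x by blast
        have "\<not> 1 \<le> N * height x" using False deriv_cut_off_ge_1 by blast
        then have "height x < 1 / N" using N by (simp add: field_simps)
        with b h have ind: "x \<in> strip (1 / N) \<inter> ball p r" by (simp add: strip_def)
        have "(deriv cut_off (N * height x))\<^sup>2 \<le> M\<^sup>2"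
          using power_mono[OF M[of "N * height x"], of 2] h N by simp
        then have "N\<^sup>2 * (deriv cut_off (N * height x))\<^sup>2 * (f x)\<^sup>2 \<le> N\<^sup>2 * M\<^sup>2 * (f x)\<^sup>2"
          by (intro mult_right_mono mult_left_mono) auto
        then have "(N * deriv cut_off (N * height x) * f x)\<^sup>2 \<le> M\<^sup>2 * N\<^sup>2 * (f x)\<^sup>2"
          by (simp add: power_mult_distrib mult_ac)
        then show ?thesis using ind by (simp add: ennreal_mult'[symmetric] ennreal_leI)
      qed auto
    qed
    also have "\<dots> = ennreal (M\<^sup>2 * N\<^sup>2) * strip_sq (1 / N) f"
      unfolding strip_sq_def by (rule nn_integral_cmult) measurable
    also have "\<dots> \<le> ennreal (M\<^sup>2 * N\<^sup>2) * (8 * (ennreal ((1 / N)\<^sup>2) * strip_sq (1 / N) f'))"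
      using N by (intro mult_left_mono hardy) auto
    also have "\<dots> = 8 * (ennreal (M\<^sup>2 * N\<^sup>2) * ennreal ((1 / N)\<^sup>2)) * strip_sq (1 / N) f'"
      by (simp only: mult_ac)
    also have "ennreal (M\<^sup>2 * N\<^sup>2) * ennreal ((1 / N)\<^sup>2) = ennreal (M\<^sup>2)"
      using N by (simp add: ennreal_mult'[symmetric] power_divide)
    finally show ?thesis unfolding N_def .
  qed
  moreover have "(\<lambda>n. 8 * ennreal (M\<^sup>2) * strip_sq (1 / real (Suc n)) f') \<longlonglongrightarrow> 0"
    using ennreal_tendsto_cmult[OF _ strip_sq_tendsto_0[OF f'], of "8 * ennreal (M\<^sup>2)"]
    by (simp add: ennreal_mult_less_top)
  ultimately show ?thesis unfolding L2_tendsto_def by (rule ennreal_tendsto_0_le)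
qed

text \<open>The sequence that witnesses the trace of \<open>v\<close> is multiplied by
  \<open>c\<close>; this yields smooth functions supported in the chart, as the strip estimates
  require.\<close>

lemma localised_approximation:
  assumes \<Omega>: "bounded \<Omega>" and tr: "has_trace \<Omega> v h" and c: "smooth_fun c"
    and R: "\<And>x. R < dist p x \<Longrightarrow> c x = 0"
  obtains F where "\<And>j. smooth_fun (F j)" "\<And>j x. R < dist p x \<Longrightarrow> F j x = 0"
    "L2_tendsto vol F (\<lambda>x. c x * v x)"
    "L2_tendsto vol (\<lambda>j. partial_deriv e (F j))
      (\<lambda>x. \<Sum>b\<in>Basis. (e \<bullet> b) * weak_partial \<Omega> b (\<lambda>x. c x * v x) x)"
    "L2_tendsto surf F (\<lambda>x. c x * h x)"
proof -
  note O = open_domain \<Omega>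
  obtain V where v: "W12 \<Omega> v" "L2_fun surf h" and V: "\<And>j. smooth_fun (V j)"
      "L2_tendsto vol V v"
      "\<And>b. b\<in>Basis \<Longrightarrow> L2_tendsto vol (\<lambda>j. partial_deriv b (V j)) (weak_partial \<Omega> b v)"
      "L2_tendsto surf V h"
    using tr unfolding has_trace_def by blast
  have s: "smooth_fun (\<lambda>x. c x * V j x)" for j by (intro smooth_fun_mult V c)
  have W: "W12 \<Omega> (\<lambda>x. c x * v x)" by (rule W12_mult[OF O v(1) c])
  have D: "L2_tendsto vol (\<lambda>j. partial_deriv b (\<lambda>x. c x * V j x))
      (weak_partial \<Omega> b (\<lambda>x. c x * v x))" if b: "b \<in> Basis" for b
    by (intro partial_deriv_mult_L2_tendsto O c v V b)
  show ?thesis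
  proof (rule that[of "\<lambda>j x. c x * V j x"])
    show "L2_tendsto vol (\<lambda>j x. c x * V j x) (\<lambda>x. c x * v x)"
      by (intro L2_tendsto_smooth_mult V c \<Omega> W12_L2 v)
    show "L2_tendsto surf (\<lambda>j x. c x * V j x) (\<lambda>x. c x * h x)"
      by (rule L2_surface_mult(2)[OF O c v(2) V(1) V(4)])
    \<comment> \<open>Weak derivatives are available along \<open>Basis\<close> only, while
      \<open>e\<close> may be the negative of a basis vector; hence the expansion.\<close>
    have "L2_tendsto vol (\<lambda>j x. \<Sum>b\<in>Basis. (e \<bullet> b) * partial_deriv b (\<lambda>x. c x * V j x) x)
        (\<lambda>x. \<Sum>b\<in>Basis. (e \<bullet> b) * weak_partial \<Omega> b (\<lambda>x. c x * v x) x)"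
      by (intro L2_tendsto_sum L2_tendsto_cmult D L2_measurable L2_fun_cmult weak_partial_L2 W
          L2_fun_smooth O smooth_fun_partial s)
    moreover have "(\<lambda>x. \<Sum>b\<in>Basis. (e \<bullet> b) * partial_deriv b (\<lambda>x. c x * V j x) x)
        = partial_deriv e (\<lambda>x. c x * V j x)" for j
      by (rule ext) (rule partial_deriv_expansion[OF s, symmetric])
    ultimately show "L2_tendsto vol (\<lambda>j. partial_deriv e (\<lambda>x. c x * V j x))
        (\<lambda>x. \<Sum>b\<in>Basis. (e \<bullet> b) * weak_partial \<Omega> b (\<lambda>x. c x * v x) x)" by simp
  qed (use s R in auto)
qed

text \<open>The approximating functions need not vanish on the boundary; it suffices that their
  boundary values tend to c h = 0 in L2.\<close>

lemma hardy_trace: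
  assumes hm: "hausdorff_additive TYPE('a)"
    and \<Omega>: "bounded \<Omega>" and tr: "has_trace \<Omega> v h" and c: "smooth_fun c"
    and R: "R < r" "\<And>x. R < dist p x \<Longrightarrow> c x = 0"
    and zero: "AE x in surf. c x * h x = 0"
  shows "L2_tendsto vol
    (\<lambda>n x. real (Suc n) * deriv cut_off (real (Suc n) * height x) * (c x * v x)) (\<lambda>x. 0)"
proof -
  note O = open_domain \<Omega>
  have v: "W12 \<Omega> v" using tr by (simp add: has_trace_def)
  have W: "W12 \<Omega> (\<lambda>x. c x * v x)" by (rule W12_mult[OF O v c])
  let ?f' = "\<lambda>x. \<Sum>b\<in>Basis. (e \<bullet> b) * weak_partial \<Omega> b (\<lambda>x. c x * v x) x"
  obtain F where F: "\<And>j. smooth_fun (F j)" "\<And>j x. R < dist p x \<Longrightarrow> F j x = 0"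
    "L2_tendsto vol F (\<lambda>x. c x * v x)"
    "L2_tendsto vol (\<lambda>j. partial_deriv e (F j)) ?f'"
    "L2_tendsto surf F (\<lambda>x. c x * h x)"
  proof (rule localised_approximation[OF \<Omega> tr c, of R])
    show "c x = 0" if "R < dist p x" for x using R(2) that .
  qed (rule that)
  have F0: "L2_tendsto surf F (\<lambda>x. 0)"
    by (rule L2_tendsto_cong[OF F(5) zero]) simp
  have f': "L2_fun vol ?f'"
    by (intro L2_fun_sum L2_fun_cmult weak_partial_L2 W)
  show ?thesis
  proof (rule cut_off_deriv_L2_tendsto[OF W12_L2[OF W] _ f'])
    show "c x * v x = 0" if "x \<notin> ball p r" for x using R(2)[of x] R(1) that by simp
    show "strip_sq w (\<lambda>x. c x * v x) \<le> 8 * (ennreal (w\<^sup>2) * strip_sq w ?f')"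
      if "0 < w" "w \<le> 1" for w
      by (rule hardy_strip[OF hm R(1) F(1,2) L2_measurable[OF W12_L2[OF W]] L2_measurable[OF f'] F(3,4) F0 that])
  qed
qed

lemma trace_of_zero_localised:
  assumes hm: "hausdorff_additive TYPE('a)"
    and \<Omega>: "bounded \<Omega>" and tr: "has_trace \<Omega> v h" and zero: "AE x in vol. v x = 0"
  shows "AE x in surf. x \<in> ball p (r / 4) \<longrightarrow> h x = 0"
proof -
  note O = open_domain \<Omega>
  let ?c = "bump p (r / 2)"
  have v: "W12 \<Omega> v" "L2_fun surf h" using tr by (simp_all add: has_trace_def)
  have W: "W12 \<Omega> (\<lambda>x. ?c x * v x)" by (rule W12_mult[OF O v(1) smooth_fun_bump])
  have W0: "AE x in vol. ?c x * v x = 0" using zero by eventually_elim simp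
  let ?f' = "\<lambda>x. \<Sum>b\<in>Basis. (e \<bullet> b) * weak_partial \<Omega> b (\<lambda>x. ?c x * v x) x"
  have R: "?c x = 0" if "r / 2 < dist p x" for x
    using r_pos that by (intro bump_outside) (auto simp: dist_norm norm_minus_commute)
  obtain F where F: "\<And>j. smooth_fun (F j)" "\<And>j x. r / 2 < dist p x \<Longrightarrow> F j x = 0"
    "L2_tendsto vol F (\<lambda>x. ?c x * v x)"
    "L2_tendsto vol (\<lambda>j. partial_deriv e (F j)) ?f'"
    "L2_tendsto surf F (\<lambda>x. ?c x * h x)"
  proof (rule localised_approximation[OF \<Omega> tr smooth_fun_bump, of "r / 2" p "r / 2"])
    show "?c x = 0" if "r / 2 < dist p x" for x using R that .
  qed (rule that)
  have "AE x in vol. \<forall>b\<in>Basis. weak_partial \<Omega> b (\<lambda>x. ?c x * v x) x = 0"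
    using weak_partial_AE_zero[OF O W W0] by (intro AE_finite_allI) auto
  then have f'0: "AE x in vol. ?f' x = 0" by eventually_elim simp
  have "AE x in surf. x \<in> ball p r \<longrightarrow> ?c x * h x = 0"
  proof (rule trace_of_zero[OF hm, of "r / 2" F])
    show "smooth_fun (F j)" for j by (rule F)
    show "F j x = 0" if "r / 2 < dist p x" for j x using F(2) that .
    show "(\<lambda>x. ?c x * h x) \<in> borel_measurable surf"
      by (intro borel_measurable_times smooth_surface smooth_fun_bump L2_measurable v)
    show "L2_tendsto vol F (\<lambda>x. 0)" by (rule L2_tendsto_cong[OF F(3) W0]) simp
    show "L2_tendsto vol (\<lambda>j. partial_deriv e (F j)) (\<lambda>x. 0)"
      by (rule L2_tendsto_cong[OF F(4) f'0]) simp
  qed (use r_pos F(5) in auto)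
  then show ?thesis
  proof eventually_elim
    case (elim x)
    then show ?case using r_pos bump_inside[of "r / 2" x p]
      by (auto simp: dist_norm norm_minus_commute)
  qed
qed

end

section \<open>Forms and the boundary cut-off\<close>

lemma finite_basis_tuples: "finite (basis_tuples m :: 'a::euclidean_space list set)"
proof -
  have "basis_tuples m = {bs :: 'a list. set bs \<subseteq> Basis \<and> length bs = m}"
    by (auto simp: basis_tuples_def)
  then show ?thesis using finite_lists_length_eq[of "Basis :: 'a set" m] by simp
qed

lemma basis_tuples_nth: "cs \<in> basis_tuples m \<Longrightarrow> j < m \<Longrightarrow> cs ! j \<in> Basis"
  unfolding basis_tuples_def using nth_mem by blast

lemma basis_tuples_omit: "cs \<in> basis_tuples (Suc m) \<Longrightarrow> j < Suc m \<Longrightarrow> omit j cs \<in> basis_tuples m"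
  unfolding basis_tuples_def omit_def
  by (auto dest: in_set_takeD in_set_dropD)

lemma alt_form_add:
  assumes "alt_form m \<alpha>" "alt_form m \<beta>"
  shows "alt_form m (\<lambda>vs. \<alpha> vs + c * \<beta> vs)"
  unfolding alt_form_def
proof (intro conjI allI impI)
  fix vs :: "'a list" and i assume "length vs = m \<and> i < m"
  then have l: "linear (\<lambda>v. \<alpha> (vs[i := v]))" "linear (\<lambda>v. \<beta> (vs[i := v]))"
    using assms unfolding alt_form_def by blast+
  show "linear (\<lambda>v. \<alpha> (vs[i := v]) + c * \<beta> (vs[i := v]))"
    by (rule linearI) (simp_all add: linear_add[OF l(1)] linear_add[OF l(2)]
        linear_scale[OF l(1)] linear_scale[OF l(2)] algebra_simps)
qed (use assms in \<open>auto simp: alt_form_def\<close>)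

lemma alt_form_zero: "alt_form m (\<lambda>vs. 0)"
  unfolding alt_form_def by (auto simp: linear_zero)

lemma alt_form_eq_0:
  fixes \<alpha> :: "'a::euclidean_space form"
  assumes \<alpha>: "alt_form m \<alpha>" and z: "\<And>bs. bs \<in> basis_tuples m \<Longrightarrow> \<alpha> bs = 0"
  shows "\<alpha> = (\<lambda>vs. 0)"
proof -
  \<comment> \<open>The first \<open>j\<close> arguments are arbitrary and the others basis vectors;
    each induction step frees one more slot by linearity.\<close>
  have "\<forall>vs. length vs = m \<and> (\<forall>i<m. j \<le> i \<longrightarrow> vs ! i \<in> Basis) \<longrightarrow> \<alpha> vs = 0" if "j \<le> m" for j
    using that
  proof (induction j)
    case 0
    then show ?case using z by (auto simp: basis_tuples_def in_set_conv_nth subset_iff)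
  next
    case (Suc j)
    show ?case
    proof (intro allI impI, elim conjE)
      fix vs :: "'a list" assume len: "length vs = m" and b: "\<forall>i<m. Suc j \<le> i \<longrightarrow> vs ! i \<in> Basis"
      have j: "j < m" using Suc.prems by simp
      have l: "linear (\<lambda>v. \<alpha> (vs[j := v]))" using \<alpha> len j unfolding alt_form_def by blast
      have "\<alpha> (vs[j := b']) = 0" if "b' \<in> Basis" for b'
      proof -
        have "\<forall>i<m. j \<le> i \<longrightarrow> vs[j := b'] ! i \<in> Basis"
          using b that len by (auto simp: nth_list_update le_eq_less_or_eq)
        then show ?thesis using Suc.IH j len by simp
      qed
      then have 0: "\<alpha> (vs[j := (vs ! j \<bullet> b') *\<^sub>R b']) = 0" if "b' \<in> Basis" for b'
        using linear_scale[OF l] that by simp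
      have "\<alpha> vs = \<alpha> (vs[j := (\<Sum>b'\<in>Basis. (vs ! j \<bullet> b') *\<^sub>R b')])"
        by (simp add: euclidean_representation)
      also have "\<dots> = (\<Sum>b'\<in>Basis. \<alpha> (vs[j := (vs ! j \<bullet> b') *\<^sub>R b']))"
        by (rule linear_sum[OF l])
      finally show "\<alpha> vs = 0" using 0 by simp
    qed
  qed
  from this[of m] have "\<alpha> vs = 0" if "length vs = m" for vs using that by auto
  then show ?thesis using \<alpha> unfolding alt_form_def by blast
qed

lemma wedge_covector_scaleR: "wedge_covector (c *\<^sub>R \<nu>) \<alpha> vs = c * wedge_covector \<nu> \<alpha> vs"
  by (simp add: wedge_covector_def sum_distrib_left mult_ac)

lemma ext_deriv_basis:
  assumes cs: "cs \<in> basis_tuples (Suc m)"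
  shows "ext_deriv \<Omega> \<omega> x cs = (\<Sum>j<Suc m. (-1) ^ j * weak_partial \<Omega> (cs ! j) (\<lambda>y. \<omega> y (omit j cs)) x)"
proof -
  have "(\<Sum>b\<in>Basis. (cs ! j \<bullet> b) * w b) = w (cs ! j)" if "j < Suc m" for j and w :: "'a \<Rightarrow> real"
  proof -
    have "(\<Sum>b\<in>Basis. (cs ! j \<bullet> b) * w b) = (\<Sum>b\<in>Basis. if cs ! j = b then w b else 0)"
      using basis_tuples_nth[OF cs that] by (intro sum.cong) (auto simp: inner_Basis)
    then show ?thesis using basis_tuples_nth[OF cs that] by simp
  qed
  moreover have "length cs = Suc m" using cs by (simp add: basis_tuples_def)
  ultimately show ?thesis unfolding ext_deriv_def by (intro sum.cong) auto
qed

lemma ext_deriv_L2: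
  assumes "\<And>bs. bs \<in> basis_tuples m \<Longrightarrow> W12 \<Omega> (\<lambda>x. \<omega> x bs)" "cs \<in> basis_tuples (Suc m)"
  shows "L2_fun (lebesgue_on \<Omega>) (\<lambda>x. ext_deriv \<Omega> \<omega> x cs)"
  unfolding ext_deriv_basis[OF assms(2)]
  by (intro L2_fun_sum L2_fun_cmult weak_partial_L2 assms(1) basis_tuples_omit[OF assms(2)]
      basis_tuples_nth[OF assms(2)]) auto

lemma form_norm_square: "(form_norm m \<alpha>)\<^sup>2 = (\<Sum>bs\<in>basis_tuples m. (\<alpha> bs)\<^sup>2) / fact m"
  unfolding form_norm_def by (simp add: sum_nonneg)

lemma integral_form_norm_square:
  assumes "\<And>bs. bs \<in> basis_tuples m \<Longrightarrow> L2_fun M (\<lambda>x. \<omega> x bs)"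
  shows "(\<integral>x. (form_norm m (\<omega> x))\<^sup>2 \<partial>M) = (\<Sum>bs\<in>basis_tuples m. \<integral>x. (\<omega> x bs)\<^sup>2 \<partial>M) / fact m"
proof -
  have "integrable M (\<lambda>x. (\<omega> x bs)\<^sup>2)" if "bs \<in> basis_tuples m" for bs
    using assms[OF that] by (simp add: L2_fun_def)
  then show ?thesis unfolding form_norm_square by simp
qed

lemma energy_eq:
  assumes "\<And>bs. bs \<in> basis_tuples m \<Longrightarrow> W12 \<Omega> (\<lambda>x. \<omega> x bs)"
  shows "energy m \<Omega> \<omega> =
    1 / 2 * ((\<Sum>cs\<in>basis_tuples (Suc m). \<integral>x. (ext_deriv \<Omega> \<omega> x cs)\<^sup>2 \<partial>lebesgue_on \<Omega>) / fact (Suc m)) +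
    1 / 2 * ((\<Sum>bs\<in>basis_tuples m. \<integral>x. (\<omega> x bs)\<^sup>2 \<partial>lebesgue_on \<Omega>) / fact m)"
proof -
  have "(\<integral>x. (form_norm (Suc m) (ext_deriv \<Omega> \<omega> x))\<^sup>2 \<partial>lebesgue_on \<Omega>)
      = (\<Sum>cs\<in>basis_tuples (Suc m). \<integral>x. (ext_deriv \<Omega> \<omega> x cs)\<^sup>2 \<partial>lebesgue_on \<Omega>) / fact (Suc m)"
    by (rule integral_form_norm_square) (rule ext_deriv_L2, rule assms)
  moreover have "(\<integral>x. (form_norm m (\<omega> x))\<^sup>2 \<partial>lebesgue_on \<Omega>)
      = (\<Sum>bs\<in>basis_tuples m. \<integral>x. (\<omega> x bs)\<^sup>2 \<partial>lebesgue_on \<Omega>) / fact m"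
    by (rule integral_form_norm_square) (rule W12_L2, rule assms)
  ultimately show ?thesis unfolding energy_def by (simp only:)
qed

lemma L2_tendsto_0_integral:
  assumes "L2_tendsto M F (\<lambda>x. 0)" "\<And>n. L2_fun M (F n)"
  shows "(\<lambda>n. \<integral>x. (F n x)\<^sup>2 \<partial>M) \<longlonglongrightarrow> 0"
proof -
  have "(\<integral>\<^sup>+x. ennreal ((F n x - 0)\<^sup>2) \<partial>M) = ennreal (\<integral>x. (F n x)\<^sup>2 \<partial>M)" for n
    using assms(2)[of n] by (simp add: L2_fun_def nn_integral_eq_integral)
  then have "(\<lambda>n. ennreal (\<integral>x. (F n x)\<^sup>2 \<partial>M)) \<longlonglongrightarrow> ennreal 0"
    using assms(1) unfolding L2_tendsto_def by simp
  then show ?thesis by (rule tendsto_ennrealD) auto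
qed

lemma has_trace_sum:
  assumes "open \<Omega>" "bounded \<Omega>" "finite I" "I \<noteq> {}" "\<And>i. i \<in> I \<Longrightarrow> has_trace \<Omega> (u i) (g i)"
  shows "has_trace \<Omega> (\<lambda>x. \<Sum>i\<in>I. u i x) (\<lambda>x. \<Sum>i\<in>I. g i x)"
  using assms(3-5)
proof (induction I rule: finite_ne_induct)
  case (insert i I)
  then have "has_trace \<Omega> (\<lambda>x. u i x + 1 * (\<Sum>i\<in>I. u i x)) (\<lambda>x. g i x + 1 * (\<Sum>i\<in>I. g i x))"
    by (intro has_trace_add assms(1,2)) auto
  with insert show ?case by simp
qed simp

text \<open>Quarter radii are used because the bumps of radius r/2 equal 1 there. Indexing by
  numbers provides the order in which the partition functions are built.\<close>

lemma finite_chart_cover: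
  fixes \<Omega> :: "'a::euclidean_space set"
  assumes "bounded \<Omega>" "smooth_boundary \<Omega>"
  obtains N :: nat and p r e \<gamma> where "\<And>i. i < N \<Longrightarrow> boundary_graph \<Omega> (p i) (r i) (e i) (\<gamma> i)"
    "frontier \<Omega> \<subseteq> (\<Union>i<N. ball (p i) (r i / 4))"
proof -
  have "\<forall>q\<in>frontier \<Omega>. \<exists>c. boundary_graph \<Omega> q (fst c) (fst (snd c)) (snd (snd c))"
    using assms(2) unfolding smooth_boundary_def by (metis fst_conv snd_conv)
  then obtain c where c: "\<And>q. q \<in> frontier \<Omega> \<Longrightarrow> boundary_graph \<Omega> q (fst (c q)) (fst (snd (c q))) (snd (snd (c q)))"
    by metis
  have pos: "0 < fst (c q)" if "q \<in> frontier \<Omega>" for q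
    using c[OF that] by (simp add: boundary_graph_def)
  have "compact (frontier \<Omega>)" using assms(1) by (rule compact_frontier_bounded)
  then obtain D where D: "D \<subseteq> frontier \<Omega>" "finite D" "frontier \<Omega> \<subseteq> (\<Union>q\<in>D. ball q (fst (c q) / 4))"
    by (rule compactE_image[of _ "frontier \<Omega>" "\<lambda>q. ball q (fst (c q) / 4)"]) (use pos in force)+
  obtain f where f: "bij_betw f {0..<card D} D" using ex_bij_betw_nat_finite[OF D(2)] by blast
  then have im: "f ` {..<card D} = D" by (simp add: bij_betw_def lessThan_atLeast0)
  show ?thesis
  proof (rule that[of "card D" f "\<lambda>i. fst (c (f i))" "\<lambda>i. fst (snd (c (f i)))" "\<lambda>i. snd (snd (c (f i)))"])
    show "boundary_graph \<Omega> (f i) (fst (c (f i))) (fst (snd (c (f i)))) (snd (snd (c (f i))))" if "i < card D" for i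
      using that im D(1) by (intro c) auto
    show "frontier \<Omega> \<subseteq> (\<Union>i<card D. ball (f i) (fst (c (f i)) / 4))"
    proof
      fix x assume "x \<in> frontier \<Omega>"
      then obtain q where q: "q \<in> D" "x \<in> ball q (fst (c q) / 4)" using D(3) by blast
      then obtain i where "i < card D" "q = f i" using im by blast
      with q show "x \<in> (\<Union>i<card D. ball (f i) (fst (c (f i)) / 4))" by blast
    qed
  qed
qed

section \<open>Gluing the charts by a partition of unity near the boundary\<close>

locale boundary_cover =
  fixes \<Omega> :: "'a::euclidean_space set" and N :: nat and p :: "nat \<Rightarrow> 'a" and r :: "nat \<Rightarrow> real"
    and e :: "nat \<Rightarrow> 'a" and \<gamma> :: "nat \<Rightarrow> 'a \<Rightarrow> real"
  assumes open_domain: "open \<Omega>" and bounded_domain: "bounded \<Omega>"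
    and charts: "\<And>i. i < N \<Longrightarrow> boundary_graph \<Omega> (p i) (r i) (e i) (\<gamma> i)"
    and cover: "frontier \<Omega> \<subseteq> (\<Union>i<N. ball (p i) (r i / 4))"
begin

abbreviation (input) "vol \<equiv> lebesgue_on \<Omega>"

abbreviation (input) "surf \<equiv> surface_measure \<Omega>"

lemma chart: "i < N \<Longrightarrow> boundary_chart \<Omega> (p i) (r i) (e i) (\<gamma> i)"
  by unfold_locales (use charts open_domain in auto)

abbreviation height :: "nat \<Rightarrow> 'a \<Rightarrow> real" where
  "height i \<equiv> boundary_chart.height (e i) (\<gamma> i)"

text \<open>The usual construction without division: the sum telescopes to 1 minus the product of
  all \<open>1 - bump\<close>, and on the frontier some bump equals 1.\<close>

definition part :: "nat \<Rightarrow> 'a \<Rightarrow> real" where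
  "part i x = bump (p i) (r i / 2) x * (\<Prod>l<i. 1 - bump (p l) (r l / 2) x)"

text \<open>These are the functions \<open>\<Psi>\<^sub>n\<close>. On the frontier all heights that
  count are 0, so the sum reduces to that of the partition functions, which is 1.
  \<open>Suc n\<close> keeps the scaling factor positive.\<close>

definition cutoff :: "nat \<Rightarrow> 'a \<Rightarrow> real" where
  "cutoff n x = (\<Sum>i<N. part i x * cut_off (real (Suc n) * height i x))"

lemma smooth_part: "smooth_fun (part i)"
  unfolding part_def
  by (intro smooth_fun_mult smooth_fun_prod smooth_fun_diff smooth_fun_const smooth_fun_bump)

lemma smooth_height: "i < N \<Longrightarrow> smooth_fun (height i)"
  by (rule boundary_chart.smooth_height[OF chart])

lemma smooth_scaled_height: "i < N \<Longrightarrow> smooth_fun (\<lambda>x. c * height i x)"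
  by (intro smooth_fun_mult smooth_fun_const smooth_height)

lemma smooth_cutoff: "smooth_fun (cutoff n)"
  unfolding cutoff_def
  by (intro smooth_fun_sum smooth_fun_mult smooth_part smooth_fun_compose[OF smooth_real_cut_off]
      smooth_scaled_height) auto

lemma radius_pos: "i < N \<Longrightarrow> 0 < r i"
  by (rule boundary_chart.r_pos[OF chart])

lemma part_outside: "i < N \<Longrightarrow> r i / 2 < dist (p i) x \<Longrightarrow> part i x = 0"
  using bump_outside[of "r i / 2" x "p i"] radius_pos[of i]
  by (simp add: part_def dist_norm norm_minus_commute)

lemma part_outside_ball: "i < N \<Longrightarrow> x \<notin> ball (p i) (r i) \<Longrightarrow> part i x = 0"
  using part_outside[of i x] radius_pos[of i] by simp

lemma sum_part: "(\<Sum>i<n. part i x) = 1 - (\<Prod>l<n. 1 - bump (p l) (r l / 2) x)"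
  by (induction n) (simp_all add: part_def algebra_simps)

lemma sum_part_frontier: "x \<in> frontier \<Omega> \<Longrightarrow> (\<Sum>i<N. part i x) = 1"
proof -
  assume "x \<in> frontier \<Omega>"
  then obtain l where l: "l < N" "x \<in> ball (p l) (r l / 4)" using cover by auto
  then have "bump (p l) (r l / 2) x = 1"
    using radius_pos[of l] by (intro bump_inside) (auto simp: dist_norm norm_minus_commute)
  then have "(\<Prod>l<N. 1 - bump (p l) (r l / 2) x) = 0" using l(1) by (intro prod_zero) auto
  then show ?thesis by (simp add: sum_part)
qed

lemma cutoff_frontier: assumes x: "x \<in> frontier \<Omega>" shows "cutoff n x = 1"
proof -
  have "part i x * cut_off (real (Suc n) * height i x) = part i x" if "i < N" for i
  proof (cases "x \<in> ball (p i) (r i)")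
    case True
    then have "height i x = 0" using boundary_chart.mem_frontier[OF chart[OF that] True] x by simp
    then show ?thesis by simp
  qed (simp add: part_outside_ball[OF that])
  then have "cutoff n x = (\<Sum>i<N. part i x)" unfolding cutoff_def by (intro sum.cong) auto
  then show ?thesis using sum_part_frontier[OF x] by simp
qed

lemma cutoff_L2_tendsto:
  assumes w: "L2_fun vol w"
  shows "L2_tendsto vol (\<lambda>n x. cutoff n x * w x) (\<lambda>x. 0)"
proof -
  have *: "L2_fun vol (\<lambda>x. part i x * w x)" for i
    by (rule L2_fun_smooth_mult[OF bounded_domain smooth_part w])
  have "L2_tendsto vol (\<lambda>n x. \<Sum>i<N. cut_off (real (Suc n) * height i x) * (part i x * w x)) (\<lambda>x. \<Sum>i<N. 0)"
  proof (rule L2_tendsto_sum)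
    fix i assume "i \<in> {..<N}"
    then have i: "i < N" by simp
    show "L2_tendsto vol (\<lambda>n x. cut_off (real (Suc n) * height i x) * (part i x * w x)) (\<lambda>x. 0)"
      by (rule boundary_chart.cut_off_L2_tendsto[OF chart[OF i] *]) (simp add: part_outside_ball[OF i])
    show "(\<lambda>x. cut_off (real (Suc n) * height i x) * (part i x * w x)) \<in> borel_measurable vol" for n
      by (intro borel_measurable_times smooth_lebesgue_on smooth_fun_compose[OF smooth_real_cut_off]
          smooth_scaled_height i smooth_part L2_measurable w)
  qed simp
  moreover have "cutoff n x * w x = (\<Sum>i<N. cut_off (real (Suc n) * height i x) * (part i x * w x))" for n x
    unfolding cutoff_def sum_distrib_right by (simp only: mult_ac)
  ultimately show ?thesis by (simp del: of_nat_Suc)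
qed

lemma partial_deriv_cutoff:
  "partial_deriv b (cutoff n) x = (\<Sum>i<N. cut_off (real (Suc n) * height i x) * partial_deriv b (part i) x +
    real (Suc n) * deriv cut_off (real (Suc n) * height i x) * (part i x * partial_deriv b (height i) x))"
proof -
  have c: "smooth_fun (\<lambda>x. cut_off (real (Suc n) * height i x))" if "i < N" for i
    by (intro smooth_fun_compose[OF smooth_real_cut_off] smooth_scaled_height that)
  have "partial_deriv b (\<lambda>x. cut_off (real (Suc n) * height i x)) x
      = deriv cut_off (real (Suc n) * height i x) * (real (Suc n) * partial_deriv b (height i) x)" if "i < N" for i
    using partial_deriv_compose(2)[OF smooth_differentiable[OF smooth_scaled_height[OF that]]
        smooth_real_DERIV[OF smooth_real_cut_off], where b = b]
    by (simp add: partial_deriv_mult smooth_differentiable smooth_height that del: of_nat_Suc)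
  then have "partial_deriv b (\<lambda>x. part i x * cut_off (real (Suc n) * height i x)) x
      = cut_off (real (Suc n) * height i x) * partial_deriv b (part i) x +
        real (Suc n) * deriv cut_off (real (Suc n) * height i x) * (part i x * partial_deriv b (height i) x)"
    if "i < N" for i
    using that by (subst partial_deriv_mult)
      (simp_all add: smooth_differentiable smooth_part c mult_ac del: of_nat_Suc)
  then have "(\<Sum>i<N. partial_deriv b (\<lambda>x. part i x * cut_off (real (Suc n) * height i x)) x)
      = (\<Sum>i<N. cut_off (real (Suc n) * height i x) * partial_deriv b (part i) x +
        real (Suc n) * deriv cut_off (real (Suc n) * height i x) * (part i x * partial_deriv b (height i) x))"
    by (intro sum.cong) auto
  moreover have "(\<lambda>x. part i x * cut_off (real (Suc n) * height i x)) differentiable (at x)" if "i \<in> {..<N}" for i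
    using that by (intro smooth_differentiable smooth_fun_mult smooth_part c) auto
  ultimately show ?thesis unfolding cutoff_def by (simp only: partial_deriv_sum)
qed

text \<open>In the chart, the differential \<open>e - gradient (\<gamma> i) x\<close> of the height
  is a negative multiple of the outer normal, and the wedge is linear in the covector.\<close>

lemma wedge_trace_zero:
  fixes g :: "'a \<Rightarrow> 'a form"
  assumes i: "i < N" and wedge: "AE x in surf. wedge_covector (outer_normal \<Omega> x) (g x) = (\<lambda>vs. 0)"
  shows "AE x in surf. part i x * wedge_covector (e i - gradient (\<gamma> i) x) (g x) cs = 0"
  using wedge AE_space
proof eventually_elim
  case (elim x)
  show ?case
  proof (cases "x \<in> ball (p i) (r i)")
    case True
    have x: "x \<in> frontier \<Omega>" using elim by (simp add: space_surface_measure)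
    let ?v = "gradient (\<gamma> i) x - e i"
    have "outer_normal \<Omega> x = sgn ?v" by (rule outer_normal_eq[OF open_domain charts[OF i] True x])
    then have "e i - gradient (\<gamma> i) x = (- norm ?v) *\<^sub>R outer_normal \<Omega> x"
      by (cases "?v = 0") (simp_all add: sgn_div_norm)
    then show ?thesis using elim(1) by (simp only: wedge_covector_scaleR)
  qed (simp add: part_outside_ball[OF i])
qed

text \<open>On basis tuples the wedge is a linear combination of components of the form, with
  coefficients that are derivatives of the height and thus smooth on the whole space; traces are
  compatible with such combinations.\<close>

lemma has_trace_wedge:
  assumes i: "i < N" and cs: "cs \<in> basis_tuples (Suc m)"
    and tr: "\<And>bs. bs \<in> basis_tuples m \<Longrightarrow> has_trace \<Omega> (\<lambda>x. \<omega> x bs) (\<lambda>x. g x bs)"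
  shows "has_trace \<Omega> (\<lambda>x. wedge_covector (e i - gradient (\<gamma> i) x) (\<omega> x) cs)
    (\<lambda>x. wedge_covector (e i - gradient (\<gamma> i) x) (g x) cs)"
proof -
  have len: "length cs = Suc m" using cs by (simp add: basis_tuples_def)
  have eq: "wedge_covector (e i - gradient (\<gamma> i) x) \<alpha> cs
      = (\<Sum>j<Suc m. ((-1) ^ j * partial_deriv (cs ! j) (height i) x) * \<alpha> (omit j cs))" for x \<alpha>
    unfolding wedge_covector_def len boundary_chart.partial_deriv_height[OF chart[OF i]]
    by (simp add: inner_commute)
  show ?thesis unfolding eq
    using basis_tuples_omit[OF cs] basis_tuples_nth[OF cs]
    by (intro has_trace_sum has_trace_mult open_domain bounded_domain tr smooth_fun_mult smooth_fun_const
        smooth_fun_partial smooth_height i) auto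
qed

text \<open>By the product rule, d(\<Psi> \<omega>) consists of \<Psi> d\<omega>, of terms whose
  derivative falls on \<open>part i\<close>, and of terms whose derivative falls on the steep
  factor. The first two kinds tend to 0 by dominated convergence, the third by
  \<open>hardy_trace\<close>.\<close>

lemma ext_deriv_cutoff_L2_tendsto:
  assumes hm: "hausdorff_additive TYPE('a)"
    and tr: "\<And>bs. bs \<in> basis_tuples m \<Longrightarrow> has_trace \<Omega> (\<lambda>x. \<omega> x bs) (\<lambda>x. g x bs)"
    and wedge: "AE x in surf. wedge_covector (outer_normal \<Omega> x) (g x) = (\<lambda>vs. 0)"
    and cs: "cs \<in> basis_tuples (Suc m)"
  shows "L2_tendsto vol (\<lambda>n x. ext_deriv \<Omega> (\<lambda>x vs. cutoff n x * \<omega> x vs) x cs) (\<lambda>x. 0)"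
proof -
  let ?M = "vol"
  note O = open_domain bounded_domain
  have W: "W12 \<Omega> (\<lambda>x. \<omega> x bs)" if "bs \<in> basis_tuples m" for bs
    using tr[OF that] by (simp add: has_trace_def)
  have len: "length cs = Suc m" using cs by (simp add: basis_tuples_def)
  note nth = basis_tuples_nth[OF cs] and om = basis_tuples_omit[OF cs]
  \<comment> \<open>Evaluated at \<open>cs\<close>, \<open>D\<close> is d\<omega>,
    \<open>E i\<close> is d(part i) \<and> \<omega>, and \<open>V i\<close> is ds \<and> \<omega>
    with s the height in chart i.\<close>
  define D where "D x = (\<Sum>j<Suc m. (-1) ^ j * weak_partial \<Omega> (cs ! j) (\<lambda>y. \<omega> y (omit j cs)) x)" for x
  define E where "E i x = (\<Sum>j<Suc m. (-1) ^ j * (partial_deriv (cs ! j) (part i) x * \<omega> x (omit j cs)))" for i x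
  define V where "V i x = wedge_covector (e i - gradient (\<gamma> i) x) (\<omega> x) cs" for i x
  have V: "V i x = (\<Sum>j<Suc m. (-1) ^ j * (partial_deriv (cs ! j) (height i) x * \<omega> x (omit j cs)))" if "i < N" for i x
    unfolding V_def wedge_covector_def len boundary_chart.partial_deriv_height[OF chart[OF that]]
    by (simp add: inner_commute mult.assoc)
  have D2: "L2_fun ?M D" unfolding D_def
    by (intro L2_fun_sum L2_fun_cmult weak_partial_L2 W om nth) auto
  have E2: "L2_fun ?M (E i)" for i unfolding E_def
    by (intro L2_fun_sum L2_fun_cmult L2_fun_smooth_mult O smooth_fun_partial smooth_part W12_L2 W om nth) auto
  have tw: "has_trace \<Omega> (V i) (\<lambda>x. wedge_covector (e i - gradient (\<gamma> i) x) (g x) cs)" if "i < N" for i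
    unfolding V_def by (rule has_trace_wedge[OF that cs]) (rule tr)
  then have VW: "W12 \<Omega> (V i)" if "i < N" for i using that unfolding has_trace_def by blast
  have E_out: "E i x = 0" if i: "i < N" and "x \<notin> ball (p i) (r i)" for i x
  proof -
    have "partial_deriv b (part i) x = 0" for b
      using boundary_chart.partial_deriv_outside[OF chart[OF i], of "r i / 2" "part i" x b]
        radius_pos[OF i] part_outside[OF i] smooth_part that by simp
    then show ?thesis by (simp add: E_def)
  qed
  let ?k = "\<lambda>n i x. cut_off (real (Suc n) * height i x)"
  let ?k' = "\<lambda>n i x. real (Suc n) * deriv cut_off (real (Suc n) * height i x)"
  let ?T = "\<lambda>n x. \<Sum>i<N. ?k n i x * E i x + ?k' n i x * (part i x * V i x)"
  have sk: "smooth_fun (\<lambda>x. ?k n i x)" "smooth_fun (\<lambda>x. ?k' n i x)" if "i < N" for n i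
    by (intro smooth_fun_mult smooth_fun_const smooth_fun_compose[OF smooth_real_cut_off]
        smooth_fun_compose[OF smooth_real_deriv[OF smooth_real_cut_off]] smooth_scaled_height that)+
  have sum_eq: "(\<Sum>j<Suc m. (-1) ^ j * (partial_deriv (cs ! j) (cutoff n) x * \<omega> x (omit j cs)))
      = ?T n x" for n x
  proof -
    have "(\<Sum>j<Suc m. (-1) ^ j * (partial_deriv (cs ! j) (cutoff n) x * \<omega> x (omit j cs)))
        = (\<Sum>j<Suc m. \<Sum>i<N. ?k n i x * ((-1) ^ j * (partial_deriv (cs ! j) (part i) x * \<omega> x (omit j cs)))
          + ?k' n i x * (part i x * ((-1) ^ j * (partial_deriv (cs ! j) (height i) x * \<omega> x (omit j cs)))))"
      unfolding partial_deriv_cutoff sum_distrib_right sum_distrib_left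
      by (intro sum.cong refl) (simp only: distrib_left distrib_right mult_ac)
    also have "\<dots> = (\<Sum>i<N. \<Sum>j<Suc m. ?k n i x * ((-1) ^ j * (partial_deriv (cs ! j) (part i) x * \<omega> x (omit j cs)))
          + ?k' n i x * (part i x * ((-1) ^ j * (partial_deriv (cs ! j) (height i) x * \<omega> x (omit j cs)))))"
      by (rule sum.swap)
    also have "\<dots> = ?T n x"
      by (intro sum.cong refl) (simp only: V lessThan_iff E_def sum.distrib sum_distrib_left[symmetric])
    finally show ?thesis .
  qed
  have ae: "AE x in ?M. cutoff n x * D x + ?T n x
      = ext_deriv \<Omega> (\<lambda>x vs. cutoff n x * \<omega> x vs) x cs" for n
  proof -
    have "AE x in ?M. \<forall>j\<in>{..<Suc m}. weak_partial \<Omega> (cs ! j) (\<lambda>y. cutoff n y * \<omega> y (omit j cs)) x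
        = cutoff n x * weak_partial \<Omega> (cs ! j) (\<lambda>y. \<omega> y (omit j cs)) x
          + partial_deriv (cs ! j) (cutoff n) x * \<omega> x (omit j cs)"
      by (intro AE_finite_allI weak_partial_mult O W om smooth_cutoff nth) auto
    then show ?thesis
    proof eventually_elim
      case (elim x)
      have "ext_deriv \<Omega> (\<lambda>x vs. cutoff n x * \<omega> x vs) x cs
          = (\<Sum>j<Suc m. cutoff n x * ((-1) ^ j * weak_partial \<Omega> (cs ! j) (\<lambda>y. \<omega> y (omit j cs)) x)
          + (-1) ^ j * (partial_deriv (cs ! j) (cutoff n) x * \<omega> x (omit j cs)))"
        unfolding ext_deriv_basis[OF cs] using elim
        by (intro sum.cong refl) (simp add: algebra_simps)
      then show ?case
        unfolding sum.distrib sum_distrib_left[symmetric] sum_eq D_def[symmetric] by simp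
    qed
  qed
  have P1: "L2_tendsto ?M (\<lambda>n x. ?k n i x * E i x) (\<lambda>x. 0)" if i: "i < N" for i
    by (rule boundary_chart.cut_off_L2_tendsto[OF chart[OF i] E2 E_out[OF i]])
  have P2: "L2_tendsto ?M (\<lambda>n x. ?k' n i x * (part i x * V i x)) (\<lambda>x. 0)" if i: "i < N" for i
  proof (rule boundary_chart.hardy_trace[OF chart[OF i] hm bounded_domain _ smooth_part, of _ _ "r i / 2"])
    show "has_trace \<Omega> (V i) (\<lambda>x. wedge_covector (e i - gradient (\<gamma> i) x) (g x) cs)"
      by (rule tw[OF i])
    show "AE x in surf. part i x * wedge_covector (e i - gradient (\<gamma> i) x) (g x) cs = 0"
      by (rule wedge_trace_zero[OF i wedge])
  qed (use radius_pos[OF i] part_outside[OF i] in auto)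
  have meas: "(\<lambda>x. ?k n i x * E i x) \<in> borel_measurable ?M"
      "(\<lambda>x. ?k' n i x * (part i x * V i x)) \<in> borel_measurable ?M" if i: "i < N" for n i
    by (intro borel_measurable_times smooth_lebesgue_on sk smooth_part i L2_measurable E2 W12_L2 VW)+
  have S: "L2_tendsto ?M ?T (\<lambda>x. \<Sum>i<N. 0 + 0)"
    by (intro L2_tendsto_sum L2_tendsto_add P1 P2 meas borel_measurable_add borel_measurable_const) auto
  have Sm: "?T n \<in> borel_measurable ?M" for n
    by (intro borel_measurable_sum borel_measurable_add meas) auto
  have Dm: "(\<lambda>x. cutoff n x * D x) \<in> borel_measurable ?M" for n
    by (intro borel_measurable_times smooth_lebesgue_on smooth_cutoff L2_measurable D2)
  have "L2_tendsto ?M (\<lambda>n x. cutoff n x * D x + ?T n x)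
      (\<lambda>x. 0 + (\<Sum>i<N. 0 + 0))"
    by (rule L2_tendsto_add[OF Dm Sm _ _ cutoff_L2_tendsto[OF D2] S]) simp_all
  then show ?thesis by (rule L2_tendsto_cong[OF _ _ ae]) simp
qed

end

section \<open>Competitors, vanishing energy and the contradiction\<close>

lemma (in boundary_cover) trace_of_zero_frontier:
  assumes hm: "hausdorff_additive TYPE('a)"
    and tr: "has_trace \<Omega> v h" and zero: "AE x in vol. v x = 0"
  shows "AE x in surf. h x = 0"
proof -
  have "AE x in surf. \<forall>i\<in>{..<N}. x \<in> ball (p i) (r i / 4) \<longrightarrow> h x = 0"
    by (intro AE_finite_allI boundary_chart.trace_of_zero_localised[OF chart hm bounded_domain tr zero]) auto
  then show ?thesis using AE_space
  proof eventually_elim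
    case (elim x)
    then show ?case using cover by (auto simp: space_surface_measure)
  qed
qed

text \<open>Multiplying by the cut-off subtracts (1 - \<Psi>) \<omega>, whose trace (1 - \<Psi>) g
  is 0 because \<Psi> = 1 on the frontier.\<close>

lemma (in boundary_cover) cutoff_admissible:
  assumes \<omega>: "W12_form m \<Omega> \<omega>" "has_form_trace m \<Omega> \<omega> g" and \<phi>: "W12_0_form m \<Omega> \<phi>"
    and eq: "\<omega> = (\<lambda>x vs. \<omega>\<^sub>0 x vs + \<phi> x vs)"
  shows "(\<lambda>x vs. cutoff n x * \<omega> x vs) \<in> admissible m \<Omega> \<omega>\<^sub>0"
proof -
  note O = open_domain bounded_domain
  define \<psi> where "\<psi> x vs = \<phi> x vs + (-1) * ((1 - cutoff n x) * \<omega> x vs)" for x vs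
  have s: "smooth_fun (\<lambda>x. 1 - cutoff n x)"
    by (intro smooth_fun_diff smooth_fun_const smooth_cutoff)
  have tr: "has_trace \<Omega> (\<lambda>x. \<psi> x bs) (\<lambda>x. 0)" if bs: "bs \<in> basis_tuples m" for bs
  proof (rule has_trace_cong[OF O])
    show "has_trace \<Omega> (\<lambda>x. \<psi> x bs) (\<lambda>x. 0 + (-1) * ((1 - cutoff n x) * g x bs))"
      unfolding \<psi>_def using bs \<omega>(2) \<phi>
      by (intro has_trace_add has_trace_mult O s) (auto simp: W12_0_form_def has_form_trace_def)
  qed (simp add: cutoff_frontier)
  have "alt_form m (\<psi> x)" if x: "x \<in> \<Omega>" for x
  proof -
    have "alt_form m (\<phi> x)" "alt_form m (\<omega> x)"
      using x \<omega>(1) \<phi> by (auto simp: W12_0_form_def W12_form_def)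
    from alt_form_add[OF this, of "- (1 - cutoff n x)"]
    have "alt_form m (\<lambda>vs. \<phi> x vs + - (1 - cutoff n x) * \<omega> x vs)" .
    moreover have "(\<lambda>vs. \<phi> x vs + - (1 - cutoff n x) * \<omega> x vs) = \<psi> x"
      by (intro ext) (simp add: \<psi>_def algebra_simps)
    ultimately show ?thesis by (simp only:)
  qed
  then have "W12_form m \<Omega> \<psi>" using tr by (auto simp: W12_form_def has_trace_def)
  then have "W12_0_form m \<Omega> \<psi>" using tr by (simp add: W12_0_form_def has_form_trace_def alt_form_zero)
  moreover have "(\<lambda>x vs. cutoff n x * \<omega> x vs) = (\<lambda>x vs. \<omega>\<^sub>0 x vs + \<psi> x vs)"
    by (intro ext) (simp add: \<psi>_def eq algebra_simps)
  ultimately show ?thesis unfolding admissible_def by blast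
qed

lemma (in boundary_cover) energy_cutoff_tendsto:
  assumes hm: "hausdorff_additive TYPE('a)"
    and tr: "\<And>bs. bs \<in> basis_tuples m \<Longrightarrow> has_trace \<Omega> (\<lambda>x. \<omega> x bs) (\<lambda>x. g x bs)"
    and wedge: "AE x in surf. wedge_covector (outer_normal \<Omega> x) (g x) = (\<lambda>vs. 0)"
  shows "(\<lambda>n. energy m \<Omega> (\<lambda>x vs. cutoff n x * \<omega> x vs)) \<longlonglongrightarrow> 0"
proof -
  note O = open_domain bounded_domain
  have W: "W12 \<Omega> (\<lambda>x. \<omega> x bs)" if "bs \<in> basis_tuples m" for bs
    using tr[OF that] by (simp add: has_trace_def)
  have W': "W12 \<Omega> (\<lambda>x. cutoff n x * \<omega> x bs)" if "bs \<in> basis_tuples m" for n bs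
    by (rule W12_mult[OF O W[OF that] smooth_cutoff])
  have 1: "(\<lambda>n. \<integral>x. (ext_deriv \<Omega> (\<lambda>x vs. cutoff n x * \<omega> x vs) x cs)\<^sup>2 \<partial>vol) \<longlonglongrightarrow> 0"
    if cs: "cs \<in> basis_tuples (Suc m)" for cs
  proof (rule L2_tendsto_0_integral)
    show "L2_tendsto vol (\<lambda>n x. ext_deriv \<Omega> (\<lambda>x vs. cutoff n x * \<omega> x vs) x cs) (\<lambda>x. 0)"
      by (rule ext_deriv_cutoff_L2_tendsto[OF hm _ wedge cs]) (rule tr)
    show "L2_fun vol (\<lambda>x. ext_deriv \<Omega> (\<lambda>x vs. cutoff n x * \<omega> x vs) x cs)" for n
      by (rule ext_deriv_L2[OF _ cs]) (rule W')
  qed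
  have 2: "(\<lambda>n. \<integral>x. (cutoff n x * \<omega> x bs)\<^sup>2 \<partial>vol) \<longlonglongrightarrow> 0"
    if bs: "bs \<in> basis_tuples m" for bs
    by (intro L2_tendsto_0_integral cutoff_L2_tendsto W12_L2 W W' bs)
  let ?D = "\<lambda>n cs. \<integral>x. (ext_deriv \<Omega> (\<lambda>x vs. cutoff n x * \<omega> x vs) x cs)\<^sup>2 \<partial>vol"
  let ?I = "\<lambda>n bs. \<integral>x. (cutoff n x * \<omega> x bs)\<^sup>2 \<partial>vol"
  have "energy m \<Omega> (\<lambda>x vs. cutoff n x * \<omega> x vs) = 1 / 2 * (sum (?D n) (basis_tuples (Suc m)) / fact (Suc m))
      + 1 / 2 * (sum (?I n) (basis_tuples m) / fact m)" for n
    by (rule energy_eq) (rule W')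
  moreover have "(\<lambda>n. 1 / 2 * (sum (?D n) (basis_tuples (Suc m)) / fact (Suc m))
      + 1 / 2 * (sum (?I n) (basis_tuples m) / fact m))
    \<longlonglongrightarrow> 1 / 2 * ((\<Sum>cs\<in>(basis_tuples (Suc m) :: 'a list set). 0) / fact (Suc m))
      + 1 / 2 * ((\<Sum>bs\<in>(basis_tuples m :: 'a list set). 0) / fact m)"
    by (intro tendsto_add tendsto_mult tendsto_divide tendsto_sum tendsto_const 1 2) auto
  ultimately show ?thesis by simp
qed

text \<open>Both parts of the energy are nonnegative sums of squares, so each summand of the
  zero-order part has to vanish.\<close>

lemma energy_nonpos_AE_zero:
  assumes W: "\<And>bs. bs \<in> basis_tuples m \<Longrightarrow> W12 \<Omega> (\<lambda>x. \<omega> x bs)"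
    and le: "energy m \<Omega> \<omega> \<le> 0" and bs: "bs \<in> basis_tuples m"
  shows "AE x in lebesgue_on \<Omega>. \<omega> x bs = 0"
proof -
  let ?A = "(\<Sum>cs\<in>basis_tuples (Suc m). \<integral>x. (ext_deriv \<Omega> \<omega> x cs)\<^sup>2 \<partial>lebesgue_on \<Omega>) / fact (Suc m)"
  let ?S = "\<Sum>bs\<in>basis_tuples m. \<integral>x. (\<omega> x bs)\<^sup>2 \<partial>lebesgue_on \<Omega>"
  have "energy m \<Omega> \<omega> = 1 / 2 * ?A + 1 / 2 * (?S / fact m)" by (rule energy_eq) (rule W)
  moreover have "0 \<le> ?A" by (intro divide_nonneg_nonneg sum_nonneg) auto
  ultimately have "?S / fact m \<le> 0" using le by linarith
  then have "?S \<le> 0" using fact_gt_zero[of m, where 'a = real] by (auto simp: divide_le_0_iff)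
  moreover have "(\<integral>x. (\<omega> x bs)\<^sup>2 \<partial>lebesgue_on \<Omega>) \<le> ?S"
    by (rule member_le_sum[OF bs]) (auto simp: finite_basis_tuples)
  moreover have "0 \<le> (\<integral>x. (\<omega> x bs)\<^sup>2 \<partial>lebesgue_on \<Omega>)" by simp
  ultimately have "(\<integral>x. (\<omega> x bs)\<^sup>2 \<partial>lebesgue_on \<Omega>) = 0" by linarith
  moreover have "integrable (lebesgue_on \<Omega>) (\<lambda>x. (\<omega> x bs)\<^sup>2)"
    using W12_L2[OF W[OF bs]] by (simp add: L2_fun_def)
  ultimately have "AE x in lebesgue_on \<Omega>. (\<omega> x bs)\<^sup>2 = 0"
    by (subst (asm) integral_nonneg_eq_0_iff_AE) auto
  then show ?thesis by eventually_elim simp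
qed

theorem proposition6p1:
  fixes \<Omega> :: "'a::euclidean_space set"
    and k :: nat
    and \<omega>\<^sub>0 g :: "'a \<Rightarrow> 'a form"
  assumes "2 \<le> DIM('a)"
    and "2 \<le> k" and "k \<le> DIM('a)"
    and "open \<Omega>" and "bounded \<Omega>" and "smooth_boundary \<Omega>" and "contractible \<Omega>"
    and "W12_form (k - 1) \<Omega> \<omega>\<^sub>0"
    and "has_form_trace (k - 1) \<Omega> \<omega>\<^sub>0 g"
    and "AE x in surface_measure \<Omega>. wedge_covector (outer_normal \<Omega> x) (g x) = (\<lambda>vs. 0)"
    and "\<not> (AE x in surface_measure \<Omega>. g x = (\<lambda>vs. 0))"
  shows "\<not> (\<exists>\<omega>\<in>admissible (k - 1) \<Omega> \<omega>\<^sub>0.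
          \<forall>\<eta>\<in>admissible (k - 1) \<Omega> \<omega>\<^sub>0. energy (k - 1) \<Omega> \<omega> \<le> energy (k - 1) \<Omega> \<eta>)"
proof
  assume "\<exists>\<omega>\<in>admissible (k - 1) \<Omega> \<omega>\<^sub>0.
      \<forall>\<eta>\<in>admissible (k - 1) \<Omega> \<omega>\<^sub>0. energy (k - 1) \<Omega> \<omega> \<le> energy (k - 1) \<Omega> \<eta>"
  then obtain \<omega> \<phi> where \<omega>: "\<omega> = (\<lambda>x vs. \<omega>\<^sub>0 x vs + \<phi> x vs)" and \<phi>: "W12_0_form (k - 1) \<Omega> \<phi>"
      and min: "\<And>\<eta>. \<eta> \<in> admissible (k - 1) \<Omega> \<omega>\<^sub>0 \<Longrightarrow> energy (k - 1) \<Omega> \<omega> \<le> energy (k - 1) \<Omega> \<eta>"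
    unfolding admissible_def by blast
  \<comment> \<open>Otherwise the surface measure would be zero and every boundary property would
    hold almost everywhere, against the assumption that \<open>g\<close> is nonzero.\<close>
  have hm: "hausdorff_additive TYPE('a)"
    using surface_measure_degenerate assms(11) by blast
  obtain N :: nat and p r e \<gamma> where "\<And>i. i < N \<Longrightarrow> boundary_graph \<Omega> (p i) (r i) (e i) (\<gamma> i)"
      "frontier \<Omega> \<subseteq> (\<Union>i<N. ball (p i) (r i / 4))"
    by (rule finite_chart_cover[OF assms(5,6)]) (rule that)
  then interpret boundary_cover \<Omega> N p r e \<gamma>
    using assms(4,5) by unfold_locales
  \<comment> \<open>The minimizer inherits the trace \<open>g\<close>, because \<phi> has trace
    0.\<close>
  have tr: "has_trace \<Omega> (\<lambda>x. \<omega> x bs) (\<lambda>x. g x bs)" if "bs \<in> basis_tuples (k - 1)" for bs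
  proof -
    have "has_trace \<Omega> (\<lambda>x. \<omega>\<^sub>0 x bs + 1 * \<phi> x bs) (\<lambda>x. g x bs + 1 * 0)"
      using that assms(9) \<phi>
      by (intro has_trace_add assms(4,5)) (auto simp: has_form_trace_def W12_0_form_def)
    then show ?thesis by (simp add: \<omega>)
  qed
  have W: "W12 \<Omega> (\<lambda>x. \<omega> x bs)" if "bs \<in> basis_tuples (k - 1)" for bs
    using tr[OF that] by (simp add: has_trace_def)
  have "alt_form (k - 1) (\<omega> x)" if x: "x \<in> \<Omega>" for x
    using alt_form_add[of "k - 1" "\<omega>\<^sub>0 x" "\<phi> x" 1] x assms(8) \<phi>
    by (auto simp: \<omega> W12_form_def W12_0_form_def)
  then have W\<omega>: "W12_form (k - 1) \<Omega> \<omega>" using W by (simp add: W12_form_def)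
  have "has_form_trace (k - 1) \<Omega> \<omega> g" using assms(9) tr by (simp add: has_form_trace_def)
  \<comment> \<open>The competitors are cut-offs of the minimizer itself.\<close>
  then have "energy (k - 1) \<Omega> \<omega> \<le> energy (k - 1) \<Omega> (\<lambda>x vs. cutoff n x * \<omega> x vs)" for n
    by (intro min cutoff_admissible[OF W\<omega> _ \<phi> \<omega>])
  moreover have "(\<lambda>n. energy (k - 1) \<Omega> (\<lambda>x vs. cutoff n x * \<omega> x vs)) \<longlonglongrightarrow> 0"
    by (rule energy_cutoff_tendsto[OF hm _ assms(10)]) (rule tr)
  ultimately have "energy (k - 1) \<Omega> \<omega> \<le> 0"
    using LIMSEQ_le_const[of "\<lambda>n. energy (k - 1) \<Omega> (\<lambda>x vs. cutoff n x * \<omega> x vs)" 0] by blast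
  then have "AE x in surface_measure \<Omega>. g x bs = 0" if "bs \<in> basis_tuples (k - 1)" for bs
    using trace_of_zero_frontier[OF hm tr[OF that]] energy_nonpos_AE_zero[of "k - 1" \<Omega> \<omega> bs] W that by blast
  then have "AE x in surface_measure \<Omega>. \<forall>bs\<in>basis_tuples (k - 1). g x bs = 0"
    by (intro AE_finite_allI finite_basis_tuples)
  then have "AE x in surface_measure \<Omega>. g x = (\<lambda>vs. 0)"
    using AE_space
  proof eventually_elim
    case (elim x)
    then have "alt_form (k - 1) (g x)"
      using assms(9) by (simp add: has_form_trace_def space_surface_measure)
    then show ?case using elim(1) by (intro alt_form_eq_0) auto
  qed
  with assms(11) show False by blast
qed

end
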